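(* Let $\Omega$ be a compact open subset of $\mathbb{Q}_p$ with $\mathfrak{m}(\Omega)>0$. The following are equivalent: (a) $\Omega$ is a spectral set; (b) $\Omega$ is $p$-homogeneous; (c) $\Omega$ tiles $\mathbb{Q}_p$ by translation.
   Context: $p\ge 2$ is a prime. $\mathbb{Q}_p$ is the field of $p$-adic numbers and $\mathbb{Z}_p$ its ring of integers. $v_p$ is the $p$-adic valuation and $|x|_p=p^{-v_p(x)}$. $\mathfrak{m}$ is the Haar measure on $\mathbb{Q}_p$, normalized so that $\mathfrak{m}(\mathbb{Z}_p)=1$. For $a\in\mathbb{Q}_p$ and $n\in\mathbb{Z}$, $B(a,p^{n})=a+p^{-n}\mathbb{Z}_p$ is the closed ball of radius $p^n$. Characters: every $x\in\mathbb{Q}_p$ is written $x=\sum_{n\ge v_p(x)}a_np^n$ with $a_n\in\{0,\dots,p-1\}$. Its fractional part is $\{x\}=\sum_{n=v_p(x)}^{-1}a_np^n$ (an empty sum is $0$). Set $\chi(x)=e^{2\pi i\{x\}}$ and $\chi_y(x)=\chi(yx)$ for $y\in\mathbb{Q}_p$. Spectral set: a Borel set $\Omega$ with $0<\mathfrak{m}(\Omega)<\infty$ is spectral if there is $\Lambda\subset\mathbb{Q}_p$ such that $\{\chi_\lambda|_\Omega\}_{\lambda\in\Lambda}$ is an orthonormal basis of $L^2$ of the probability measure $\mathfrak{m}|_\Omega/\mathfrak{m}(\Omega)$. Such a $\Lambda$ is called a spectrum. Tiling: $\Omega$ tiles $\mathbb{Q}_p$ if there is $T\subset\mathbb{Q}_p$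 with $\sum_{t\in T}1_\Omega(x-t)=1$ for $\mathfrak{m}$-a.e. $x$. Such a $T$ is called a tiling complement. $p$-homogeneity: for a compact open set $\Omega$ and $n\in\mathbb{Z}$, let $\mathcal{N}_n(\Omega)$ be the set of balls of radius $p^{-n}$ that meet $\Omega$. $\Omega$ is $p$-homogeneous if for every $n\in\mathbb{Z}$ one of the following holds: every ball in $\mathcal{N}_n(\Omega)$ contains exactly one ball of $\mathcal{N}_{n+1}(\Omega)$, or every ball in $\mathcal{N}_n(\Omega)$ contains exactly $p$ balls of $\mathcal{N}_{n+1}(\Omega)$. Equivalently, in the finite tree of balls meeting $\Omega$ (edges from a ball to its sub-balls of $1/p$ the radius), the number of children of a vertex depends only on its radius and is $1$ or $p$. *)

theory Defs
  imports "HOL-Analysis.Analysis"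
begin

text \<open>Concrete model of the p-adic numbers.  An element x of Q_p is represented by the
family of its residues modulo p^n Z_p, for all integers n: the component x n is the unique
rational number in [0, p^n) with denominator a power of p that is congruent to x modulo
p^n Z_p (i.e. the sum of the digits a_k p^k for k < n).  The family is compatible, lies in
[0,p^n), and vanishes for all sufficiently negative n (x lies in p^N Z_p for some N).\<close>

definition qmod :: "nat \<Rightarrow> rat \<Rightarrow> int \<Rightarrow> rat" where
  "qmod p q n = q - (of_nat p) powi n * of_int \<lfloor>q / (of_nat p) powi n\<rfloor>"

definition Qp :: "nat \<Rightarrow> (int \<Rightarrow> rat) set" where
  "Qp p = {x. (\<forall>n. 0 \<le> x n \<and> x n < (of_nat p) powi n)
             \<and> (\<forall>n. x n = qmod p (x (n + 1)) n)
             \<and> (\<exists>N. \<forall>n\<le>N. x n = 0)}"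

definition psub :: "nat \<Rightarrow> (int \<Rightarrow> rat) \<Rightarrow> (int \<Rightarrow> rat) \<Rightarrow> (int \<Rightarrow> rat)" where
  "psub p x y = (\<lambda>n. qmod p (x n - y n) n)"

definition pmul :: "nat \<Rightarrow> (int \<Rightarrow> rat) \<Rightarrow> (int \<Rightarrow> rat) \<Rightarrow> (int \<Rightarrow> rat)" where
  "pmul p x y = (\<lambda>n. THE c. \<exists>M. \<forall>m\<ge>M. qmod p (x m * y m) n = c)"

text \<open>Fractional part {x} = x 0, character chi and chi_y.\<close>

definition pchi :: "nat \<Rightarrow> (int \<Rightarrow> rat) \<Rightarrow> complex" where
  "pchi p x = cis (2 * pi * real_of_rat (x 0))"

definition pchi_y :: "nat \<Rightarrow> (int \<Rightarrow> rat) \<Rightarrow> (int \<Rightarrow> rat) \<Rightarrow> complex" where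
  "pchi_y p y x = pchi p (pmul p y x)"

text \<open>Closed ball B(a, p^n) = a + p^(-n) Z_p: the points with the same residue modulo p^(-n).\<close>

definition qp_ball :: "nat \<Rightarrow> (int \<Rightarrow> rat) \<Rightarrow> int \<Rightarrow> (int \<Rightarrow> rat) set" where
  "qp_ball p a n = {x \<in> Qp p. x (- n) = a (- n)}"

definition qp_topology :: "nat \<Rightarrow> (int \<Rightarrow> rat) topology" where
  "qp_topology p = topology (\<lambda>U. U \<subseteq> Qp p \<and> (\<forall>x\<in>U. \<exists>n. qp_ball p x n \<subseteq> U))"

text \<open>Haar measure: Borel sigma-algebra generated by the open sets, with the outer measure
given by countable covers by balls, a ball of radius p^n having mass p^n (so m(Z_p) = 1).\<close>

definition qp_outer :: "nat \<Rightarrow> (int \<Rightarrow> rat) set \<Rightarrow> ennreal" where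
  "qp_outer p A = (INF c \<in> {(a, r). (\<forall>i. a i \<in> Qp p) \<and> A \<subseteq> (\<Union>i. qp_ball p (a i) (r i))}.
                      (\<Sum>i. ennreal ((real p) powr (real_of_int (snd c i)))))"

definition haar :: "nat \<Rightarrow> (int \<Rightarrow> rat) measure" where
  "haar p = measure_of (Qp p) {U. openin (qp_topology p) U} (qp_outer p)"

text \<open>Spectral sets: the restricted characters form an orthonormal basis (orthonormal and
complete) of L^2 of the normalized restriction of the Haar measure.\<close>

definition spectral_set :: "nat \<Rightarrow> (int \<Rightarrow> rat) set \<Rightarrow> bool" where
  "spectral_set p \<Omega> \<longleftrightarrow>
     \<Omega> \<in> sets (haar p) \<and> 0 < emeasure (haar p) \<Omega> \<and> emeasure (haar p) \<Omega> < \<infinity> \<and>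
     (\<exists>\<Lambda> \<subseteq> Qp p.
        (\<forall>l\<in>\<Lambda>. \<forall>m\<in>\<Lambda>.
           (LINT x:\<Omega>|haar p. pchi_y p l x * cnj (pchi_y p m x)) / measure (haar p) \<Omega>
             = (if l = m then 1 else 0)) \<and>
        (\<forall>f :: (int \<Rightarrow> rat) \<Rightarrow> complex.
           f \<in> borel_measurable (restrict_space (haar p) \<Omega>) \<and>
           integrable (restrict_space (haar p) \<Omega>) (\<lambda>x. (cmod (f x))\<^sup>2) \<and>
           (\<forall>l\<in>\<Lambda>. (LINT x:\<Omega>|haar p. f x * cnj (pchi_y p l x)) = 0)
           \<longrightarrow> (AE x in restrict_space (haar p) \<Omega>. f x = 0)))"

definition tiles :: "nat \<Rightarrow> (int \<Rightarrow> rat) set \<Rightarrow> bool" where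
  "tiles p \<Omega> \<longleftrightarrow>
     (\<exists>T \<subseteq> Qp p. AE x in haar p.
        (\<Sum>\<^sub>\<infinity>t\<in>T. (indicator \<Omega> (psub p x t) :: ennreal)) = 1)"

definition meeting_balls :: "nat \<Rightarrow> (int \<Rightarrow> rat) set \<Rightarrow> int \<Rightarrow> (int \<Rightarrow> rat) set set" where
  "meeting_balls p \<Omega> n = {qp_ball p a (- n) | a. a \<in> Qp p \<and> qp_ball p a (- n) \<inter> \<Omega> \<noteq> {}}"

definition p_homogeneous :: "nat \<Rightarrow> (int \<Rightarrow> rat) set \<Rightarrow> bool" where
  "p_homogeneous p \<Omega> \<longleftrightarrow>
     (\<forall>n::int.
        (\<forall>B\<in>meeting_balls p \<Omega> n. card {C \<in> meeting_balls p \<Omega> (n + 1). C \<subseteq> B} = 1) \<or>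
        (\<forall>B\<in>meeting_balls p \<Omega> n. card {C \<in> meeting_balls p \<Omega> (n + 1). C \<subseteq> B} = p))"

end

theory Submission
  imports Defs
begin

text \<open>A compact open set \<open>\<Omega>\<close> is a finite union of balls of radius \<open>p\<^bsup>-N\<^esup>\<close> inside \<open>p\<^bsup>-M\<^esup> Z\<^sub>p\<close>, hence is
  described by a finite set \<open>C\<close> of residues modulo \<open>p\<^bsup>N\<^esup>\<close>. By irreducibility of the cyclotomic
  polynomial of order \<open>p\<^bsup>j\<^esup>\<close>, a character sum of conductor \<open>p\<^bsup>n\<^esup>\<close> over \<open>C\<close> vanishes only if \<open>C\<close> is
  equidistributed at level \<open>n\<close>: the \<open>p\<close> lifts of a residue modulo \<open>p\<^bsup>n-1\<^esup>\<close> contain equally many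
  elements of \<open>C\<close>. If \<open>S\<close> is the set of such levels, then \<open>|C| \<ge> p\<^bsup>|S|\<^esup>\<close>, with equality only for
  homogeneous \<open>C\<close>. A tiling \<open>C \<oplus> T\<close> of the residues gives equality because at every level \<open>C\<close> or \<open>T\<close>
  is equidistributed. A spectrum gives equality because its part \<open>\<Lambda>\<^sub>0\<close> in the ball of radius \<open>p\<^bsup>N\<^esup>\<close>
  has \<open>|C|\<close> elements by completeness, while by orthogonality the distances within it lie in
  \<open>p\<^bsup>n\<^esup>\<close>, \<open>n \<in> S\<close>, so that \<open>|\<Lambda>\<^sub>0| \<le> p\<^bsup>|S|\<^esup>\<close>. Conversely, if \<open>\<Omega>\<close> is homogeneous and branches exactly at
  the digit positions in \<open>J\<close>, the numbers with digits only outside \<open>J\<close> form a tiling complement,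
  and those with digits only at positions \<open>k\<close> with \<open>-1-k \<in> J\<close> form a spectrum.\<close>

section \<open>Vanishing sums of roots of unity of prime power order\<close>

text \<open>The digit at position n - 1 decides how residues modulo p^(n-1) split modulo p^n, so a
  level n in \<open>S\<close> means branching at n - 1. The reflection of k to -1-k has the same
  origin: frequencies that first differ at digit k have a difference of valuation k, whose character
  has conductor p^(-k) and therefore detects branching at -k-1. A vanishing sum speaks of counts at
  the finest level, homogeneity of the residues that occur at all, and nothing is known about a
  level outside \<open>S\<close>. Only equality in a global count excludes branching there, so both
  directions close a chain of inequalities. For a tiling, the character sum over the sum set is the
  product of the sums over the two summands, and it vanishes because the sum set is a full group;
  hence one of the two factors vanishes at each level. For a spectrum, orthogonality gives only an
  upper bound for the number of frequencies; the matching count comes from testing completeness on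
  the indicator of a single ball. Almost-everywhere statements become pointwise because everything
  tested is constant on balls of positive measure.\<close>

definition ieval :: "complex \<Rightarrow> int poly \<Rightarrow> complex" where
  "ieval z F = poly (map_poly of_int F) z"

lemma ieval_0 [simp]: "ieval z 0 = 0"
  by (simp add: ieval_def)

lemma ieval_pCons [simp]: "ieval z (pCons a F) = of_int a + z * ieval z F"
  by (simp add: ieval_def map_poly_pCons)

lemma ieval_1 [simp]: "ieval z 1 = 1"
  by (simp add: one_pCons)

lemma ieval_add [simp]: "ieval z (F + G) = ieval z F + ieval z G"
  by (induction F G rule: poly_induct2) (auto simp: algebra_simps)

lemma ieval_smult [simp]: "ieval z (smult c F) = of_int c * ieval z F"
  by (induction F) (auto simp: algebra_simps)

lemma ieval_mult [simp]: "ieval z (F * G) = ieval z F * ieval z G"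
  by (induction F) (auto simp: algebra_simps)

lemma ieval_monom [simp]: "ieval z (monom c n) = of_int c * z ^ n"
  by (induction n) (auto simp: monom_Suc monom_0)

lemma ieval_sum [simp]: "ieval z (\<Sum>i\<in>A. F i) = (\<Sum>i\<in>A. ieval z (F i))"
  by (induction A rule: infinite_finite_induct) auto

lemma ieval_pcompose [simp]: "ieval z (pcompose F G) = ieval (ieval z G) F"
  by (induction F) (auto simp: pcompose_pCons)

text \<open>A form of Gauss's lemma. Among the nonzero integer polynomials vanishing at
  \<open>z\<close> take one of least degree and make it primitive; the pseudo-remainder of
  \<open>g\<close> by it vanishes at \<open>z\<close> and is too small to be nonzero. The factor
  \<open>c\<close> left by pseudo-division cancels because contents are multiplicative and both
  \<open>m\<close> and \<open>g\<close> are primitive.\<close>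

lemma min_degree_dvd:
  fixes z :: complex and g :: "int poly"
  assumes "f \<noteq> 0" "ieval z f = 0" and g: "ieval z g = 0" "content g = 1"
  obtains m where "ieval z m = 0" "m \<noteq> 0" "degree m \<le> degree f" "m dvd g"
proof -
  define D where "D = {f::int poly. f \<noteq> 0 \<and> ieval z f = 0}"
  define m0 where "m0 = arg_min degree (\<lambda>f. f \<in> D)"
  have m0: "m0 \<in> D" and min: "\<And>h. h \<in> D \<Longrightarrow> degree m0 \<le> degree h"
    using arg_min_natI[of "\<lambda>f. f \<in> D" f degree] arg_min_nat_le[of "\<lambda>f. f \<in> D" _ degree] assms(1,2)
    by (auto simp: m0_def D_def)
  define m where "m = primitive_part m0"
  have m0eq: "m0 = smult (content m0) m" by (simp add: m_def)
  have c0: "content m0 \<noteq> 0" using m0 by (simp add: D_def)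
  have "of_int (content m0) * ieval z m = ieval z m0" using m0eq by (metis ieval_smult)
  then have m: "m \<noteq> 0" "ieval z m = 0" "content m = 1" "degree m = degree m0"
    using m0 c0 by (auto simp: D_def m_def)
  obtain q r where qr: "pseudo_divmod g m = (q, r)" by fastforce
  define c where "c = coeff m (degree m) ^ (Suc (degree g) - degree m)"
  have eq: "smult c g = m * q + r" and r: "r = 0 \<or> degree r < degree m"
    using pseudo_divmod[OF m(1) qr] by (auto simp: c_def)
  have "ieval z r = 0" using arg_cong[OF eq, of "ieval z"] g m by simp
  then have "r = 0" using r min[of r] m(4) by (force simp: D_def)
  then have eq: "smult c g = m * q" using eq by simp
  have "c \<noteq> 0" using m(1) by (simp add: c_def)
  have "normalize c = content q"
    using arg_cong[OF eq, of content] m(3) g(2) by (simp add: content_mult)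
  then have "c dvd content q" by (metis normalize_dvd_iff dvd_refl)
  then have "[:c:] dvd q" by (simp add: const_poly_dvd_iff_dvd_content)
  then obtain q' where "q = smult c q'" by (auto elim!: dvdE)
  then have "smult c g = smult c (m * q')" using eq by simp
  then have "g = m * q'" using \<open>c \<noteq> 0\<close> smult_cancel by blast
  then have "m dvd g" by simp
  then show ?thesis using that[of m] m min[of f] assms(1,2) by (auto simp: D_def)
qed

text \<open>Modulo \<open>p\<close> the constant term of \<open>a\<close> is a unit, so the
  vanishing low coefficients of \<open>a * b\<close> force those of \<open>b\<close> to vanish, one
  after the other. If the degree of \<open>b\<close> were below \<open>n\<close>, all of
  \<open>b\<close> would be zero modulo \<open>p\<close>, against \<open>top\<close>.\<close>

lemma eisenstein_factor_degree:
  fixes a b :: "int poly"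
  assumes p: "prime p" and low: "\<And>k. k < n \<Longrightarrow> p dvd coeff (a * b) k"
    and top: "\<not> p dvd coeff (a * b) n" and c0: "\<not> p dvd coeff a 0"
  shows "n \<le> degree b"
proof (rule ccontr)
  assume lt: "\<not> n \<le> degree b"
  have "p dvd coeff b k" for k
  proof (induction k rule: less_induct)
    case (less k)
    show ?case
    proof (cases "k < n")
      case True
      have "coeff (a * b) k = coeff a 0 * coeff b k + (\<Sum>i\<in>{..k}-{0}. coeff a i * coeff b (k - i))"
        unfolding coeff_mult by (subst sum.remove[of _ 0]) auto
      moreover have "p dvd (\<Sum>i\<in>{..k}-{0}. coeff a i * coeff b (k - i))"
        by (intro dvd_sum dvd_mult less) auto
      ultimately have "p dvd coeff a 0 * coeff b k"
        using low[OF True] by (metis dvd_add_left_iff)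
      then show ?thesis using p c0 by (auto simp: prime_dvd_mult_iff)
    next
      case False
      then show ?thesis using lt by (simp add: coeff_eq_0)
    qed
  qed
  then have "p dvd coeff (a * b) n"
    unfolding coeff_mult by (intro dvd_sum dvd_mult) auto
  with top show False by simp
qed

text \<open>Eisenstein's criterion, phrased as a degree bound. As p^2 does not divide the constant
  term of \<open>g = m * h\<close>, one factor has constant term prime to \<open>p\<close>, and then
  the other carries the full degree. It cannot be \<open>h\<close>: then \<open>m\<close> would be a
  nonzero constant, yet it vanishes at \<open>z\<close>.\<close>

lemma eisenstein_degree_le:
  fixes f g :: "int poly" and z :: complex
  assumes p: "prime (p::int)" and "f \<noteq> 0" "ieval z f = 0" "ieval z g = 0"
    and lc: "lead_coeff g = 1" and low: "\<And>k. k < degree g \<Longrightarrow> p dvd coeff g k"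
    and c0: "\<not> p^2 dvd coeff g 0"
  shows "degree g \<le> degree f"
proof -
  have "content g dvd 1" using lc content_dvd_coeff[of g "degree g"] by simp
  then have "content g = 1" using normalize_content[of g] by (metis is_unit_normalize)
  then obtain m where m: "ieval z m = 0" "m \<noteq> 0" "degree m \<le> degree f" "m dvd g"
    using min_degree_dvd[of f z g] assms by metis
  then obtain h where gh: "g = m * h" by (auto elim: dvdE)
  have "h \<noteq> 0" using gh lc by auto
  have nz: "\<not> p dvd coeff g (degree g)" using lc p by auto
  have "\<not> (p dvd coeff m 0 \<and> p dvd coeff h 0)"
    using c0 by (auto simp: gh coeff_mult_0 power2_eq_square intro: mult_dvd_mono)
  then consider "\<not> p dvd coeff m 0" | "\<not> p dvd coeff h 0" by blast
  then show ?thesis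
  proof cases
    case 1
    then have "degree g \<le> degree h"
      using eisenstein_factor_degree[OF p, of "degree g" m h] low nz gh by simp
    then have "degree m = 0" using degree_mult_eq[OF m(2) \<open>h \<noteq> 0\<close>] gh by simp
    then obtain c where "m = [:c:]" by (metis degree_eq_zeroE)
    then show ?thesis using m by simp
  next
    case 2
    then have "degree g \<le> degree m"
      using eisenstein_factor_degree[OF p, of "degree g" h m] low nz gh by (simp add: mult.commute)
    then show ?thesis using m by simp
  qed
qed

section \<open>Frobenius congruences and cyclotomic polynomials of prime power order\<close>

lemma prime_dvd_add_power_diff:
  fixes a b :: "int poly"
  assumes p: "prime p"
  shows "of_nat p dvd (a + b) ^ p - (a ^ p + b ^ p)"
proof -
  have "p \<noteq> 0" using p by auto
  have "(a + b) ^ p = (\<Sum>k\<le>p. of_nat (p choose k) * a ^ k * b ^ (p - k))"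
    by (rule binomial_ring)
  also have "{..p} = {0, p} \<union> {0<..<p}" by auto
  also have "(\<Sum>k\<in>\<dots>. of_nat (p choose k) * a ^ k * b ^ (p - k)) =
     b ^ p + a ^ p + (\<Sum>k\<in>{0<..<p}. of_nat (p choose k) * a ^ k * b ^ (p - k))"
    using \<open>p \<noteq> 0\<close> by (subst sum.union_disjoint) auto
  finally have "(a + b) ^ p - (a ^ p + b ^ p) =
     (\<Sum>k\<in>{0<..<p}. of_nat (p choose k) * a ^ k * b ^ (p - k))" by simp
  moreover have "(of_nat p :: int poly) dvd of_nat (p choose k)" if "k \<in> {0<..<p}" for k
  proof -
    have "p dvd (p choose k)" using dvd_choose_prime[of k p] p that by auto
    then show ?thesis by (auto elim!: dvdE)
  qed
  ultimately show ?thesis by (auto intro!: dvd_sum dvd_mult2)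
qed

lemma prime_dvd_add_prime_power_diff:
  fixes a b :: "int poly"
  assumes p: "prime p"
  shows "of_nat p dvd (a + b) ^ (p ^ j) - (a ^ (p ^ j) + b ^ (p ^ j))"
proof (induction j)
  case (Suc j)
  define u where "u = (a + b) ^ (p ^ j)"
  define v where "v = a ^ (p ^ j) + b ^ (p ^ j)"
  have "u - v dvd u ^ p - v ^ p"
    by (simp add: power_diff_sumr2)
  then have "of_nat p dvd u ^ p - v ^ p" using Suc unfolding u_def v_def by (rule dvd_trans[rotated])
  moreover have "of_nat p dvd v ^ p - ((a ^ (p ^ j)) ^ p + (b ^ (p ^ j)) ^ p)"
    unfolding v_def by (rule prime_dvd_add_power_diff[OF p])
  ultimately have "of_nat p dvd (u ^ p - v ^ p) + (v ^ p - ((a ^ (p ^ j)) ^ p + (b ^ (p ^ j)) ^ p))"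
    by (rule dvd_add)
  then have "of_nat p dvd u ^ p - ((a ^ (p ^ j)) ^ p + (b ^ (p ^ j)) ^ p)" by (simp add: algebra_simps)
  then show ?case by (simp add: u_def power_mult[symmetric] mult.commute)
qed auto

text \<open>The cyclotomic polynomial of order \<^term>\<open>p ^ Suc j\<close>.\<close>

definition cyc :: "nat \<Rightarrow> nat \<Rightarrow> int poly" where
  "cyc p j = (\<Sum>i<p. monom 1 (i * p ^ j))"

lemma coeff_cyc:
  assumes "p > 0"
  shows "coeff (cyc p j) n = (if p ^ j dvd n \<and> n < p * p ^ j then 1 else 0)"
proof -
  have "coeff (cyc p j) n = (\<Sum>i<p. if i * p ^ j = n then 1 else 0)"
    by (simp add: cyc_def coeff_sum)
  also have "\<dots> = (if p ^ j dvd n \<and> n < p * p ^ j then 1 else 0)"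
  proof (cases "p ^ j dvd n \<and> n < p * p ^ j")
    case True
    then obtain k where k: "n = k * p ^ j" by (metis dvd_def mult.commute)
    have "k < p" using True assms unfolding k by simp
    have "(\<Sum>i<p. if i * p ^ j = n then 1 else 0::int) = (\<Sum>i<p. if i = k then 1 else 0)"
      using assms by (intro sum.cong) (auto simp: k)
    then show ?thesis using True \<open>k < p\<close> by simp
  next
    case False
    then have "i * p ^ j \<noteq> n" if "i < p" for i
      using that assms by auto
    then show ?thesis using False by simp
  qed
  finally show ?thesis .
qed

lemma degree_cyc:
  assumes "p > 0" shows "degree (cyc p j) = (p - 1) * p ^ j"
proof (rule antisym)
  show "degree (cyc p j) \<le> (p - 1) * p ^ j"
  proof (rule degree_le, intro allI impI)
    fix n assume n: "(p - 1) * p ^ j < n"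
    show "coeff (cyc p j) n = 0"
    proof (rule ccontr)
      assume "coeff (cyc p j) n \<noteq> 0"
      then have "p ^ j dvd n" "n < p * p ^ j" by (auto simp: coeff_cyc[OF assms] split: if_splits)
      then obtain k where "n = k * p ^ j" "k < p" by (metis dvd_def mult.commute mult_less_cancel2)
      with n show False by simp
    qed
  qed
  show "(p - 1) * p ^ j \<le> degree (cyc p j)"
    using assms by (intro le_degree) (simp add: coeff_cyc)
qed

lemma lead_coeff_cyc: "p > 0 \<Longrightarrow> lead_coeff (cyc p j) = 1"
  by (simp add: coeff_cyc degree_cyc)

text \<open>This is Eisenstein's condition for the shifted polynomial. Modulo \<open>p\<close>,
  Frobenius turns \<open>Y\<close> into \<open>X + 1\<close>, where \<open>X\<close> is the monomial
  of degree p^j; the geometric sum of the powers of \<open>X + 1\<close> is ((X + 1)^p - 1) / X,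
  which by Frobenius again is X^(p-1).\<close>

lemma cyc_shift_mod:
  assumes p: "prime p"
  shows "of_nat p dvd pcompose (cyc p j) [:1, 1:] - monom 1 ((p - 1) * p ^ j)"
proof -
  define q where "q = p ^ j"
  define X :: "int poly" where "X = monom 1 q"
  define Y :: "int poly" where "Y = [:1, 1:] ^ q"
  have Y: "of_nat p dvd Y - (X + 1)"
  proof -
    have "[:1, 1:] = [:0, 1:] + (1 :: int poly)" by (simp add: one_pCons)
    then show ?thesis
      using prime_dvd_add_prime_power_diff[OF p, of "[:0, 1:]" 1 j]
      unfolding Y_def X_def q_def monom_altdef by (simp only: smult_1_left power_one)
  qed
  have pcm: "pcompose (monom 1 n) [:1, 1:] = ([:1, 1:] ^ n :: int poly)" for n
    by (induction n) (auto simp: monom_Suc pcompose_pCons monom_0 pcompose_const one_pCons)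
  have pc: "pcompose (cyc p j) [:1, 1:] = (\<Sum>i<p. Y ^ i)"
    by (simp add: cyc_def pcompose_sum pcm Y_def q_def power_mult[symmetric] mult.commute)
  have "of_nat p dvd (\<Sum>i<p. Y ^ i) - (\<Sum>i<p. (X + 1) ^ i)"
  proof -
    have "Y - (X + 1) dvd Y ^ i - (X + 1) ^ i" for i by (simp add: power_diff_sumr2)
    then show ?thesis unfolding sum_subtractf[symmetric] using Y by (intro dvd_sum) (metis dvd_trans)
  qed
  moreover have "of_nat p dvd (\<Sum>i<p. (X + 1) ^ i) - monom 1 ((p - 1) * q)"
  proof -
    have "X * (\<Sum>i<p. (X + 1) ^ i) = (X + 1) ^ p - 1"
      using power_diff_1_eq[of "X + 1" p] by simp
    moreover have "of_nat p dvd (X + 1) ^ p - (X ^ p + 1)"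
      using prime_dvd_add_power_diff[OF p, of X 1] by simp
    moreover have "X ^ p = X * monom 1 ((p - 1) * q)"
      using prime_gt_0_nat[OF p] by (simp add: X_def monom_power mult_monom algebra_simps diff_mult_distrib)
    ultimately have *: "of_nat p dvd X * ((\<Sum>i<p. (X + 1) ^ i) - monom 1 ((p - 1) * q))"
      by (simp add: right_diff_distrib diff_diff_eq add.commute)
    \<comment> \<open>Multiplication by the monomial \<open>X\<close> only shifts coefficients, so
      divisibility by \<open>p\<close> passes to the cofactor.\<close>
    have "int p dvd coeff (X * ((\<Sum>i<p. (X + 1) ^ i) - monom 1 ((p - 1) * q))) (n + q)" for n
      using * by (simp add: of_nat_poly const_poly_dvd_iff)
    then show ?thesis by (simp add: of_nat_poly const_poly_dvd_iff X_def coeff_monom_mult)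
  qed
  ultimately have "of_nat p dvd ((\<Sum>i<p. Y ^ i) - (\<Sum>i<p. (X + 1) ^ i)) + ((\<Sum>i<p. (X + 1) ^ i) - monom 1 ((p - 1) * q))"
    by (rule dvd_add)
  then show ?thesis by (simp add: pc q_def)
qed

text \<open>Shifting the variable by one makes \<open>cyc p j\<close> an Eisenstein polynomial: its
  constant term becomes the value of \<open>cyc p j\<close> at 1, which is \<open>p\<close>. The
  root \<open>z\<close> moves to \<open>z - 1\<close>, and degrees do not change.\<close>

lemma cyc_minimal:
  assumes p: "prime p" and z: "ieval z (cyc p j) = 0" and f: "ieval z f = 0" "degree f < (p - 1) * p ^ j"
  shows "f = 0"
proof (rule ccontr)
  assume "f \<noteq> 0"
  have p0: "p > 0" using p prime_gt_0_nat by blast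
  define g where "g = pcompose (cyc p j) [:1, 1:]"
  have dg: "degree g = (p - 1) * p ^ j" by (simp add: g_def degree_pcompose degree_cyc[OF p0])
  have lc: "lead_coeff g = 1" using lead_coeff_comp[of "[:1,1:]" "cyc p j"] p0 by (simp add: g_def lead_coeff_cyc)
  have low: "int p dvd coeff g k" if "k < degree g" for k
  proof -
    have "int p dvd coeff (g - monom 1 ((p - 1) * p ^ j)) k"
      using cyc_shift_mod[OF p, of j] by (simp add: g_def of_nat_poly const_poly_dvd_iff)
    then show ?thesis using that by (simp add: dg)
  qed
  have "coeff g 0 = poly (cyc p j) 1" by (simp add: g_def poly_0_coeff_0[symmetric] poly_pcompose)
  also have "\<dots> = int p" by (simp add: cyc_def poly_sum poly_monom)
  finally have "\<not> (int p)^2 dvd coeff g 0"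
    using prime_gt_1_nat[OF p] by (auto simp: power2_eq_square dest: zdvd_imp_le)
  then have "degree g \<le> degree (pcompose f [:1,1:])"
    using p lc low z f \<open>f \<noteq> 0\<close>
    by (intro eisenstein_degree_le[of "int p" _ "z - 1"]) (auto simp: g_def pcompose_eq_0_iff)
  then show False using f(2) by (simp add: degree_pcompose dg)
qed

text \<open>Such a polynomial is divisible by the cyclotomic one, and a multiple of
  \<open>1 + X\<^bsup>q\<^esup> + \<dots> + X\<^bsup>(p-1)q\<^esup>\<close>, \<open>q = p\<^bsup>j\<^esup>\<close>, of degree below \<open>p q\<close> repeats its first \<open>q\<close> coefficients.\<close>

lemma prime_power_root_coeff_periodic:
  assumes p: "prime p" and z: "ieval z (cyc p j) = 0" and F: "ieval z F = 0" "degree F < p * p ^ j"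
    and rs: "r < p * p ^ j" "s < p * p ^ j" "r mod p ^ j = s mod p ^ j"
  shows "coeff F r = coeff F s"
proof -
  have p0: "p > 0" using p prime_gt_0_nat by blast
  obtain G R where GR: "pseudo_divmod F (cyc p j) = (G, R)" by fastforce
  have nz: "cyc p j \<noteq> 0" using lead_coeff_cyc[OF p0, of j] by auto
  \<comment> \<open>The divisor is monic, so pseudo-division is ordinary division with
    remainder.\<close>
  have eq: "F = cyc p j * G + R" and R: "R = 0 \<or> degree R < (p - 1) * p ^ j"
    using pseudo_divmod[OF nz GR] unfolding lead_coeff_cyc[OF p0] by (simp_all add: degree_cyc[OF p0])
  have "ieval z R = 0" using arg_cong[OF eq, of "ieval z"] z F by simp
  then have "R = 0" using cyc_minimal[OF p z] R by blast
  then have eq: "F = cyc p j * G" using eq by simp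
  have dG: "degree G < p ^ j"
  proof (cases "G = 0")
    case False
    then have "degree F = (p - 1) * p ^ j + degree G"
      using eq degree_mult_eq[OF nz] by (simp add: degree_cyc[OF p0])
    then show ?thesis using F(2) p0 by (simp add: algebra_simps diff_mult_distrib)
  qed (use p0 in auto)
  have "coeff F r = coeff G (r mod p ^ j)" if r: "r < p * p ^ j" for r
  proof -
    have "coeff F r = (\<Sum>i<p. coeff (monom 1 (i * p ^ j) * G) r)"
      by (simp add: eq cyc_def sum_distrib_right coeff_sum)
    \<comment> \<open>As \<open>G\<close> has degree below p^j, its shifted copies occupy disjoint
      blocks of coefficients, and \<open>r\<close> lies in the block with number
      \<open>r div p ^ j\<close>.\<close>
    also have "\<dots> = (\<Sum>i<p. if i = r div p ^ j then coeff G (r mod p ^ j) else 0)"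
    proof (rule sum.cong[OF refl])
      fix i assume "i \<in> {..<p}"
      have r_eq: "r = (r div p ^ j) * p ^ j + r mod p ^ j" by (rule div_mult_mod_eq[symmetric])
      have rm: "r mod p ^ j < p ^ j" using p0 by simp
      consider "i = r div p ^ j" | "i < r div p ^ j" | "i > r div p ^ j" by linarith
      then show "coeff (monom 1 (i * p ^ j) * G) r = (if i = r div p ^ j then coeff G (r mod p ^ j) else 0)"
      proof cases
        case 1
        then show ?thesis using div_times_less_eq_dividend[of r "p ^ j"]
            by (simp add: coeff_monom_mult minus_div_mult_eq_mod not_less[symmetric])
      next
        case 2
        then have "Suc i * p ^ j \<le> (r div p ^ j) * p ^ j" by (intro mult_right_mono) auto
        then have "r - i * p ^ j \<ge> p ^ j" using r_eq by simp
        then show ?thesis using 2 dG by (simp add: coeff_monom_mult coeff_eq_0)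
      next
        case 3
        then have "Suc (r div p ^ j) * p ^ j \<le> i * p ^ j" by (intro mult_right_mono) auto
        then have "r < i * p ^ j" using r_eq rm by simp
        then show ?thesis using 3 by (simp add: coeff_monom_mult)
      qed
    qed
    also have "\<dots> = coeff G (r mod p ^ j)"
      using r p0 by (simp add: less_mult_imp_div_less)
    finally show ?thesis .
  qed
  then show ?thesis using rs by simp
qed

section \<open>Residues of p-adic numbers\<close>

locale padic =
  fixes p :: nat
  assumes prime_p: "prime p"
begin

abbreviation P :: rat where "P \<equiv> of_nat p"

lemma p_gt_1: "p > 1" and p_pos: "p > 0"
  using prime_p prime_gt_1_nat prime_gt_0_nat by auto

lemma p_nz [simp]: "p \<noteq> 0" "0 < p"
  using p_pos by auto

lemma P_nz: "P \<noteq> 0"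
  by simp

lemma Ppow_pos [simp]: "P powi n > 0"
  by (rule zero_less_power_int) simp

lemma Ppow_nz [simp]: "P powi n \<noteq> 0"
  using Ppow_pos[of n] by linarith

text \<open>The fractional ideal p^n Z of Q. Truncations of p-adic numbers are rational, so
  congruence modulo p^n Z_p becomes membership of a difference in \<open>lat n\<close>, and
  congruence arguments run inside Q.\<close>

definition lat :: "int \<Rightarrow> rat set" where
  "lat n = range (\<lambda>k. of_int k * P powi n)"

lemma lat_0 [simp]: "0 \<in> lat n"
  unfolding lat_def by (intro image_eqI[of _ _ 0]) auto

lemma lat_self [simp]: "P powi n \<in> lat n"
  unfolding lat_def by (intro image_eqI[of _ _ 1]) auto

lemma lat_add: "a \<in> lat n \<Longrightarrow> b \<in> lat n \<Longrightarrow> a + b \<in> lat n"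
  unfolding lat_def by (auto simp: distrib_right[symmetric] of_int_add[symmetric] simp del: of_int_add)

lemma lat_minus [simp]: "- a \<in> lat n \<longleftrightarrow> a \<in> lat n"
proof -
  have "- a \<in> lat n" if "a \<in> lat n" for a
    using that unfolding lat_def by (auto simp: image_iff) (metis of_int_minus mult_minus_left)
  from this[of a] this[of "-a"] show ?thesis by auto
qed

lemma lat_diff: "a \<in> lat n \<Longrightarrow> b \<in> lat n \<Longrightarrow> a - b \<in> lat n"
  using lat_add[of a n "- b"] by simp

lemma lat_diff_commute: "a - b \<in> lat n \<longleftrightarrow> b - a \<in> lat n"
  using lat_minus[of "a - b" n] by simp

lemma lat_cong: "a - b \<in> lat n \<Longrightarrow> a \<in> lat n \<longleftrightarrow> b \<in> lat n"
  using lat_diff[of a n "a - b"] lat_add[of "a - b" n b] by auto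

lemma lat_trans: "a - b \<in> lat n \<Longrightarrow> b - c \<in> lat n \<Longrightarrow> a - c \<in> lat n"
  using lat_add[of "a - b" n "b - c"] by simp

lemma lat_mult: "a \<in> lat m \<Longrightarrow> b \<in> lat n \<Longrightarrow> a * b \<in> lat (m + n)"
proof -
  assume "a \<in> lat m" "b \<in> lat n"
  then obtain k l where "a = of_int k * P powi m" "b = of_int l * P powi n" by (auto simp: lat_def)
  then have "a * b = of_int (k * l) * P powi (m + n)" by (simp add: power_int_add)
  then show ?thesis unfolding lat_def by blast
qed

lemma lat_0_iff: "a \<in> lat 0 \<longleftrightarrow> a \<in> \<int>"
  by (auto simp: lat_def Ints_def)

lemma Ppow_nat: "m \<le> n \<Longrightarrow> P powi n = of_nat (p ^ nat (n - m)) * P powi m"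
proof -
  assume "m \<le> n"
  then have "n = int (nat (n - m)) + m" by simp
  then have "P powi n = P powi (int (nat (n - m))) * P powi m" by (metis power_int_add P_nz)
  then show ?thesis by (metis power_int_of_nat of_nat_power)
qed

lemma lat_mono: "m \<le> n \<Longrightarrow> lat n \<subseteq> lat m"
proof
  fix a assume mn: "m \<le> n" and "a \<in> lat n"
  then obtain k where "a = of_int k * P powi n" by (auto simp: lat_def)
  then have "a = of_int (k * int (p ^ nat (n - m))) * P powi m" using Ppow_nat[OF mn] by simp
  then show "a \<in> lat m" unfolding lat_def by blast
qed

lemma lat_monoD: "a \<in> lat n \<Longrightarrow> m \<le> n \<Longrightarrow> a \<in> lat m"
  using lat_mono by blast

lemma lat_unique:
  assumes "a - b \<in> lat n" "0 \<le> a" "a < P powi n" "0 \<le> b" "b < P powi n"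
  shows "a = b"
proof -
  obtain k where k: "a - b = of_int k * P powi n" using assms by (auto simp: lat_def)
  have "of_int k * P powi n < 1 * P powi n" "(-1) * P powi n < of_int k * P powi n"
    unfolding k[symmetric] using assms by auto
  then have "of_int k < (1 :: rat)" "(-1 :: rat) < of_int k"
    by (auto simp only: mult_less_cancel_right_pos Ppow_pos)
  then have "k = 0" by linarith
  then show ?thesis using k by simp
qed

abbreviation rd :: "rat \<Rightarrow> int \<Rightarrow> rat" where "rd \<equiv> qmod p"

lemma rd_diff: "a - rd a n \<in> lat n" and rd_diff': "rd a n - a \<in> lat n"
proof -
  show "a - rd a n \<in> lat n" by (auto simp: qmod_def lat_def)
  then show "rd a n - a \<in> lat n" using lat_diff_commute by blast
qed

lemma rd_nonneg [simp]: "0 \<le> rd a n" and rd_less [simp]: "rd a n < P powi n"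
proof -
  define y where "y = a / P powi n"
  have a: "a = P powi n * y" by (simp add: y_def)
  have "rd a n = P powi n * (y - of_int \<lfloor>y\<rfloor>)"
    unfolding qmod_def y_def[symmetric] by (simp add: a right_diff_distrib)
  moreover have "0 \<le> y - of_int \<lfloor>y\<rfloor>" "y - of_int \<lfloor>y\<rfloor> < 1" by linarith+
  ultimately show "0 \<le> rd a n" "rd a n < P powi n"
    using Ppow_pos[of n] by (auto intro: mult_nonneg_nonneg less_imp_le simp: mult_less_cancel_left2 not_le)
qed

lemma rd_eq_iff: "rd a n = rd b n \<longleftrightarrow> a - b \<in> lat n"
proof
  assume "rd a n = rd b n"
  then show "a - b \<in> lat n" using lat_trans[OF rd_diff[of a n], of b] rd_diff'[of b n] by simp
next
  assume "a - b \<in> lat n"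
  then have "rd a n - rd b n \<in> lat n" using lat_trans[OF rd_diff'] lat_trans rd_diff by blast
  then show "rd a n = rd b n" by (intro lat_unique) auto
qed

lemma rd_eqI: "a - b \<in> lat n \<Longrightarrow> 0 \<le> b \<Longrightarrow> b < P powi n \<Longrightarrow> rd a n = b"
  by (rule lat_unique[of _ _ n]) (auto intro: lat_trans[OF rd_diff'])

lemma rd_id: "0 \<le> b \<Longrightarrow> b < P powi n \<Longrightarrow> rd b n = b"
  by (rule rd_eqI) auto

lemma rd_rd: "m \<le> n \<Longrightarrow> rd (rd a n) m = rd a m"
  by (simp add: rd_eq_iff) (meson lat_monoD rd_diff')

lemma rd_eq_0_iff: "rd a n = 0 \<longleftrightarrow> a \<in> lat n"
  using rd_eq_iff[of a n 0] rd_id[of 0 n] by simp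

lemma rd_lat: "a \<in> lat m \<Longrightarrow> m \<le> n \<Longrightarrow> rd a n \<in> lat m"
  using lat_cong[OF lat_monoD[OF rd_diff]] by blast

lemma Qp_rd:
  assumes "x \<in> Qp p" "m \<le> n" shows "rd (x n) m = x m"
  using assms(2)
proof (induction n rule: int_ge_induct)
  case base
  have "0 \<le> x m" "x m < P powi m" using assms(1) unfolding Qp_def by blast+
  then show ?case by (rule rd_id)
next
  case (step i)
  have "x i = rd (x (i + 1)) i" using assms(1) unfolding Qp_def by blast
  then show ?case using step rd_rd by metis
qed

lemma Qp_bounds: "x \<in> Qp p \<Longrightarrow> 0 \<le> x n" "x \<in> Qp p \<Longrightarrow> x n < P powi n"
  unfolding Qp_def by blast+

lemma Qp_diff: "x \<in> Qp p \<Longrightarrow> m \<le> n \<Longrightarrow> x n - x m \<in> lat m"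
  using Qp_rd rd_diff by metis

lemma Qp_eq_mono: "x \<in> Qp p \<Longrightarrow> y \<in> Qp p \<Longrightarrow> x n = y n \<Longrightarrow> m \<le> n \<Longrightarrow> x m = y m"
  using Qp_rd by metis

lemma Qp_zero: "x \<in> Qp p \<Longrightarrow> \<exists>A. x A = 0"
  unfolding Qp_def by blast

lemma Qp_zero_mono: "x \<in> Qp p \<Longrightarrow> x n = 0 \<Longrightarrow> m \<le> n \<Longrightarrow> x m = 0"
  using Qp_rd[of x m n] rd_id[of 0 m] by simp

lemma Qp_lat:
  assumes "x \<in> Qp p" "x A = 0" shows "x n \<in> lat A"
proof (cases "n \<le> A")
  case True
  then show ?thesis using Qp_zero_mono[OF assms True] by simp
next
  case False
  then show ?thesis using Qp_diff[of x A n] assms by simp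
qed

lemma QpI:
  assumes "\<And>n. 0 \<le> x n" "\<And>n. x n < P powi n" "\<And>n. x (n + 1) - x n \<in> lat n" "x A = 0"
  shows "x \<in> Qp p"
proof -
  have 1: "x n = rd (x (n + 1)) n" for n by (rule rd_eqI[symmetric]) (use assms in auto)
  have "x n = 0" if "n \<le> A" for n
    using that
  proof (induction n rule: int_le_induct)
    case (step i)
    then show ?case using 1[of "i - 1"] rd_id[of 0] by simp
  qed (use assms in auto)
  then have 2: "\<exists>N. \<forall>n\<le>N. x n = 0" by blast
  show ?thesis unfolding Qp_def mem_Collect_eq by (intro conjI allI assms(1,2) 1 2)
qed

text \<open>The p-adic number given by a rational in Z[1/p]; it is the source of explicit points
  with a prescribed residue.\<close>

definition emb :: "rat \<Rightarrow> int \<Rightarrow> rat" where "emb q = rd q"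

lemma emb_apply: "emb q n = rd q n" by (simp add: emb_def)

lemma emb_Qp: "q \<in> lat A \<Longrightarrow> emb q \<in> Qp p"
proof (rule QpI[of _ A])
  show "emb q (n + 1) - emb q n \<in> lat n" for n
    using lat_trans[OF lat_monoD[OF rd_diff'] rd_diff, of n "n + 1"] by (simp add: emb_def)
qed (auto simp: emb_def rd_eq_0_iff)

lemma rd_emb_Qp: "x \<in> Qp p \<Longrightarrow> emb (x n) \<in> Qp p"
  using emb_Qp Qp_lat Qp_zero by metis

lemma emb_Qp_eq: "x \<in> Qp p \<Longrightarrow> m \<le> n \<Longrightarrow> emb (x n) m = x m"
  by (simp add: emb_def Qp_rd)

lemma psub_Qp:
  assumes "x \<in> Qp p" "y \<in> Qp p" shows "psub p x y \<in> Qp p"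
proof -
  obtain A B where AB: "x A = 0" "y B = 0" using assms Qp_zero by blast
  show ?thesis
  proof (rule QpI[of _ "min A B"])
    fix n
    have "(x (n+1) - y (n+1)) - (x n - y n) \<in> lat n"
      using lat_diff[OF Qp_diff[OF assms(1), of n "n+1"] Qp_diff[OF assms(2), of n "n+1"]]
      by (simp add: algebra_simps)
    then show "psub p x y (n + 1) - psub p x y n \<in> lat n"
      unfolding psub_def by (meson lat_trans lat_monoD rd_diff rd_diff' zle_add1_eq_le order_refl le_less)
  next
    show "psub p x y (min A B) = 0"
      using Qp_zero_mono[OF assms(1) AB(1)] Qp_zero_mono[OF assms(2) AB(2)] rd_id[of 0]
      by (simp add: psub_def)
  qed (auto simp: psub_def)
qed

lemma psub_apply: "psub p x y n = rd (x n - y n) n" by (simp add: psub_def)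

section \<open>Additive characters evaluated on truncations\<close>

definition e :: "rat \<Rightarrow> complex" where "e q = cis (2 * pi * real_of_rat q)"

lemma e_add: "e (a + b) = e a * e b"
  by (simp add: e_def cis_mult distrib_left of_rat_add)

lemma e_0 [simp]: "e 0 = 1" by (simp add: e_def)

lemma cnj_e: "cnj (e a) = e (- a)"
  by (simp add: e_def cis_cnj of_rat_minus)

lemma e_diff: "e (a - b) = e a * cnj (e b)"
  using e_add[of a "- b"] by (simp add: cnj_e)

lemma e_eq_1_iff: "e a = 1 \<longleftrightarrow> a \<in> lat 0"
proof -
  have "e a = 1 \<longleftrightarrow> cis (2 * pi * real_of_rat a) = cis (2 * pi * 0)" by (simp add: e_def)
  also have "\<dots> \<longleftrightarrow> (\<exists>k::int. real_of_rat a = of_int k)"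
  proof
    assume "cis (2 * pi * real_of_rat a) = cis (2 * pi * 0)"
    then have "cos (2 * pi * real_of_rat a) = 1" by (simp add: complex_eq_iff)
    then obtain k :: int where "2 * pi * real_of_rat a = of_int k * 2 * pi"
      using cos_one_2pi_int by blast
    then show "\<exists>k::int. real_of_rat a = of_int k" by auto
  next
    assume "\<exists>k::int. real_of_rat a = of_int k"
    then show "cis (2 * pi * real_of_rat a) = cis (2 * pi * 0)"
      by (auto simp: complex_eq_iff cos_int_2pin sin_int_2pin)
  qed
  also have "\<dots> \<longleftrightarrow> a \<in> lat 0"
    unfolding lat_0_iff Ints_def by (auto simp: image_iff) (metis of_rat_of_int_eq of_rat_eq_iff)
  finally show ?thesis .
qed

lemma e_cong: "a - b \<in> lat 0 \<Longrightarrow> e a = e b"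
  using e_add[of "a - b" b] e_eq_1_iff[of "a - b"] by simp

lemma e_mult_cong:
  assumes "q \<in> lat (- n)" "a - b \<in> lat n" shows "e (q * a) = e (q * b)"
proof (rule e_cong)
  show "q * a - q * b \<in> lat 0" using lat_mult[OF assms] by (simp add: right_diff_distrib)
qed

text \<open>The precision a product needs: \<open>y\<close> lies in p^(-A) Z_p, so an error of
  \<open>x\<close> at level \<open>j\<close> becomes an error at level \<open>j - A\<close>, and
  symmetrically with \<open>B\<close>. This is why the eventual value in \<open>pmul\<close>
  exists.\<close>

lemma mult_diff_lat:
  assumes "y \<in> Qp p" "y (- A) = 0" "x \<in> Qp p" "x (- B) = 0"
    and "B + n \<le> i" "A + n \<le> j" "i \<le> i'" "j \<le> j'"
  shows "y i' * x j' - y i * x j \<in> lat n"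
proof -
  have "y i' * (x j' - x j) \<in> lat (- A + j)"
    using assms by (intro lat_mult Qp_lat Qp_diff)
  moreover have "(y i' - y i) * x j \<in> lat (i + - B)"
    using assms by (intro lat_mult Qp_lat Qp_diff)
  ultimately have "y i' * (x j' - x j) + (y i' - y i) * x j \<in> lat n"
    using assms(5,6) by (intro lat_add lat_monoD[of _ "- A + j" n] lat_monoD[of _ "i + - B" n]) auto
  then show ?thesis by (simp add: algebra_simps)
qed

lemma pmul_apply:
  assumes "y \<in> Qp p" "y (- A) = 0" "x \<in> Qp p" "x (- B) = 0" "B + n \<le> m" "A + n \<le> m"
  shows "pmul p y x n = rd (y m * x m) n"
  unfolding pmul_def
proof (rule the_equality)
  have *: "rd (y m' * x m') n = rd (y m * x m) n" if "m' \<ge> m" for m'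
    using mult_diff_lat[OF assms that that] by (simp add: rd_eq_iff)
  then show "\<exists>M. \<forall>m'\<ge>M. rd (y m' * x m') n = rd (y m * x m) n" by blast
  fix c assume "\<exists>M. \<forall>m'\<ge>M. rd (y m' * x m') n = c"
  then obtain M where "\<forall>m'\<ge>M. rd (y m' * x m') n = c" by blast
  then show "c = rd (y m * x m) n" using *[of "max M m"] by simp
qed

text \<open>Precision modulo Z_p suffices, as \<open>e\<close> is trivial on integers. From here on
  character values are exponentials of products of two rational truncations.\<close>

lemma chi_eq:
  assumes "y \<in> Qp p" "y (- A) = 0" "x \<in> Qp p" "x (- B) = 0" "B \<le> i" "A \<le> j"
  shows "pchi_y p y x = e (y i * x j)"
proof -
  define m where "m = max (max A B) (max i j)"
  have "pchi_y p y x = e (rd (y m * x m) 0)"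
    unfolding pchi_y_def pchi_def e_def
    by (subst pmul_apply[OF assms(1-4)]) (auto simp: m_def)
  also have "\<dots> = e (y m * x m)" by (intro e_cong rd_diff')
  also have "\<dots> = e (y i * x j)"
    using mult_diff_lat[OF assms(1-4), of 0 i j m m] assms(5,6) by (intro e_cong) (auto simp: m_def)
  finally show ?thesis .
qed

end

section \<open>Homogeneous sets and character sums\<close>

lemma sum_fibres:
  fixes g :: "'b \<Rightarrow> 'c :: semiring_1"
  assumes "finite S" "finite T" "f ` S \<subseteq> T" "\<And>t. t \<in> T \<Longrightarrow> card {s \<in> S. f s = t} = w"
  shows "(\<Sum>s\<in>S. g (f s)) = of_nat w * (\<Sum>t\<in>T. g t)"
proof -
  have "(\<Sum>s\<in>S. g (f s)) = (\<Sum>t\<in>T. \<Sum>s | s \<in> S \<and> f s = t. g (f s))"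
    by (rule sum.group[OF assms(1-3), symmetric])
  also have "\<dots> = (\<Sum>t\<in>T. of_nat w * g t)"
    using assms(4) by (intro sum.cong) auto
  finally show ?thesis by (simp add: sum_distrib_left)
qed

lemma card_fibres:
  assumes "finite S" "finite T" "f ` S \<subseteq> T" "\<And>t. t \<in> T \<Longrightarrow> card {s \<in> S. f s = t} = w"
  shows "card S = w * card T"
  using sum_fibres[OF assms, of "\<lambda>_. 1 :: nat"] by simp

context padic
begin

lemma e_power: "e a ^ n = e (of_nat n * a)"
  by (induction n) (auto simp: e_add distrib_right)

lemma of_int_lat_iff: "of_int i * P powi m \<in> lat (m + int j) \<longleftrightarrow> int (p ^ j) dvd i"
proof -
  have "of_int i * P powi m \<in> lat (m + int j) \<longleftrightarrow> (\<exists>k. of_int i * P powi m = of_int k * P powi (m + int j))"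
    by (auto simp: lat_def)
  also have "\<dots> \<longleftrightarrow> (\<exists>k. (of_int i :: rat) = of_int (k * int (p ^ j)))"
    by (auto simp: power_int_add)
  also have "\<dots> \<longleftrightarrow> int (p ^ j) dvd i"
    by (simp only: of_int_eq_iff) (auto simp: dvd_def mult.commute)
  finally show ?thesis .
qed

lemma lat_exact:
  assumes "q \<in> lat n" "q \<notin> lat (n + 1)"
  obtains u where "q = of_int u * P powi n" "\<not> int p dvd u"
proof -
  obtain u where u: "q = of_int u * P powi n" using assms(1) by (auto simp: lat_def)
  then have "\<not> int p dvd u" using of_int_lat_iff[of u n 1] assms(2) by simp
  with u show ?thesis using that by blast
qed

text \<open>Scaled by p^M and reduced modulo \<open>L\<close>, the elements of \<open>A\<close>
  become exponents: the character sum is the value at a primitive \<open>L\<close>-th root of unity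
  of a polynomial whose coefficients count \<open>A\<close> by residue modulo p^n. Divisibility by
  the cyclotomic polynomial makes these counts depend on the residue modulo p^(n-1) alone.\<close>

lemma vanishing_sum_equidistributed:
  assumes A: "finite A" "A \<subseteq> lat (- M)" and q: "q \<in> lat (- n)" "q \<notin> lat (- n + 1)" and n: "- M < n"
    and sum0: "(\<Sum>a\<in>A. e (q * a)) = 0"
    and a: "a1 \<in> lat (- M)" "a2 \<in> lat (- M)" "a1 - a2 \<in> lat (n - 1)"
  shows "card {a \<in> A. a - a1 \<in> lat n} = card {a \<in> A. a - a2 \<in> lat n}"
proof -
  \<comment> \<open>The lattice p^(-M) Z has p^j classes modulo p^(n-1) and \<open>L\<close> classes
    modulo p^n.\<close>
  define j where "j = nat (n + M - 1)"
  define L where "L = p * p ^ j"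
  have L0: "L > 0" by (simp add: L_def)
  have n_eq: "n = - M + int (Suc j)" and n1_eq: "n - 1 = - M + int j" using n by (auto simp: j_def)
  obtain u where u: "q = of_int u * P powi (- n)" "\<not> int p dvd u" using lat_exact[OF q] .
  define k where "k a = \<lfloor>a / P powi (- M)\<rfloor>" for a
  define kk where "kk a = nat (k a mod int L)" for a
  have k: "a = of_int (k a) * P powi (- M)" if aM: "a \<in> lat (- M)" for a
  proof -
    obtain i where "a = of_int i * P powi (- M)" using aM unfolding lat_def by blast
    then show ?thesis by (simp add: k_def del: power_int_minus)
  qed
  have kk_int: "int (kk a) = k a mod int L" for a using L0 by (simp add: kk_def)
  have lat_iff: "a - b \<in> lat (- M + int i) \<longleftrightarrow> int (p ^ i) dvd k a - k b"
    if "a \<in> lat (- M)" "b \<in> lat (- M)" for a b i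
  proof -
    have "a - b = of_int (k a - k b) * P powi (- M)"
      using k[OF that(1)] k[OF that(2)] by (metis left_diff_distrib of_int_diff)
    then show ?thesis using of_int_lat_iff by metis
  qed
  have lat_n: "a - b \<in> lat n \<longleftrightarrow> kk a = kk b" if "a \<in> lat (- M)" "b \<in> lat (- M)" for a b
  proof -
    have "a - b \<in> lat n \<longleftrightarrow> int L dvd k a - k b"
      unfolding n_eq lat_iff[OF that] by (simp add: L_def)
    also have "\<dots> \<longleftrightarrow> k a mod int L = k b mod int L" by (simp add: mod_eq_dvd_iff)
    also have "\<dots> \<longleftrightarrow> kk a = kk b" using kk_int by (metis of_nat_eq_iff)
    finally show ?thesis .
  qed
  define z where "z = e (of_int u / of_nat L)"
  have PL: "P powi (- n) * P powi (- M) = 1 / of_nat L"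
  proof -
    have "P powi (- n) * P powi (- M) = P powi (- n - M)" by (simp add: power_int_add[symmetric])
    also have "- n - M = - int (Suc j)" using n_eq by simp
    also have "P powi (- int (Suc j)) = 1 / of_nat L"
      by (simp only: power_int_minus power_int_of_nat L_def) (simp add: field_simps)
    finally show ?thesis .
  qed
  have e_z: "e (q * a) = z ^ kk a" if "a \<in> A" for a
  proof -
    have "a \<in> lat (- M)" using that A by auto
    have "q * a = of_int u * of_int (k a) * (P powi (- n) * P powi (- M))"
      using k[OF \<open>a \<in> lat (- M)\<close>] u(1) by (metis mult.assoc mult.left_commute)
    then have qa: "q * a = of_int (u * k a) / of_nat L" using PL by simp
    have "k a = int L * (k a div int L) + int (kk a)" by (simp add: kk_int)
    then have "of_int (u * k a) = of_int u * (of_nat L * of_int (k a div int L) + of_nat (kk a) :: rat)"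
      by (metis of_int_add of_int_mult of_int_of_nat_eq)
    then have "q * a - of_nat (kk a) * (of_int u / of_nat L) = of_int (u * (k a div int L))"
      using L0 unfolding qa by (simp add: field_simps)
    then have "q * a - of_nat (kk a) * (of_int u / of_nat L) \<in> lat 0" by (simp add: lat_0_iff)
    then show ?thesis unfolding z_def e_power by (rule e_cong)
  qed
  define F where "F = (\<Sum>a\<in>A. monom (1::int) (kk a))"
  have kk_less: "kk a < L" for a using L0 by (simp add: kk_def nat_less_iff)
  have coeff: "coeff F r = int (card {a \<in> A. kk a = r})" for r
    using A(1) by (simp add: F_def coeff_sum sum.If_cases Int_def)
  have "card {a \<in> A. kk a = i} = 0" if "L - 1 < i" for i
    using kk_less that L0 by (auto simp: card_eq_0_iff) (metis Suc_pred less_antisym not_less_iff_gr_or_eq)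
  then have "degree F \<le> L - 1" by (intro degree_le) (auto simp: coeff)
  then have degF: "degree F < L" using L0 by simp
  have F0: "ieval z F = 0" using sum0 e_z by (simp add: F_def)
  \<comment> \<open>A nontrivial \<open>p\<close>-th root of unity, whose geometric sum is the value
    of \<open>cyc p j\<close> at \<open>z\<close>. Nontriviality is the exactness of the conductor
    of \<open>q\<close>.\<close>
  define \<omega> where "\<omega> = z ^ (p ^ j)"
  have w: "\<omega> = e (of_int u / P)" unfolding \<omega>_def z_def e_power by (simp add: L_def)
  have "of_int u / P \<notin> lat 0"
  proof
    assume "of_int u / P \<in> lat 0"
    then obtain i where "of_int u / P = of_int i" by (auto simp: lat_0_iff elim: Ints_cases)
    then have "(of_int u :: rat) = of_int (int p * i)" by (simp add: field_simps)
    then have "u = int p * i" by (simp only: of_int_eq_iff)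
    then show False using u(2) by simp
  qed
  then have "\<omega> \<noteq> 1" unfolding w e_eq_1_iff .
  moreover have "\<omega> ^ p = 1"
  proof -
    have "\<omega> ^ p = e (P * (of_int u / P))" by (simp only: w e_power)
    also have "P * (of_int u / P) = of_int u" by simp
    also have "e (of_int u) = 1" by (simp only: e_eq_1_iff lat_0_iff Ints_of_int)
    finally show ?thesis .
  qed
  ultimately have "(\<Sum>i<p. \<omega> ^ i) = 0" by (simp add: geometric_sum)
  then have cyc0: "ieval z (cyc p j) = 0"
    by (simp add: cyc_def \<omega>_def power_mult[symmetric] mult.commute)
  have "a1 - a2 \<in> lat (- M + int j)" using a(3) n1_eq by simp
  then have "int (p ^ j) dvd k a1 - k a2" using lat_iff a by blast
  then have "k a1 mod int (p ^ j) = k a2 mod int (p ^ j)" by (simp add: mod_eq_dvd_iff)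
  then have "int (kk a1) mod int (p ^ j) = int (kk a2) mod int (p ^ j)"
    unfolding kk_int by (simp add: L_def mod_mod_cancel)
  then have "kk a1 mod p ^ j = kk a2 mod p ^ j" by (metis zmod_int of_nat_eq_iff)
  then have "coeff F (kk a1) = coeff F (kk a2)"
    using prime_power_root_coeff_periodic[OF prime_p cyc0 F0] degF kk_less by (simp add: L_def)
  then have "card {a \<in> A. kk a = kk a1} = card {a \<in> A. kk a = kk a2}" by (simp add: coeff)
  moreover have "{a \<in> A. a - b \<in> lat n} = {a \<in> A. kk a = kk b}" if "b \<in> lat (- M)" for b
    using lat_n that A(2) by blast
  ultimately show ?thesis using a by simp
qed

section \<open>Residues and the tree of balls\<close>

definition box :: "int \<Rightarrow> int \<Rightarrow> rat set" where
  "box m n = {a \<in> lat m. 0 \<le> a \<and> a < P powi n}"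

lemma box_eq: "m \<le> n \<Longrightarrow> box m n = (\<lambda>k. of_nat k * P powi m) ` {..<p ^ nat (n - m)}"
proof (intro equalityI subsetI)
  fix a assume mn: "m \<le> n" and a: "a \<in> box m n"
  then obtain k where k: "a = of_int k * P powi m" by (auto simp: box_def lat_def)
  have "0 \<le> of_int k * P powi m" "of_int k * P powi m < of_nat (p ^ nat (n - m)) * P powi m"
    using a Ppow_nat[OF mn] by (auto simp: box_def k)
  then have "(0::rat) \<le> of_int k" "(of_int k :: rat) < of_nat (p ^ nat (n - m))"
    by (simp_all only: zero_le_mult_iff mult_less_cancel_right_pos Ppow_pos) (use Ppow_pos[of m] in auto)
  then have "0 \<le> k" "k < int (p ^ nat (n - m))" by (simp, metis of_int_less_iff of_int_of_nat_eq)
  then show "a \<in> (\<lambda>k. of_nat k * P powi m) ` {..<p ^ nat (n - m)}"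
    by (intro image_eqI[of _ _ "nat k"]) (auto simp: k nat_less_iff)
next
  fix a assume mn: "m \<le> n" and "a \<in> (\<lambda>k. of_nat k * P powi m) ` {..<p ^ nat (n - m)}"
  then obtain k where k: "a = of_nat k * P powi m" "k < p ^ nat (n - m)" by auto
  have "(of_nat k :: rat) < of_nat (p ^ nat (n - m))" using k(2) of_nat_less_iff by blast
  then have "a < P powi n" unfolding k(1) Ppow_nat[OF mn] by (rule mult_strict_right_mono) simp
  moreover have "0 \<le> a" unfolding k(1) by (intro mult_nonneg_nonneg) (auto intro: less_imp_le)
  moreover have "a \<in> lat m" unfolding lat_def k(1) by (intro image_eqI[of _ _ "int k"]) auto
  ultimately show "a \<in> box m n" by (simp add: box_def)
qed

lemma finite_box: "finite (box m n)"
proof (cases "m \<le> n")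
  case False
  have "a = 0" if "a \<in> box m n" for a
    using that False lat_unique[of a 0 n] lat_monoD[of a m n] by (auto simp: box_def)
  then have "box m n \<subseteq> {0}" by blast
  then show ?thesis using finite_subset by blast
qed (simp add: box_eq)

lemma card_box: "m \<le> n \<Longrightarrow> card (box m n) = p ^ nat (n - m)"
  by (simp add: box_eq card_image inj_on_def)

lemma rd_box: "a \<in> lat m \<Longrightarrow> m \<le> n \<Longrightarrow> rd a n \<in> box m n"
  by (simp add: box_def rd_lat)

lemma Qp_box: "x \<in> Qp p \<Longrightarrow> x m = 0 \<Longrightarrow> x n \<in> box m n"
  by (simp add: box_def Qp_lat Qp_bounds)

definition lifts :: "rat \<Rightarrow> int \<Rightarrow> rat set" where
  "lifts a n = (\<lambda>d. a + of_nat d * P powi n) ` {..<p}"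

lemma card_lifts: "card (lifts a n) = p" and finite_lifts [simp]: "finite (lifts a n)"
  by (simp_all add: lifts_def card_image inj_on_def)

lemma lifts_iff:
  assumes "0 \<le> a" "a < P powi n"
  shows "b \<in> lifts a n \<longleftrightarrow> b - a \<in> lat n \<and> 0 \<le> b \<and> b < P powi (n + 1)"
proof
  assume "b \<in> lifts a n"
  then obtain d where d: "d < p" "b = a + of_nat d * P powi n" by (auto simp: lifts_def)
  have "of_nat d * P powi n \<le> of_nat (p - 1) * P powi n"
    using d(1) by (intro mult_right_mono) (auto intro: less_imp_le)
  also have "\<dots> = P powi (n + 1) - P powi n"
    using p_gt_1 by (simp add: power_int_add of_nat_diff algebra_simps)
  finally have "b < P powi (n + 1)" using assms d by simp
  moreover have "b - a \<in> lat n" unfolding lat_def d(2) by (intro image_eqI[of _ _ "int d"]) auto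
  moreover have "0 \<le> b" using assms d(2) Ppow_pos[of n] by simp
  ultimately show "b - a \<in> lat n \<and> 0 \<le> b \<and> b < P powi (n + 1)" by blast
next
  assume b: "b - a \<in> lat n \<and> 0 \<le> b \<and> b < P powi (n + 1)"
  then obtain k where k: "b - a = of_int k * P powi n" by (auto simp: lat_def)
  have "(-1) * P powi n < of_int k * P powi n" using k b assms by simp
  then have "(-1 :: rat) < of_int k" by (simp only: mult_less_cancel_right_pos Ppow_pos)
  moreover have "of_int k * P powi n < of_nat p * P powi n"
    unfolding k[symmetric] using b assms by (simp add: power_int_add mult.commute)
  then have "(of_int k :: rat) < of_nat p" by (simp only: mult_less_cancel_right_pos Ppow_pos)
  ultimately have "0 \<le> k" "k < int p" by linarith+
  then show "b \<in> lifts a n" unfolding lifts_def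
    using k by (intro image_eqI[of _ _ "nat k"]) (auto simp: nat_less_iff algebra_simps)
qed

lemma lifts_rd: "0 \<le> a \<Longrightarrow> a < P powi n \<Longrightarrow> b \<in> lifts a n \<Longrightarrow> rd b n = a"
  using lifts_iff rd_eqI by blast

lemma Qp_lifts: "x \<in> Qp p \<Longrightarrow> x (n + 1) \<in> lifts (x n) n"
  by (simp add: lifts_iff Qp_bounds Qp_diff)

text \<open>A ball of radius p^(-n) meeting \<open>X\<close> is the same thing as a residue of
  \<open>X\<close> modulo p^n. Together with \<open>children\<close> this encodes the tree of balls
  by rational numbers.\<close>

definition res :: "(int \<Rightarrow> rat) set \<Rightarrow> int \<Rightarrow> rat set" where
  "res X n = (\<lambda>x. x n) ` X"

definition children :: "(int \<Rightarrow> rat) set \<Rightarrow> rat \<Rightarrow> int \<Rightarrow> rat set" where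
  "children X a n = {b \<in> res X (n + 1). rd b n = a}"

lemma children_subset_lifts: "X \<subseteq> Qp p \<Longrightarrow> children X a n \<subseteq> lifts a n"
proof
  fix b assume X: "X \<subseteq> Qp p" and "b \<in> children X a n"
  then obtain x where "x \<in> X" "b = x (n + 1)" "rd b n = a" by (auto simp: children_def res_def)
  then show "b \<in> lifts a n" using X Qp_lifts[of x n] Qp_rd[of x n "n + 1"] by auto
qed

lemma res_child: "X \<subseteq> Qp p \<Longrightarrow> x \<in> X \<Longrightarrow> x (n + 1) \<in> children X (x n) n"
  using Qp_rd[of x n "n + 1"] by (auto simp: children_def res_def)

text \<open>\<open>J\<close> is the set of levels at which \<open>X\<close> branches.\<close>

definition homog :: "(int \<Rightarrow> rat) set \<Rightarrow> int set \<Rightarrow> bool" where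
  "homog X J \<longleftrightarrow> X \<subseteq> Qp p \<and>
     (\<forall>n. \<forall>a\<in>res X n. card (children X a n) = (if n \<in> J then p else 1))"

lemma homog_lifts:
  assumes "homog X J" "n \<in> J" "a \<in> res X n" shows "children X a n = lifts a n"
  using assms children_subset_lifts[of X a n] card_lifts[of a n]
  by (intro card_subset_eq) (auto simp: homog_def)

lemma homog_unique:
  assumes "homog X J" "n \<notin> J" "x \<in> X" "y \<in> X" "x n = y n" shows "x (n + 1) = y (n + 1)"
proof -
  have X: "X \<subseteq> Qp p" using assms by (simp add: homog_def)
  have "card (children X (x n) n) = 1" using assms by (auto simp: homog_def res_def)
  then obtain b where "children X (x n) n = {b}" by (auto simp: card_1_singleton_iff)
  then show ?thesis using res_child[OF X assms(3), of n] res_child[OF X assms(4), of n] assms(5) by simp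
qed

definition inside :: "int \<Rightarrow> (int \<Rightarrow> rat) set \<Rightarrow> bool" where
  "inside A X \<longleftrightarrow> X \<subseteq> {x \<in> Qp p. x A = 0}"

lemma insideD: "inside A X \<Longrightarrow> X \<subseteq> Qp p" "inside A X \<Longrightarrow> x \<in> X \<Longrightarrow> x \<in> Qp p" "inside A X \<Longrightarrow> x \<in> X \<Longrightarrow> x A = 0"
  unfolding inside_def by auto

lemma insideI: "(\<And>x. x \<in> X \<Longrightarrow> x \<in> Qp p) \<Longrightarrow> (\<And>x. x \<in> X \<Longrightarrow> x A = 0) \<Longrightarrow> inside A X"
  unfolding inside_def by auto

lemma res_box: "inside A X \<Longrightarrow> res X n \<subseteq> box A n"
  unfolding res_def inside_def by (auto intro!: Qp_box)

lemma finite_res: "inside A X \<Longrightarrow> finite (res X n)"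
  by (rule finite_subset[OF res_box finite_box])

lemma rd_res: "X \<subseteq> Qp p \<Longrightarrow> m \<le> n \<Longrightarrow> b \<in> res X n \<Longrightarrow> rd b m \<in> res X m"
  unfolding res_def by (auto simp: Qp_rd subset_iff)

lemma rd_res_id: "X \<subseteq> Qp p \<Longrightarrow> b \<in> res X n \<Longrightarrow> rd b n = b"
  unfolding res_def by (auto simp: Qp_rd subset_iff)

text \<open>When branching depends on the level alone, all vertices of a level have equally many
  descendants. This lets a character sum at level \<open>i\<close> be computed at the level of its
  conductor, each term being repeated \<open>w\<close> times.\<close>

lemma homog_fibre_card:
  assumes h: "homog X J" and A: "inside A X" and "m \<le> i"
  shows "\<exists>w. \<forall>b\<in>res X m. card {c \<in> res X i. rd c m = b} = w"
  using \<open>m \<le> i\<close>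
proof (induction i rule: int_ge_induct)
  case base
  have X: "X \<subseteq> Qp p" using h by (simp add: homog_def)
  have "{c \<in> res X m. rd c m = b} = {b}" if "b \<in> res X m" for b
    using that rd_res_id[OF X, of _ m] by auto
  then show ?case by (intro exI[of _ 1]) simp
next
  case (step i)
  have X: "X \<subseteq> Qp p" using h by (simp add: homog_def)
  have fin: "finite (res X n)" for n
    using finite_res[OF A] .
  obtain w where w: "\<And>b. b \<in> res X m \<Longrightarrow> card {c \<in> res X i. rd c m = b} = w" using step by blast
  have "card {c \<in> res X (i + 1). rd c m = b} = (if i \<in> J then p else 1) * w" if b: "b \<in> res X m" for b
  proof -
    have "card {c \<in> res X (i + 1). rd c m = b} = (if i \<in> J then p else 1) * card {c \<in> res X i. rd c m = b}"
    proof (rule card_fibres)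
      show "(\<lambda>c. rd c i) ` {c \<in> res X (i + 1). rd c m = b} \<subseteq> {c \<in> res X i. rd c m = b}"
        using rd_res[OF X, of i "i + 1"] step(1) by (auto simp: rd_rd)
      fix c assume c: "c \<in> {c \<in> res X i. rd c m = b}"
      have "{s \<in> {c \<in> res X (i + 1). rd c m = b}. rd s i = c} = children X c i"
        using c step(1) by (auto simp: children_def rd_rd)
      then show "card {s \<in> {c \<in> res X (i + 1). rd c m = b}. rd s i = c} = (if i \<in> J then p else 1)"
        using h c by (auto simp: homog_def)
    qed (use fin in auto)
    then show ?thesis using w[OF b] by simp
  qed
  then show ?case by blast
qed

text \<open>The character of \<open>q\<close> depends on residues at level \<open>k + 1\<close>
  only, so the sum is a multiple of the sum \<open>S\<close> taken there. Full branching at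
  \<open>k\<close> makes translation by p^k a permutation of these residues, and it multiplies
  \<open>S\<close> by a number different from 1.\<close>

lemma homog_vanishing_sum:
  assumes h: "homog X J" and A: "inside A X" and k: "k \<in> J" "k + 1 \<le> i"
    and q: "q \<in> lat (- (k + 1))" "q \<notin> lat (- k)"
  shows "(\<Sum>b\<in>res X i. e (q * b)) = 0"
proof -
  have X: "X \<subseteq> Qp p" using h by (simp add: homog_def)
  have fin: "finite (res X n)" for n
    using finite_res[OF A] .
  obtain w where w: "\<And>b. b \<in> res X (k + 1) \<Longrightarrow> card {c \<in> res X i. rd c (k + 1) = b} = w"
    using homog_fibre_card[OF h A k(2)] by blast
  define S where "S = (\<Sum>b\<in>res X (k + 1). e (q * b))"
  have "(\<Sum>b\<in>res X i. e (q * b)) = (\<Sum>b\<in>res X i. e (q * rd b (k + 1)))"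
    by (intro sum.cong refl e_mult_cong[OF q(1)] rd_diff)
  also have "\<dots> = of_nat w * S"
    unfolding S_def using fin w rd_res[OF X k(2)] by (intro sum_fibres) auto
  finally have 1: "(\<Sum>b\<in>res X i. e (q * b)) = of_nat w * S" .
  define s where "s b = rd (b + P powi k) (k + 1)" for b
  have inj: "inj_on s (res X (k + 1))"
  proof (rule inj_onI)
    fix b c assume b: "b \<in> res X (k + 1)" "c \<in> res X (k + 1)" "s b = s c"
    then have "b - c \<in> lat (k + 1)" by (simp add: s_def rd_eq_iff)
    then show "b = c" using b(1,2) X Qp_bounds by (intro lat_unique) (auto simp: res_def)
  qed
  have sub: "s ` res X (k + 1) \<subseteq> res X (k + 1)"
  proof
    fix c assume "c \<in> s ` res X (k + 1)"
    then obtain x where x: "x \<in> X" "c = s (x (k + 1))" by (auto simp: res_def)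
    have xQ: "x \<in> Qp p" using x X by auto
    have "x (k + 1) + P powi k - x k \<in> lat k"
      using lat_add[OF Qp_diff[OF xQ, of k "k + 1"] lat_self] by (simp add: algebra_simps)
    then have "c - x k \<in> lat k"
      using lat_trans[OF lat_monoD[OF rd_diff'[of "x (k + 1) + P powi k" "k + 1"]], of k] x(2)
      by (simp add: s_def)
    then have "c \<in> lifts (x k) k"
      using Qp_bounds[OF xQ] by (subst lifts_iff) (auto simp: x(2) s_def)
    also have "lifts (x k) k = children X (x k) k"
      using homog_lifts[OF h k(1), of "x k"] x by (auto simp: res_def)
    finally show "c \<in> res X (k + 1)" by (simp add: children_def)
  qed
  have "bij_betw s (res X (k + 1)) (res X (k + 1))"
    using endo_inj_surj[OF fin sub inj] inj by (simp add: bij_betw_def)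
  then have "S = (\<Sum>b\<in>res X (k + 1). e (q * s b))"
    unfolding S_def by (rule sum.reindex_bij_betw[symmetric])
  also have "\<dots> = (\<Sum>b\<in>res X (k + 1). e (q * P powi k) * e (q * b))"
  proof (rule sum.cong[OF refl])
    fix b
    have "e (q * s b) = e (q * (b + P powi k))"
      unfolding s_def by (rule e_mult_cong[OF q(1) rd_diff'])
    then show "e (q * s b) = e (q * P powi k) * e (q * b)" by (simp add: distrib_left e_add mult.commute)
  qed
  finally have "S = e (q * P powi k) * S" unfolding S_def sum_distrib_left[symmetric] .
  moreover have "e (q * P powi k) \<noteq> 1"
  proof
    assume "e (q * P powi k) = 1"
    then have "q * P powi k * P powi (- k) \<in> lat (0 + - k)"
      unfolding e_eq_1_iff by (intro lat_mult lat_self)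
    moreover have "q * P powi k * P powi (- k) = q" by (simp add: power_int_minus)
    ultimately show False using q(2) by simp
  qed
  ultimately have "S = 0" by (metis mult_cancel_right2)
  then show ?thesis using 1 by simp
qed

text \<open>Balls are indexed by level, so \<open>rball v n\<close> has radius p^(-n). It is empty
  when \<open>v\<close> is not a residue at level \<open>n\<close>; statements about inclusions
  therefore supply a point of the ball.\<close>

definition rball :: "rat \<Rightarrow> int \<Rightarrow> (int \<Rightarrow> rat) set" where
  "rball v n = {x \<in> Qp p. x n = v}"

lemma qp_ball_eq: "qp_ball p a n = rball (a (- n)) (- n)"
  by (simp add: qp_ball_def rball_def)

lemma ball_subset_iff:
  assumes "x \<in> Qp p" "x (n + 1) = w"
  shows "rball w (n + 1) \<subseteq> rball v n \<longleftrightarrow> rd w n = v"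
proof
  assume "rball w (n + 1) \<subseteq> rball v n"
  then have "x n = v" using assms by (auto simp: rball_def)
  then show "rd w n = v" using assms Qp_rd[of x n "n + 1"] by auto
next
  assume "rd w n = v"
  then show "rball w (n + 1) \<subseteq> rball v n" using Qp_rd[of _ n "n + 1"] by (auto simp: rball_def)
qed

lemma meeting_balls_eq:
  assumes X: "X \<subseteq> Qp p"
  shows "meeting_balls p X n = (\<lambda>v. rball v n) ` res X n"
proof (intro equalityI subsetI)
  fix B assume "B \<in> meeting_balls p X n"
  then obtain a x where "B = rball (a n) n" "x \<in> X" "x \<in> rball (a n) n"
    by (auto simp: meeting_balls_def qp_ball_eq)
  then have "B = rball (x n) n" "x n \<in> res X n" by (simp add: rball_def) (use \<open>x \<in> X\<close> in \<open>simp add: res_def\<close>)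
  then show "B \<in> (\<lambda>v. rball v n) ` res X n" by blast
next
  fix B assume "B \<in> (\<lambda>v. rball v n) ` res X n"
  then obtain x where "x \<in> X" "B = rball (x n) n" by (auto simp: res_def)
  then show "B \<in> meeting_balls p X n"
    unfolding meeting_balls_def qp_ball_eq using X by (auto intro!: exI[of _ x] simp: rball_def)
qed

lemma card_meeting_children:
  assumes X: "X \<subseteq> Qp p"
  shows "card {C \<in> meeting_balls p X (n + 1). C \<subseteq> rball v n} = card (children X v n)"
proof -
  have inj: "inj_on (\<lambda>v. rball v n) (res X n)" for n
  proof (rule inj_onI)
    fix v w assume "v \<in> res X n" "w \<in> res X n" and eq: "rball v n = rball w n"
    then obtain x where "x \<in> X" "v = x n" by (auto simp: res_def)
    then have "x \<in> rball w n" using X eq by (auto simp: rball_def)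
    then show "v = w" using \<open>v = x n\<close> by (simp add: rball_def)
  qed
  have "rball w (n + 1) \<subseteq> rball v n \<longleftrightarrow> rd w n = v" if w: "w \<in> res X (n + 1)" for w
  proof -
    obtain x where "x \<in> X" "w = x (n + 1)" using w unfolding res_def by blast
    then show ?thesis using ball_subset_iff[of x n w v] X by blast
  qed
  then have "{C \<in> meeting_balls p X (n + 1). C \<subseteq> rball v n} = (\<lambda>w. rball w (n + 1)) ` children X v n"
    unfolding meeting_balls_eq[OF X] children_def by auto
  then show ?thesis using inj[of "n + 1"]
    by (simp add: card_image inj_on_subset[of _ "res X (n + 1)"] children_def)
qed

lemma p_homogeneous_iff_homog:
  assumes X: "X \<subseteq> Qp p"
  shows "p_homogeneous p X \<longleftrightarrow> (\<exists>J. homog X J)"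
proof -
  have mb: "(\<forall>B\<in>meeting_balls p X n. card {C \<in> meeting_balls p X (n + 1). C \<subseteq> B} = w) \<longleftrightarrow>
      (\<forall>v\<in>res X n. card (children X v n) = w)" for n w
    unfolding card_meeting_children[OF X, symmetric] by (simp add: meeting_balls_eq[OF X, of n])
  show ?thesis
  proof
    assume h: "p_homogeneous p X"
    have "homog X {n. \<forall>v\<in>res X n. card (children X v n) = p}"
      unfolding homog_def using X h unfolding p_homogeneous_def mb by auto
    then show "\<exists>J. homog X J" by blast
  next
    assume "\<exists>J. homog X J"
    then obtain J where "homog X J" by blast
    then show "p_homogeneous p X" unfolding p_homogeneous_def mb homog_def by metis
  qed
qed

text \<open>\<open>X\<close> is a union of full balls of radius p^(-N), so its tree is complete from
  level \<open>N\<close> on: a lift \<open>b\<close> is realized by \<open>emb b\<close>, whose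
  residue modulo p^N is that of a point of \<open>X\<close>.\<close>

lemma periodic_children:
  assumes X: "X = {x \<in> Qp p. x N \<in> C}" and n: "N \<le> n" and a: "a \<in> res X n"
  shows "children X a n = lifts a n"
proof
  show "children X a n \<subseteq> lifts a n" using X by (intro children_subset_lifts) auto
  show "lifts a n \<subseteq> children X a n"
  proof
    fix b assume b: "b \<in> lifts a n"
    obtain x where x: "x \<in> Qp p" "x N \<in> C" "a = x n" using a X by (auto simp: res_def)
    obtain A where "x A = 0" using Qp_zero x by blast
    have bb: "b - a \<in> lat n" "0 \<le> b" "b < P powi (n + 1)"
      using b lifts_iff[of a n b] Qp_bounds[OF x(1)] x(3) by auto
    have rdb: "rd b n = a" using lifts_rd[OF _ _ b] Qp_bounds[OF x(1)] x(3) by auto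
    have "b \<in> lat (min A n)"
      using lat_add[of "b - a" "min A n" a] lat_monoD[OF bb(1), of "min A n"]
        lat_monoD[OF Qp_lat[OF x(1) \<open>x A = 0\<close>], of "min A n" n] x(3) by simp
    then have eQ: "emb b \<in> Qp p" by (rule emb_Qp)
    have "emb b N = x N" using n rdb Qp_rd[OF x(1) n] x(3) rd_rd[OF n, of b] by (simp add: emb_apply)
    then have "emb b \<in> X" using eQ x X by simp
    moreover have "emb b (n + 1) = b" using bb by (simp add: emb_apply rd_id)
    ultimately have "b \<in> res X (n + 1)" unfolding res_def by (metis imageI)
    then show "b \<in> children X a n" using rdb by (simp add: children_def)
  qed
qed

text \<open>Puts balls within reach of \<open>homog_vanishing_sum\<close>: a character that is not
  constant on a ball sums to zero over it.\<close>

lemma homog_ball: "homog (rball v m) {m..}"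
  unfolding homog_def
proof (intro conjI allI ballI)
  show sub: "rball v m \<subseteq> Qp p" by (auto simp: rball_def)
  fix n a assume a: "a \<in> res (rball v m) n"
  show "card (children (rball v m) a n) = (if n \<in> {m..} then p else 1)"
  proof (cases "m \<le> n")
    case True
    then show ?thesis
      using periodic_children[of "rball v m" m "{v}" n a] a by (simp add: rball_def card_lifts)
  next
    case False
    obtain x where x: "x \<in> rball v m" "a = x n" using a by (auto simp: res_def)
    have "y (n + 1) = x (n + 1)" if "y \<in> rball v m" for y
      using that x(1) False Qp_eq_mono[of y x m "n + 1"] by (auto simp: rball_def)
    then have "children (rball v m) a n = {x (n + 1)}"
      using res_child[OF sub x(1), of n] x(2) unfolding children_def res_def by blast
    then show ?thesis using False by simp
  qed
qed

lemma res_ball_0: "m \<le> n \<Longrightarrow> res (rball 0 m) n = box m n"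
proof (intro equalityI subsetI)
  fix a assume "a \<in> res (rball 0 m) n"
  then show "a \<in> box m n" using Qp_box by (auto simp: res_def rball_def)
next
  fix a assume mn: "m \<le> n" and a: "a \<in> box m n"
  then have "emb a \<in> Qp p" "emb a m = 0" "emb a n = a"
    by (auto simp: box_def intro: emb_Qp simp: emb_apply rd_eq_0_iff rd_id)
  then show "a \<in> res (rball 0 m) n" unfolding res_def rball_def by (metis (mono_tags, lifting) image_eqI mem_Collect_eq)
qed

text \<open>The points \<open>a\<close> and \<open>b\<close> range over all classes in p^(-M) Z, not
  only over those met by \<open>X\<close>, so one class that is met forces its siblings to be met
  equally often. Counting takes place at the finest level \<open>N\<close>, and level
  \<open>n\<close> concerns the digit at position \<open>n - 1\<close>.\<close>

definition equid :: "int \<Rightarrow> int \<Rightarrow> (int \<Rightarrow> rat) set \<Rightarrow> int \<Rightarrow> bool" where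
  "equid M N X n \<longleftrightarrow> (\<forall>a\<in>lat (- M). \<forall>b\<in>lat (- M). a - b \<in> lat (n - 1) \<longrightarrow>
     card {c \<in> res X N. c - a \<in> lat n} = card {c \<in> res X N. c - b \<in> lat n})"

text \<open>The class of \<open>x N\<close> is counted at least once, so the equality of counts
  makes every sibling class nonempty.\<close>

lemma equid_children:
  assumes X: "inside (- M) X" and n: "- M < n" "n \<le> N"
    and eq: "equid M N X n" and a: "a \<in> res X (n - 1)"
  shows "children X a (n - 1) = lifts a (n - 1)"
proof
  show "children X a (n - 1) \<subseteq> lifts a (n - 1)" by (rule children_subset_lifts[OF insideD(1)[OF X]])
  show "lifts a (n - 1) \<subseteq> children X a (n - 1)"
  proof
    fix b assume b: "b \<in> lifts a (n - 1)"
    obtain x where x: "x \<in> X" "a = x (n - 1)" using a by (auto simp: res_def)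
    have xQ: "x \<in> Qp p" using x insideD(2)[OF X] by blast
    have bb: "b - a \<in> lat (n - 1)" "0 \<le> b" "b < P powi n"
      using b lifts_iff[of a "n - 1" b] Qp_bounds[OF xQ] x(2) by auto
    have rdb: "rd b (n - 1) = a" using lifts_rd[OF _ _ b] Qp_bounds[OF xQ] x(2) by auto
    have "a \<in> lat (- M)" using Qp_lat[OF xQ insideD(3)[OF X x(1)]] x(2) by simp
    then have bM: "b \<in> lat (- M)" using lat_add[OF lat_monoD[OF bb(1), of "- M"], of a] n by simp
    have xM: "x N \<in> lat (- M)" using Qp_lat[OF xQ insideD(3)[OF X x(1)]] by simp
    have "x N - b \<in> lat (n - 1)"
      using lat_trans[OF Qp_diff[OF xQ, of "n - 1" N], of b] bb(1) n x(2) lat_diff_commute by simp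
    then have "card {c \<in> res X N. c - x N \<in> lat n} = card {c \<in> res X N. c - b \<in> lat n}"
      using eq xM bM unfolding equid_def by blast
    moreover have "x N \<in> {c \<in> res X N. c - x N \<in> lat n}" using x by (auto simp: res_def)
    moreover have "finite {c \<in> res X N. c - x N \<in> lat n}" using finite_res[OF X] by simp
    ultimately have "{c \<in> res X N. c - b \<in> lat n} \<noteq> {}" by (metis card.empty card_0_eq emptyE)
    then obtain y where y: "y \<in> X" "y N - b \<in> lat n" by (auto simp: res_def)
    have "y n = b" using Qp_rd[OF insideD(2)[OF X y(1)] n(2)] rd_eqI[OF y(2) bb(2,3)] by simp
    then have "b \<in> res X n" using y(1) by (auto simp: res_def)
    then show "b \<in> children X a (n - 1)" using rdb by (simp add: children_def)
  qed
qed

lemma card_res_step: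
  assumes X: "inside A X"
    and w: "\<And>a. a \<in> res X n \<Longrightarrow> card (children X a n) = w"
  shows "card (res X (n + 1)) = w * card (res X n)"
proof (rule card_fibres[where f = "\<lambda>c. rd c n"])
  show "finite (res X (n + 1))" "finite (res X n)" by (rule finite_res[OF X])+
  show "(\<lambda>c. rd c n) ` res X (n + 1) \<subseteq> res X n" using rd_res[OF insideD(1)[OF X], of n "n + 1"] by auto
qed (use w in \<open>simp add: children_def\<close>)

lemma res_rd_image: "X \<subseteq> Qp p \<Longrightarrow> m \<le> n \<Longrightarrow> res X m = (\<lambda>c. rd c m) ` res X n"
  unfolding res_def image_image by (intro image_cong refl) (auto simp: Qp_rd subset_iff)

lemma card_res_mono:
  assumes X: "inside A X" and "m \<le> n"
  shows "card (res X m) \<le> card (res X n)"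
  unfolding res_rd_image[OF insideD(1)[OF X] assms(2)] by (rule card_image_le[OF finite_res[OF X]])

lemma res_zero:
  assumes X: "inside A X" "X \<noteq> {}" and n: "n \<le> A" shows "res X n = {0}"
proof -
  have "x n = 0" if "x \<in> X" for x using Qp_zero_mono[OF _ _ n] insideD[OF X(1)] that by blast
  then have "res X n = (\<lambda>x. 0) ` X" unfolding res_def by (intro image_cong) auto
  then show ?thesis using X(2) by auto
qed

text \<open>Levels in \<open>S\<close> multiply the count by exactly \<open>p\<close>, and other
  levels never lower it. The second conjunct belongs to the same induction: once the count has grown
  at a level outside \<open>S\<close>, the bound stays strict, because later steps scale both sides
  by \<open>p\<close> or do not lower the count.\<close>

lemma card_res_lower:
  assumes X: "inside (- M) X" "X \<noteq> {}"
    and S: "S \<subseteq> {- M<..N}" "\<And>n. n \<in> S \<Longrightarrow> equid M N X n" and n: "- M \<le> n" "n \<le> N"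
  shows "p ^ card (S \<inter> {..n}) \<le> card (res X n) \<and>
    ((\<exists>m. - M < m \<and> m \<le> n \<and> m \<notin> S \<and> card (res X (m - 1)) < card (res X m)) \<longrightarrow>
       p ^ card (S \<inter> {..n}) < card (res X n))"
  using n
proof (induction n rule: int_ge_induct)
  case base
  have "S \<inter> {..- M} = {}" using S(1) by auto
  then show ?case using res_zero[OF X order_refl] by simp
next
  case (step n)
  have fin: "finite (S \<inter> {..n})" by (rule finite_subset[of _ "{- M..N}"]) (use S in auto)
  show ?case
  proof (cases "n + 1 \<in> S")
    case True
    have "card (children X a n) = p" if "a \<in> res X n" for a
      using equid_children[OF X(1) _ _ S(2)[OF True], of a] step.hyps step.prems that card_lifts by simp
    then have c: "card (res X (n + 1)) = p * card (res X n)" using card_res_step[OF X(1), of n p] by blast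
    have "S \<inter> {..n + 1} = insert (n + 1) (S \<inter> {..n})" using True by auto
    then have s: "card (S \<inter> {..n + 1}) = Suc (card (S \<inter> {..n}))" using fin by simp
    have "(\<exists>m. - M < m \<and> m \<le> n + 1 \<and> m \<notin> S \<and> card (res X (m - 1)) < card (res X m)) \<longrightarrow>
      (\<exists>m. - M < m \<and> m \<le> n \<and> m \<notin> S \<and> card (res X (m - 1)) < card (res X m))"
    proof (intro impI)
      assume "\<exists>m. - M < m \<and> m \<le> n + 1 \<and> m \<notin> S \<and> card (res X (m - 1)) < card (res X m)"
      then obtain m where m: "- M < m" "m \<le> n + 1" "m \<notin> S" "card (res X (m - 1)) < card (res X m)" by blast
      then have "m \<le> n" using True by (cases "m = n + 1") auto
      then show "\<exists>m. - M < m \<and> m \<le> n \<and> m \<notin> S \<and> card (res X (m - 1)) < card (res X m)" using m by blast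
    qed
    moreover have "n \<le> N" using step.prems by simp
    ultimately show ?thesis using step.IH c s p_pos by (simp del: p_nz)
  next
    case False
    have "m \<le> n" if "m \<in> S" "m \<le> n + 1" for m using that False by (cases "m = n + 1") auto
    then have Seq: "S \<inter> {..n + 1} = S \<inter> {..n}" by auto
    have mono: "card (res X n) \<le> card (res X (n + 1))" using card_res_mono[OF X(1), of n "n + 1"] by simp
    have IH: "p ^ card (S \<inter> {..n}) \<le> card (res X n)" using step.IH step.prems by simp
    have "p ^ card (S \<inter> {..n}) < card (res X (n + 1))"
      if E: "\<exists>m. - M < m \<and> m \<le> n + 1 \<and> m \<notin> S \<and> card (res X (m - 1)) < card (res X m)"
    proof -
      obtain m where m: "- M < m" "m \<le> n + 1" "m \<notin> S" "card (res X (m - 1)) < card (res X m)" using E by blast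
      show ?thesis
      proof (cases "m = n + 1")
        case True
        then show ?thesis using m IH by simp
      next
        case False
        then have "m \<le> n" using m by simp
        then have "p ^ card (S \<inter> {..n}) < card (res X n)" using step.IH step.prems m by force
        then show ?thesis using mono by simp
      qed
    qed
    then show ?thesis unfolding Seq using IH mono by simp
  qed
qed

text \<open>Each equidistributed level multiplies the number of residues by \<open>p\<close>; if the total does not exceed
  the product of these factors, no other level can branch at all.\<close>

lemma homog_if_card_le:
  assumes X: "X = {x \<in> Qp p. x N \<in> C}" "X \<noteq> {}" "inside (- M) X" and MN: "- M \<le> N"
    and S: "S \<subseteq> {- M<..N}" "\<And>n. n \<in> S \<Longrightarrow> equid M N X n" and le: "card (res X N) \<le> p ^ card S"
  shows "homog X ({n. n + 1 \<in> S} \<union> {N..})"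
  unfolding homog_def
proof (intro conjI allI ballI)
  show XQ: "X \<subseteq> Qp p" using X by auto
  fix n a assume a: "a \<in> res X n"
  have "S \<inter> {..N} = S" using S by auto
  \<comment> \<open>The upper bound \<open>le\<close> meets the lower bound, so no level outside
    \<open>S\<close> can enlarge the count.\<close>
  then have eq: "card (res X (m - 1)) \<ge> card (res X m)" if "- M < m" "m \<le> N" "m \<notin> S" for m
    using card_res_lower[OF X(3,2) S MN order_refl] le that by (metis not_le)
  \<comment> \<open>Branching at \<open>n\<close> is decided at level \<open>n + 1\<close>. From
    \<open>N\<close> on the tree is complete; at levels of \<open>S\<close> it branches fully; at
    other levels an unchanged count makes reduction injective; below \<open>- M\<close> the only
    residue is 0.\<close>
  consider "n \<ge> N" | "n < N" "n + 1 \<in> S" | "n < N" "n + 1 \<notin> S" "- M \<le> n" | "n < N" "n + 1 \<notin> S" "n < - M" by linarith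
  then show "card (children X a n) = (if n \<in> {n. n + 1 \<in> S} \<union> {N..} then p else 1)"
  proof cases
    case 1
    then show ?thesis using periodic_children[OF X(1) _ a] card_lifts by simp
  next
    case 2
    then have "children X a n = lifts a n"
      using equid_children[OF X(3) _ _ S(2)[OF 2(2)], of a] S(1) a by auto
    then show ?thesis using 2 card_lifts by simp
  next
    case 3
    have r: "res X n = (\<lambda>c. rd c n) ` res X (n + 1)" by (rule res_rd_image[OF XQ]) simp
    have "card (res X (n + 1)) \<le> card (res X n)" using eq[of "n + 1"] 3 by simp
    moreover have fin: "finite (res X (n + 1))" by (rule finite_res[OF X(3)])
    ultimately have inj: "inj_on (\<lambda>c. rd c n) (res X (n + 1))"
      unfolding r using card_image_le[OF fin, of "\<lambda>c. rd c n"] by (intro eq_card_imp_inj_on[OF fin]) simp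
    obtain b where b: "b \<in> res X (n + 1)" "rd b n = a" using a unfolding r by auto
    then have "children X a n = {b}" using inj by (auto simp: children_def inj_on_def)
    then show ?thesis using 3 by simp
  next
    case 4
    then have "n + 1 \<le> - M" "n \<le> - M" by auto
    then have "res X (n + 1) = {0}" "res X n = {0}"
      using res_zero[OF X(3,2)] by blast+
    moreover have "rd 0 n = 0" by (rule rd_id) auto
    ultimately have "children X a n = {0}" using a by (auto simp: children_def)
    then show ?thesis using 4 by simp
  qed
qed

text \<open>Counterpart of \<open>card_res_lower\<close>, to be applied to the frequencies of a
  spectrum: two elements can separate only at positions in \<open>K\<close>, and each of these
  contributes a factor of at most \<open>p\<close>.\<close>

lemma card_res_upper:
  assumes X: "inside A X" "X \<noteq> {}"
    and K: "\<And>x y k. x \<in> X \<Longrightarrow> y \<in> X \<Longrightarrow> x k = y k \<Longrightarrow> x (k + 1) \<noteq> y (k + 1) \<Longrightarrow> k \<in> K"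
    and n: "A \<le> n"
  shows "card (res X n) \<le> p ^ card (K \<inter> {A..<n})"
  using n
proof (induction n rule: int_ge_induct)
  case base
  then show ?case using res_zero[OF X order_refl] by simp
next
  case (step n)
  have fin: "finite (K \<inter> {A..<n})" by auto
  have r: "res X n = (\<lambda>c. rd c n) ` res X (n + 1)" by (rule res_rd_image[OF insideD(1)[OF X(1)]]) simp
  have finr: "finite (res X i)" for i by (rule finite_res[OF X(1)])
  show ?case
  proof (cases "n \<in> K")
    case True
    have "res X (n + 1) \<subseteq> (\<Union>a\<in>res X n. lifts a n)"
      using insideD(1)[OF X(1)] Qp_lifts unfolding res_def by blast
    then have "card (res X (n + 1)) \<le> card (\<Union>a\<in>res X n. lifts a n)"
      using finr by (intro card_mono) auto
    also have "\<dots> \<le> (\<Sum>a\<in>res X n. card (lifts a n))" by (rule card_UN_le[OF finr])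
    also have "\<dots> = p * card (res X n)" by (simp add: card_lifts)
    also have "\<dots> \<le> p * p ^ card (K \<inter> {A..<n})" using step by simp
    also have "p * p ^ card (K \<inter> {A..<n}) = p ^ card (insert n (K \<inter> {A..<n}))" using fin by simp
    also have "insert n (K \<inter> {A..<n}) = K \<inter> {A..<n + 1}" using True step by auto
    finally show ?thesis .
  next
    case False
    have "inj_on (\<lambda>c. rd c n) (res X (n + 1))"
    proof (rule inj_onI)
      fix b c assume "b \<in> res X (n + 1)" "c \<in> res X (n + 1)" and eq: "rd b n = rd c n"
      then obtain x y where xy: "x \<in> X" "y \<in> X" "b = x (n + 1)" "c = y (n + 1)" by (auto simp: res_def)
      then have "rd b n = x n" "rd c n = y n" using insideD(2)[OF X(1)] Qp_rd[of x n "n + 1"] Qp_rd[of y n "n + 1"] by auto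
      then have "x n = y n" using eq by simp
      then show "b = c" using K[of x y n] xy False by auto
    qed
    then have "card (res X (n + 1)) = card (res X n)" unfolding r by (simp add: card_image)
    moreover have "K \<inter> {A..<n + 1} = K \<inter> {A..<n}"
    proof -
      have "m < n" if "m \<in> K" "m < n + 1" for m using that False by (cases "m = n") auto
      then show ?thesis by auto
    qed
    ultimately show ?thesis using step by simp
  qed
qed

section \<open>Tilings and homogeneous sets\<close>

lemma Ppow_not_lat: "P powi m \<notin> lat (m + 1)"
  using of_int_lat_iff[of 1 m 1] p_gt_1 by simp

lemma vanishing_sum_equid:
  assumes X: "inside (- M) X" and n: "- M < n" and q: "q \<in> lat (- n)" "q \<notin> lat (- n + 1)"
    and sum0: "(\<Sum>a\<in>res X N. e (q * a)) = 0"
  shows "equid M N X n"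
proof -
  have "res X N \<subseteq> lat (- M)" using res_box[OF X, of N] by (auto simp: box_def)
  then show ?thesis unfolding equid_def
    using vanishing_sum_equidistributed[OF finite_res[OF X] _ q n sum0] by blast
qed

text \<open>Restricting the translations to p^(-M) Z_p turns the tiling into a factorization of the
  finite cyclic group p^(-M) Z / p^N Z, and the counting takes place in that group.\<close>

lemma tiling_imp_homog:
  assumes X: "X = {x \<in> Qp p. x N \<in> C}" "X \<noteq> {}" "inside (- M) X" and MN: "- M \<le> N"
    and T: "T \<subseteq> Qp p" and tile: "\<And>x. x \<in> Qp p \<Longrightarrow> \<exists>!t. t \<in> T \<and> psub p x t \<in> X"
  shows "\<exists>J. homog X J"
proof -
  \<comment> \<open>Since \<open>X\<close> lies in p^(-M) Z_p, a translate of it meets p^(-M) Z_p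
    only if the translation vector lies there as well.\<close>
  define T' where "T' = {t \<in> T. t (- M) = 0}"
  have insT: "inside (- M) T'" using T by (intro insideI) (auto simp: T'_def)
  define f where "f = (\<lambda>(a, b). rd (a + b) N)"
  have latX: "a \<in> lat (- M)" if "a \<in> res X N" for a using that res_box[OF X(3), of N] by (auto simp: box_def)
  have latT: "a \<in> lat (- M)" if "a \<in> res T' N" for a using that res_box[OF insT, of N] by (auto simp: box_def)
  have bij: "bij_betw f (res X N \<times> res T' N) (box (- M) N)"
  proof (rule bij_betw_imageI)
    show "inj_on f (res X N \<times> res T' N)"
    proof (rule inj_onI, clarify)
      fix a b a' b'
      assume ab: "a \<in> res X N" "b \<in> res T' N" "a' \<in> res X N" "b' \<in> res T' N" and eq: "f (a, b) = f (a', b')"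
      \<comment> \<open>A point common to the translates belonging to \<open>b\<close> and
        \<open>b'\<close>; uniqueness of the tile containing it identifies the two.\<close>
      define y where "y = emb (a + b)"
      have yQ: "y \<in> Qp p" unfolding y_def by (rule emb_Qp[of _ "- M"]) (intro lat_add latX latT ab)
      have yN: "y N = f (a, b)" by (simp add: y_def emb_apply f_def)
      have inX: "psub p y t \<in> X" if t: "t \<in> T'" "t N = d" "c \<in> res X N" "f (a, b) = f (c, d)" for t c d
      proof -
        obtain x where x: "x \<in> X" "c = x N" using t(3) by (auto simp: res_def)
        have xQ: "x \<in> Qp p" "x N \<in> C" using x X(1) by auto
        have tQ: "t \<in> Qp p" using t(1) T by (auto simp: T'_def)
        have "rd (c + d) N - (c + d) \<in> lat N" by (rule rd_diff')
        then have "y N - t N - c \<in> lat N" using yN t(2,4) by (simp add: f_def algebra_simps)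
        then have "psub p y t N = c"
          unfolding psub_apply x(2) by (intro rd_eqI Qp_bounds xQ)
        then show ?thesis using psub_Qp[OF yQ tQ] X(1) x(2) xQ(2) by simp
      qed
      obtain t t' where t: "t \<in> T'" "t N = b" "t' \<in> T'" "t' N = b'" using ab by (auto simp: res_def)
      have "psub p y t \<in> X" "psub p y t' \<in> X" using inX[OF t(1,2) ab(1)] inX[OF t(3,4) ab(3)] eq by auto
      then have "t = t'" using tile[OF yQ] t by (auto simp: T'_def)
      then have b: "b = b'" using t by simp
      then have "a - a' \<in> lat N" using eq by (simp add: f_def rd_eq_iff)
      moreover obtain x x' where "x \<in> X" "a = x N" "x' \<in> X" "a' = x' N" using ab by (auto simp: res_def)
      ultimately have "a = a'" using insideD(2)[OF X(3)] by (intro lat_unique) (auto simp: Qp_bounds)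
      then show "a = a' \<and> b = b'" using b by simp
    qed
    show "f ` (res X N \<times> res T' N) = box (- M) N"
    proof (intro equalityI subsetI)
      fix r assume "r \<in> f ` (res X N \<times> res T' N)"
      then obtain a b where ab: "a \<in> res X N" "b \<in> res T' N" "r = rd (a + b) N" by (auto simp: f_def)
      show "r \<in> box (- M) N" unfolding ab(3) by (intro rd_box[OF _ MN] lat_add latX[OF ab(1)] latT[OF ab(2)])
    next
      fix r assume r: "r \<in> box (- M) N"
      have rQ: "emb r \<in> Qp p" using r by (intro emb_Qp[of _ "- M"]) (auto simp: box_def)
      have rN: "emb r N = r" using r by (auto simp: box_def emb_apply rd_id)
      have rM: "emb r (- M) = 0" using r by (auto simp: box_def emb_apply rd_eq_0_iff)
      obtain t where t: "t \<in> T" "psub p (emb r) t \<in> X" using tile[OF rQ] by blast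
      have tQ: "t \<in> Qp p" using t T by auto
      have "psub p (emb r) t (- M) = 0" using insideD(3)[OF X(3) t(2)] .
      then have "0 - t (- M) \<in> lat (- M)" unfolding psub_apply rM rd_eq_0_iff .
      then have "0 = t (- M)" using Qp_bounds[OF tQ] by (intro lat_unique) auto
      then have "t \<in> T'" using t by (simp add: T'_def)
      moreover have "f (psub p (emb r) t N, t N) = r"
      proof -
        have "psub p (emb r) t N + t N - r \<in> lat N"
          using rd_diff'[of "r - t N" N] by (simp add: psub_apply rN algebra_simps)
        then show ?thesis using r by (auto simp: f_def box_def intro!: rd_eqI)
      qed
      ultimately show "r \<in> f ` (res X N \<times> res T' N)" using t(2) unfolding res_def by force
    qed
  qed
  have card: "card (res X N) * card (res T' N) = p ^ nat (N + M)"
    using bij_betw_same_card[OF bij] card_box[OF MN] by (simp add: card_cartesian_product)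
  then have T'ne: "T' \<noteq> {}" by (auto simp: res_def)
  define S where "S = {n \<in> {- M<..N}. equid M N X n}"
  define S' where "S' = {n \<in> {- M<..N}. equid M N T' n}"
  have "{- M<..N} \<subseteq> S \<union> S'"
  proof
    fix n assume n: "n \<in> {- M<..N}"
    \<comment> \<open>A single character of conductor exactly p^n suffices to test equidistribution
      at level \<open>n\<close>.\<close>
    define q where "q = P powi (- n)"
    have q: "q \<in> lat (- n)" "q \<notin> lat (- n + 1)" using Ppow_not_lat[of "- n"] by (auto simp only: q_def lat_self)
    have "(\<Sum>a\<in>res X N. e (q * a)) * (\<Sum>b\<in>res T' N. e (q * b)) =
        (\<Sum>(a, b)\<in>res X N \<times> res T' N. e (q * a) * e (q * b))"
      by (simp add: sum_product sum.cartesian_product)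
    also have "\<dots> = (\<Sum>c\<in>res X N \<times> res T' N. e (q * f c))"
    proof (rule sum.cong[OF refl], clarify)
      fix a b
      have "e (q * f (a, b)) = e (q * (a + b))"
        using n by (intro e_mult_cong[OF q(1)] lat_monoD[OF rd_diff', of n N]) (auto simp: f_def intro: lat_monoD[OF rd_diff'])
      then show "e (q * a) * e (q * b) = e (q * f (a, b))" by (simp add: distrib_left e_add)
    qed
    also have "\<dots> = (\<Sum>r\<in>box (- M) N. e (q * r))" by (rule sum.reindex_bij_betw[OF bij])
    also have "\<dots> = (\<Sum>r\<in>res (rball 0 (- M)) N. e (q * r))" by (simp add: res_ball_0[OF MN])
    \<comment> \<open>The full group consists of the residues of a ball, which branches at
      \<open>n - 1\<close> because \<open>n\<close> exceeds \<open>- M\<close>.\<close>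
    also have "\<dots> = 0"
      using n q by (intro homog_vanishing_sum[OF homog_ball, of "- M" _ _ "n - 1"]) (auto intro: insideI simp: rball_def)
    finally have "(\<Sum>a\<in>res X N. e (q * a)) = 0 \<or> (\<Sum>b\<in>res T' N. e (q * b)) = 0" by simp
    then show "n \<in> S \<union> S'"
      using vanishing_sum_equid[OF X(3) _ q] vanishing_sum_equid[OF insT _ q] n by (auto simp: S_def S'_def)
  qed
  moreover have "finite (S \<union> S')" by (rule finite_subset[of _ "{- M<..N}"]) (auto simp: S_def S'_def)
  ultimately have "card {- M<..N} \<le> card (S \<union> S')" by (intro card_mono)
  also have "\<dots> \<le> card S + card S'" by (rule card_Un_le)
  finally have "nat (N + M) \<le> card S + card S'" by simp
  then have "p ^ nat (N + M) \<le> p ^ (card S + card S')" using p_gt_1 by (intro power_increasing) auto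
  then have le: "card (res X N) * card (res T' N) \<le> p ^ card S * p ^ card S'" using card by (simp add: power_add)
  have "S' \<inter> {..N} = S'" by (auto simp: S'_def)
  moreover have "S' \<subseteq> {- M<..N}" and "\<And>n. n \<in> S' \<Longrightarrow> equid M N T' n" by (auto simp: S'_def)
  ultimately have lower: "p ^ card S' \<le> card (res T' N)"
    using card_res_lower[OF insT T'ne _ _ MN order_refl, of S'] by simp
  \<comment> \<open>\<open>T'\<close> reaches at least its own lower bound, so an excess of
    \<open>X\<close> over its bound would make the product too large.\<close>
  have "card (res X N) \<le> p ^ card S"
  proof (rule ccontr)
    assume "\<not> card (res X N) \<le> p ^ card S"
    then have "p ^ card S * p ^ card S' < card (res X N) * card (res T' N)"
      using lower by (intro mult_less_le_imp_less) auto
    with le show False by simp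
  qed
  moreover have "S \<subseteq> {- M<..N}" and "\<And>n. n \<in> S \<Longrightarrow> equid M N X n" by (auto simp: S_def)
  ultimately show ?thesis using homog_if_card_le[OF X MN] by blast
qed

text \<open>The p-adic numbers whose base \<open>p\<close> digit at position \<open>k\<close> is nonzero only for \<open>k \<in> K\<close>.\<close>

definition Dig :: "int set \<Rightarrow> (int \<Rightarrow> rat) set" where
  "Dig K = {y \<in> Qp p. \<forall>k. y (k + 1) \<noteq> y k \<longrightarrow> k \<in> K}"

text \<open>Appending a digit: \<open>emb b\<close> keeps the digits of \<open>y\<close> below
  \<open>n\<close>, has the new digit at \<open>n\<close> and zeros above. The case
  \<open>b = y n\<close> is the digit zero, allowed at any position.\<close>

lemma Dig_snoc:
  assumes y: "y \<in> Dig K" and b: "b \<in> lifts (y n) n" "b = y n \<or> n \<in> K"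
  shows "emb b \<in> Dig K" "emb b n = y n" "emb b (n + 1) = b"
proof -
  have yQ: "y \<in> Qp p" using y by (simp add: Dig_def)
  have bb: "b - y n \<in> lat n" "0 \<le> b" "b < P powi (n + 1)"
    using b lifts_iff[of "y n" n b] Qp_bounds[OF yQ] by auto
  have rdb: "rd b n = y n" using lifts_rd[OF _ _ b(1)] Qp_bounds[OF yQ] by auto
  obtain A where A: "y A = 0" using Qp_zero[OF yQ] by blast
  have "b \<in> lat (min A n)"
    using lat_add[of "b - y n" "min A n" "y n"] lat_monoD[OF bb(1), of "min A n"]
      lat_monoD[OF Qp_lat[OF yQ A], of "min A n" n] by simp
  then have eQ: "emb b \<in> Qp p" by (rule emb_Qp)
  show n1: "emb b (n + 1) = b" using bb by (simp add: emb_apply rd_id)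
  have low: "emb b k = y k" if "k \<le> n" for k
    using rd_rd[OF that, of b] rdb Qp_rd[OF yQ that] by (simp add: emb_apply)
  show "emb b n = y n" by (rule low) simp
  have high: "emb b k = b" if "n + 1 \<le> k" for k
  proof -
    have "P powi (n + 1) \<le> P powi k" using that p_gt_1 by (intro power_int_increasing) auto
    then show ?thesis using bb by (simp add: emb_apply rd_id)
  qed
  show "emb b \<in> Dig K" unfolding Dig_def
  proof (intro CollectI conjI allI impI eQ)
    fix k assume ne: "emb b (k + 1) \<noteq> emb b k"
    consider "k + 1 \<le> n" | "k = n" | "n + 1 \<le> k" by linarith
    then show "k \<in> K"
    proof cases
      case 1
      then show ?thesis using ne low[of k] low[of "k + 1"] y by (auto simp: Dig_def)
    next
      case 2
      then show ?thesis using ne low[of n] n1 b by auto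
    next
      case 3
      then show ?thesis using ne high[of k] high[of "k + 1"] by auto
    qed
  qed
qed

lemma self_lifts: "x \<in> Qp p \<Longrightarrow> x n \<in> lifts (x n) n"
  unfolding lifts_def by (intro image_eqI[of _ _ 0]) auto

text \<open>Digit sets are the model homogeneous sets; this makes \<open>homog_vanishing_sum\<close>
  available for sums over frequencies too.\<close>

lemma homog_Dig: "homog (Dig K) K"
  unfolding homog_def
proof (intro conjI allI ballI)
  show sub: "Dig K \<subseteq> Qp p" by (auto simp: Dig_def)
  fix n a assume "a \<in> res (Dig K) n"
  then obtain y where y: "y \<in> Dig K" "a = y n" by (auto simp: res_def)
  show "card (children (Dig K) a n) = (if n \<in> K then p else 1)"
  proof (cases "n \<in> K")
    case True
    have "lifts a n \<subseteq> children (Dig K) a n"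
    proof
      fix b assume "b \<in> lifts a n"
      then have "emb b \<in> Dig K" "emb b n = a" "emb b (n + 1) = b"
        using Dig_snoc[OF y(1)] True y(2) by auto
      then show "b \<in> children (Dig K) a n" using res_child[OF sub, of "emb b" n] by simp
    qed
    then have "children (Dig K) a n = lifts a n" using children_subset_lifts[OF sub] by blast
    then show ?thesis using True card_lifts by simp
  next
    case False
    have "b = a" if "b \<in> children (Dig K) a n" for b
    proof -
      obtain z where z: "z \<in> Dig K" "b = z (n + 1)" "rd b n = a"
        using \<open>b \<in> children (Dig K) a n\<close> by (auto simp: children_def res_def)
      have "z (n + 1) = z n" using z False by (auto simp: Dig_def)
      moreover have "z n = a" using Qp_rd[of z n "n + 1"] z sub by auto
      ultimately show ?thesis using z by simp
    qed
    moreover have "y (n + 1) \<in> children (Dig K) a n" using res_child[OF sub y(1), of n] y by simp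
    ultimately have "children (Dig K) a n = {a}" by blast
    then show ?thesis using False by simp
  qed
qed

text \<open>Vanishing modulo p^A means having no nonzero digit below \<open>A\<close>. Hence the
  bounded part of a digit set is again a digit set, with known branching.\<close>

lemma Dig_restrict: "{y \<in> Dig K. y A = 0} = Dig (K \<inter> {A..})"
proof (intro equalityI subsetI)
  fix y assume y: "y \<in> {y \<in> Dig K. y A = 0}"
  then have yQ: "y \<in> Qp p" by (auto simp: Dig_def)
  have "A \<le> k" if "y (k + 1) \<noteq> y k" for k
  proof (rule ccontr)
    assume "\<not> A \<le> k"
    then have "y (k + 1) = 0" "y k = 0" using Qp_zero_mono[OF yQ, of A] y by auto
    then show False using that by simp
  qed
  then show "y \<in> Dig (K \<inter> {A..})" using y by (auto simp: Dig_def)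
next
  fix y assume y: "y \<in> Dig (K \<inter> {A..})"
  then have yQ: "y \<in> Qp p" by (auto simp: Dig_def)
  obtain B where B: "y B = 0" using Qp_zero[OF yQ] by blast
  have "n \<le> A \<longrightarrow> y n = 0" if "B \<le> n" for n
    using that
  proof (induction n rule: int_ge_induct)
    case (step n)
    then show ?case using y by (cases "y (n + 1) = y n") (auto simp: Dig_def)
  qed (use B in auto)
  then have "y A = 0" using Qp_zero_mono[OF yQ B, of A] by (cases "B \<le> A") auto
  then show "y \<in> {y \<in> Dig K. y A = 0}" using y by (auto simp: Dig_def)
qed

lemma homog_low: "homog X J \<Longrightarrow> inside A X \<Longrightarrow> X \<noteq> {} \<Longrightarrow> n < A \<Longrightarrow> n \<notin> J"
proof
  assume h: "homog X J" "inside A X" "X \<noteq> {}" "n < A" "n \<in> J"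
  have r: "res X n = {0}" "res X (n + 1) = {0}" using res_zero[OF h(2,3)] h(4) by auto
  have "children X 0 n \<subseteq> {0}" using r by (auto simp: children_def)
  then have "card (children X 0 n) \<le> card {0::rat}" by (intro card_mono) auto
  moreover have "card (children X 0 n) = p" using h r by (auto simp: homog_def)
  ultimately show False using p_gt_1 by simp
qed

text \<open>The translation is built digit by digit. Where \<open>X\<close> branches, its digit is
  free and \<open>t\<close> gets the digit zero; elsewhere the digit of \<open>X\<close> is
  determined by the earlier ones and \<open>t\<close> must supply the rest, carries included. The
  same dichotomy gives uniqueness.\<close>

lemma homog_imp_tiling:
  assumes h: "homog X J" and X: "X = {x \<in> Qp p. x N \<in> C}" "X \<noteq> {}" "inside (- M) X" and MN: "- M \<le> N"
    and x: "x \<in> Qp p"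
  shows "\<exists>!t. t \<in> Dig (- J) \<and> psub p x t \<in> X"
proof -
  have rd0: "rd 0 n = 0" for n by (rule rd_id) auto
  have ex: "\<exists>t\<in>Dig (- J). rd (x n - t n) n \<in> res X n" if "- M \<le> n" for n
    using that
  proof (induction n rule: int_ge_induct)
    case base
    \<comment> \<open>Below \<open>- M\<close> the set \<open>X\<close> does not branch, so
      \<open>t\<close> may take over all those digits of \<open>x\<close>.\<close>
    have "emb (x (- M)) \<in> Dig (- J)" unfolding Dig_def
    proof (intro CollectI conjI allI impI rd_emb_Qp x)
      fix k assume ne: "emb (x (- M)) (k + 1) \<noteq> emb (x (- M)) k"
      have "k < - M"
      proof (rule ccontr)
        assume "\<not> k < - M"
        then have "P powi (- M) \<le> P powi k" "P powi (- M) \<le> P powi (k + 1)"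
          using p_gt_1 by (auto intro!: power_int_increasing simp del: power_int_minus)
        then have "rd (x (- M)) k = x (- M)" "rd (x (- M)) (k + 1) = x (- M)"
          using Qp_bounds[OF x, of "- M"] by (auto intro!: rd_id simp del: power_int_minus)
        then show False using ne by (simp add: emb_apply)
      qed
      then show "k \<in> - J" using homog_low[OF h X(3,2)] by auto
    qed
    moreover have "rd (x (- M) - emb (x (- M)) (- M)) (- M) \<in> res X (- M)"
      using emb_Qp_eq[OF x order_refl, of "- M"] res_zero[OF X(3,2) order_refl] rd0 by simp
    ultimately show ?case by blast
  next
    case (step n)
    then obtain t where t: "t \<in> Dig (- J)" "rd (x n - t n) n \<in> res X n" by blast
    have tQ: "t \<in> Qp p" using t by (auto simp: Dig_def)
    have xd: "x (n + 1) - x n \<in> lat n" by (rule Qp_diff[OF x]) simp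
    show ?case
    proof (cases "n \<in> J")
      case True
      \<comment> \<open>Digit zero for \<open>t\<close>: the new residue of the difference is some
        lift of the old one, and every lift occurs in \<open>X\<close>.\<close>
      define t' where "t' = emb (t n)"
      have t': "t' \<in> Dig (- J)" "t' n = t n" "t' (n + 1) = t n"
        unfolding t'_def using Dig_snoc[OF t(1) self_lifts[OF tQ]] by auto
      have "rd (x (n + 1) - t n) (n + 1) - rd (x n - t n) n \<in> lat n"
      proof -
        have "rd (x (n + 1) - t n) (n + 1) - (x (n + 1) - t n) \<in> lat n"
          by (rule lat_monoD[OF rd_diff']) simp
        moreover have "x (n + 1) - t n - (x n - t n) \<in> lat n" using xd by simp
        ultimately show ?thesis using rd_diff[of "x n - t n" n] lat_trans by blast
      qed
      then have "rd (x (n + 1) - t n) (n + 1) \<in> lifts (rd (x n - t n) n) n"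
        by (subst lifts_iff) auto
      then have "rd (x (n + 1) - t n) (n + 1) \<in> res X (n + 1)"
        using homog_lifts[OF h True t(2)] by (auto simp: children_def)
      then have "rd (x (n + 1) - t' (n + 1)) (n + 1) \<in> res X (n + 1)" by (simp only: t'(3))
      then show ?thesis using t'(1) by (rule bexI)
    next
      case False
      obtain w where w: "w \<in> X" "rd (x n - t n) n = w n" using t(2) by (auto simp: res_def)
      have wQ: "w \<in> Qp p" using insideD(2)[OF X(3) w(1)] .
      \<comment> \<open>\<open>w\<close> gives the only continuation of the residue within
        \<open>X\<close>, and \<open>b\<close> is the residue of \<open>t\<close> that produces
        it.\<close>
      define b where "b = rd (x (n + 1) - w (n + 1)) (n + 1)"
      have "b - t n \<in> lat n"
      proof -
        have "b - (x (n + 1) - w (n + 1)) \<in> lat n" unfolding b_def by (rule lat_monoD[OF rd_diff']) simp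
        moreover have "(x (n + 1) - x n) - (w (n + 1) - w n) \<in> lat n" by (intro lat_diff xd Qp_diff[OF wQ]) simp
        moreover have "(x n - t n) - w n \<in> lat n" using rd_diff[of "x n - t n" n] w(2) by simp
        ultimately have "(b - (x (n + 1) - w (n + 1))) + ((x (n + 1) - x n) - (w (n + 1) - w n)) + ((x n - t n) - w n) \<in> lat n"
          by (intro lat_add)
        then show ?thesis by simp
      qed
      then have "b \<in> lifts (t n) n" using Qp_bounds[OF tQ] by (subst lifts_iff) (auto simp: b_def)
      then have t': "emb b \<in> Dig (- J)" "emb b (n + 1) = b" using Dig_snoc[OF t(1)] False by auto
      have "rd (x (n + 1) - b) (n + 1) = w (n + 1)"
      proof (rule rd_eqI[OF _ Qp_bounds[OF wQ]])
        show "x (n + 1) - b - w (n + 1) \<in> lat (n + 1)"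
          using rd_diff[of "x (n + 1) - w (n + 1)" "n + 1"] by (simp add: b_def algebra_simps)
      qed
      then have "rd (x (n + 1) - emb b (n + 1)) (n + 1) \<in> res X (n + 1)"
        using w(1) t'(2) by (auto simp: res_def)
      then show ?thesis using t'(1) by blast
    qed
  qed
  obtain t where t: "t \<in> Dig (- J)" "rd (x N - t N) N \<in> res X N" using ex[OF MN] by blast
  have "psub p x t \<in> X"
  proof -
    have "t \<in> Qp p" using t by (auto simp: Dig_def)
    then have "psub p x t \<in> Qp p" using psub_Qp x by blast
    moreover have "psub p x t N \<in> C" using t(2) unfolding psub_apply res_def using X(1) by auto
    ultimately show ?thesis using X(1) by simp
  qed
  moreover have "t1 = t2" if t1: "t1 \<in> Dig (- J)" "psub p x t1 \<in> X" and t2: "t2 \<in> Dig (- J)" "psub p x t2 \<in> X" for t1 t2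
  proof
    fix n
    have Q: "t1 \<in> Qp p" "t2 \<in> Qp p" using t1 t2 by (auto simp: Dig_def)
    \<comment> \<open>As \<open>s\<close> is \<open>x - (x - s)\<close>, uniqueness can be
      transferred from the residues of the two differences in \<open>X\<close>.\<close>
    have recover: "s n = rd (x n - psub p x s n) n" if "s \<in> Qp p" for s n
    proof (rule sym, rule rd_eqI[OF _ Qp_bounds[OF that]])
      show "x n - psub p x s n - s n \<in> lat n"
        using rd_diff[of "x n - s n" n] by (simp add: psub_apply algebra_simps)
    qed
    show "t1 n = t2 n"
    proof -
      have "t1 m = t2 m" if "- M \<le> m" for m
        using that
      proof (induction m rule: int_ge_induct)
        case base
        then show ?case using recover[OF Q(1), of "- M"] recover[OF Q(2), of "- M"]
            insideD(3)[OF X(3) t1(2)] insideD(3)[OF X(3) t2(2)] by simp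
      next
        case (step m)
        show ?case
        proof (cases "m \<in> J")
          case True
          then have "t1 (m + 1) = t1 m" "t2 (m + 1) = t2 m" using t1 t2 by (auto simp: Dig_def)
          then show ?thesis using step by simp
        next
          case False
          have "psub p x t1 m = psub p x t2 m" using step by (simp add: psub_apply)
          then have "psub p x t1 (m + 1) = psub p x t2 (m + 1)"
            using homog_unique[OF h False t1(2) t2(2)] by simp
          then show ?thesis using recover[OF Q(1), of "m + 1"] recover[OF Q(2), of "m + 1"] by simp
        qed
      qed
      then show ?thesis using Qp_eq_mono[OF Q, of "max n (- M)" n] by simp
    qed
  qed
  ultimately show ?thesis using t(1) by blast
qed

section \<open>Topology and Haar measure\<close>

lemma rball_mono: "x \<in> Qp p \<Longrightarrow> m \<le> n \<Longrightarrow> rball (x n) n \<subseteq> rball (x m) m"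
  using Qp_eq_mono unfolding rball_def by blast

lemma openin_qp: "openin (qp_topology p) U \<longleftrightarrow> U \<subseteq> Qp p \<and> (\<forall>x\<in>U. \<exists>n. rball (x n) n \<subseteq> U)"
proof -
  have eq: "(\<exists>n. qp_ball p x n \<subseteq> U) \<longleftrightarrow> (\<exists>n. rball (x n) n \<subseteq> U)" for x U
    unfolding qp_ball_eq by (metis add.inverse_inverse)
  have "istopology (\<lambda>U. U \<subseteq> Qp p \<and> (\<forall>x\<in>U. \<exists>n. rball (x n) n \<subseteq> U))"
    unfolding istopology_def
  proof (intro conjI allI impI ballI)
    fix S T x assume S: "S \<subseteq> Qp p \<and> (\<forall>x\<in>S. \<exists>n. rball (x n) n \<subseteq> S)"
      and T: "T \<subseteq> Qp p \<and> (\<forall>x\<in>T. \<exists>n. rball (x n) n \<subseteq> T)" and x: "x \<in> S \<inter> T"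
    then obtain m n where "rball (x m) m \<subseteq> S" "rball (x n) n \<subseteq> T" by blast
    then have "rball (x (max m n)) (max m n) \<subseteq> S \<inter> T"
      using rball_mono[of x m "max m n"] rball_mono[of x n "max m n"] x S by auto
    then show "\<exists>n. rball (x n) n \<subseteq> S \<inter> T" by blast
  next
    fix \<K> x assume "\<forall>K\<in>\<K>. K \<subseteq> Qp p \<and> (\<forall>x\<in>K. \<exists>n. rball (x n) n \<subseteq> K)" "x \<in> \<Union> \<K>"
    then show "\<exists>n. rball (x n) n \<subseteq> \<Union> \<K>" by (meson UnionE Union_upper subset_trans)
  qed auto
  then show ?thesis unfolding qp_topology_def eq by (simp add: topology_inverse')
qed

lemma openin_res: "openin (qp_topology p) {x \<in> Qp p. x n \<in> A}"
  unfolding openin_qp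
proof (intro conjI ballI)
  fix x assume "x \<in> {x \<in> Qp p. x n \<in> A}"
  then show "\<exists>m. rball (x m) m \<subseteq> {x \<in> Qp p. x n \<in> A}" by (intro exI[of _ n]) (auto simp: rball_def)
qed auto

lemma openin_rball: "openin (qp_topology p) (rball v n)"
  using openin_res[of n "{v}"] by (simp add: rball_def)

text \<open>Compactness is used twice: finitely many balls inside \<Omega> have bounded levels,
  which gives \<open>N\<close>, and finitely many balls around zero give \<open>M\<close>. Taking
  the maximum with \<open>- M\<close> orders the two levels.\<close>

lemma compact_open_structure:
  assumes op: "openin (qp_topology p) \<Omega>" and co: "compactin (qp_topology p) \<Omega>"
  obtains M N where "- M \<le> N" "\<Omega> = {x \<in> Qp p. x N \<in> res \<Omega> N}" "inside (- M) \<Omega>"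
proof -
  have sub: "\<Omega> \<subseteq> Qp p" using op unfolding openin_qp by blast
  have cover: "\<exists>\<F>. finite \<F> \<and> \<F> \<subseteq> \<U> \<and> \<Omega> \<subseteq> \<Union>\<F>" if "\<forall>U\<in>\<U>. openin (qp_topology p) U" "\<Omega> \<subseteq> \<Union>\<U>" for \<U>
    using co that unfolding compactin_def by blast
  define \<U> where "\<U> = {U. \<exists>v n. U = rball v n \<and> U \<subseteq> \<Omega>}"
  have U1: "\<Omega> \<subseteq> \<Union>\<U>"
  proof
    fix x assume "x \<in> \<Omega>"
    then obtain n where "rball (x n) n \<subseteq> \<Omega>" using op unfolding openin_qp by blast
    then have "rball (x n) n \<in> \<U>" unfolding \<U>_def by blast
    moreover have "x \<in> rball (x n) n" using \<open>x \<in> \<Omega>\<close> sub by (auto simp: rball_def)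
    ultimately show "x \<in> \<Union>\<U>" by blast
  qed
  have U2: "\<forall>U\<in>\<U>. openin (qp_topology p) U" using openin_rball by (auto simp: \<U>_def)
  obtain \<F> where F: "finite \<F>" "\<F> \<subseteq> \<U>" "\<Omega> \<subseteq> \<Union>\<F>" using cover[OF U2 U1] by (elim exE conjE)
  have "\<forall>U\<in>\<F>. \<exists>n. \<exists>v. U = rball v n" using F(2) unfolding \<U>_def by blast
  from bchoice[OF this] obtain lv where lv: "\<forall>U\<in>\<F>. \<exists>v. U = rball v (lv U)" by (elim exE)
  define N0 where "N0 = Max (insert 0 (lv ` \<F>))"
  have N0: "lv U \<le> N0" if "U \<in> \<F>" for U using that F(1) by (simp add: N0_def)
  have per: "y \<in> \<Omega>" if xy: "N0 \<le> N" "y \<in> Qp p" "x \<in> \<Omega>" "y N = x N" for x y N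
  proof -
    obtain U where U: "U \<in> \<F>" "x \<in> U" using xy(3) F(3) by blast
    obtain v where v: "U = rball v (lv U)" using lv U(1) by blast
    have "y (lv U) = x (lv U)" using Qp_eq_mono[of y x N "lv U"] N0[OF U(1)] xy sub by auto
    then have "y \<in> U" using v U(2) xy(2) by (metis (mono_tags, lifting) rball_def mem_Collect_eq)
    then show ?thesis using U(1) F(2) by (auto simp: \<U>_def)
  qed
  define \<V> where "\<V> = range (\<lambda>m::nat. rball 0 (- int m))"
  have V1: "\<Omega> \<subseteq> \<Union>\<V>"
  proof
    fix x assume "x \<in> \<Omega>"
    then have xQ: "x \<in> Qp p" using sub by auto
    then obtain A where "x A = 0" using Qp_zero by blast
    then have "x (- int (nat (- A))) = 0" using Qp_zero_mono[OF xQ, of A] by simp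
    then have "x \<in> rball 0 (- int (nat (- A)))" using xQ by (simp add: rball_def)
    then show "x \<in> \<Union>\<V>" unfolding \<V>_def by blast
  qed
  have V2: "\<forall>U\<in>\<V>. openin (qp_topology p) U" using openin_rball by (auto simp: \<V>_def)
  obtain \<G> where G: "finite \<G>" "\<G> \<subseteq> \<V>" "\<Omega> \<subseteq> \<Union>\<G>" using cover[OF V2 V1] by (elim exE conjE)
  then obtain I where I: "finite I" "\<G> = (\<lambda>m::nat. rball 0 (- int m)) ` I"
    unfolding \<V>_def by (meson finite_subset_image)
  define M where "M = int (Max (insert 0 I))"
  have "x (- M) = 0" if x: "x \<in> \<Omega>" for x
  proof -
    obtain m where m: "m \<in> I" "x \<in> rball 0 (- int m)" using x G(3) I(2) by blast
    have "- M \<le> - int m" using m(1) I(1) by (simp add: M_def)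
    then show ?thesis using Qp_zero_mono[of x "- int m" "- M"] m(2) by (simp add: rball_def)
  qed
  then have "inside (- M) \<Omega>" using sub by (intro insideI) auto
  moreover have "\<Omega> = {x \<in> Qp p. x (max N0 (- M)) \<in> res \<Omega> (max N0 (- M))}"
    using per[of "max N0 (- M)"] sub by (auto simp: res_def)
  ultimately show ?thesis using that[of M "max N0 (- M)"] by simp
qed

section \<open>The outer measure from covers by balls\<close>

abbreviation outer :: "(int \<Rightarrow> rat) set \<Rightarrow> ennreal" where "outer \<equiv> qp_outer p"

definition mass :: "int \<Rightarrow> ennreal" where "mass n = ennreal (real p powr real_of_int (- n))"

lemma outer_le:
  assumes "\<And>i. a i \<in> Qp p" "A \<subseteq> (\<Union>i. rball (a i (n i)) (n i))"
  shows "outer A \<le> (\<Sum>i. mass (n i))"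
  unfolding qp_outer_def
proof (rule INF_lower2[of "(a, \<lambda>i. - n i)"])
  show "(a, \<lambda>i. - n i) \<in> {(a, r). (\<forall>i. a i \<in> Qp p) \<and> A \<subseteq> (\<Union>i. qp_ball p (a i) (r i))}"
    using assms by (auto simp: qp_ball_eq)
qed (simp add: mass_def)

lemma outer_ge:
  assumes "\<And>a n. (\<And>i. a i \<in> Qp p) \<Longrightarrow> A \<subseteq> (\<Union>i. rball (a i (n i)) (n i)) \<Longrightarrow> c \<le> (\<Sum>i. mass (n i))"
  shows "c \<le> outer A"
  unfolding qp_outer_def
proof (rule INF_greatest, clarify)
  fix a and r :: "nat \<Rightarrow> int" assume a: "\<forall>i. a i \<in> Qp p" "A \<subseteq> (\<Union>i. qp_ball p (a i) (r i))"
  have "c \<le> (\<Sum>i. mass (- r i))"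
    by (rule assms[of a]) (use a in \<open>simp_all only: qp_ball_eq\<close>)
  then show "c \<le> (\<Sum>i. ennreal (real p powr real_of_int (snd (a, r) i)))" by (simp add: mass_def)
qed

lemma outer_approx:
  assumes "outer A \<noteq> \<infinity>" "\<epsilon> > 0"
  obtains a n where "\<And>i. a i \<in> Qp p" "A \<subseteq> (\<Union>i. rball (a i (n i)) (n i))"
    "(\<Sum>i. mass (n i)) \<le> outer A + ennreal \<epsilon>"
proof (rule ccontr)
  assume no: "\<not> thesis"
  have "outer A + ennreal \<epsilon> \<le> outer A"
  proof (rule outer_ge)
    fix a and n :: "nat \<Rightarrow> int" assume "\<And>i. a i \<in> Qp p" "A \<subseteq> (\<Union>i. rball (a i (n i)) (n i))"
    then show "outer A + ennreal \<epsilon> \<le> (\<Sum>i. mass (n i))" using no that[of a n] by (meson nle_le)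
  qed
  then show False using assms by (cases "outer A" rule: ennreal_cases) (auto simp: ennreal_plus[symmetric] simp del: ennreal_plus)
qed

lemma outer_mono: "A \<subseteq> B \<Longrightarrow> outer A \<le> outer B"
  by (rule outer_ge) (rule outer_le, auto)

lemma emb_0: "emb 0 \<in> Qp p" by (rule emb_Qp[of _ 0]) simp

lemma mass_small: "\<epsilon> > 0 \<Longrightarrow> \<exists>n. mass n \<le> ennreal \<epsilon>"
proof -
  assume eps: "\<epsilon> > 0"
  obtain k where k: "inverse (real p) ^ k < \<epsilon>"
    using real_arch_pow_inv[OF eps, of "inverse (real p)"] p_gt_1 by (auto simp: inverse_less_1_iff)
  have "real p powr real_of_int (- int k) = inverse (real p) ^ k"
    by (simp add: powr_minus powr_realpow power_inverse)
  then have "mass (int k) \<le> ennreal \<epsilon>" using k by (simp add: mass_def ennreal_leI)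
  then show ?thesis by blast
qed

lemma half_sum: "\<epsilon> > 0 \<Longrightarrow> (\<Sum>i. ennreal (\<epsilon> * (1/2) ^ Suc i)) = ennreal \<epsilon>"
  using sums_mult[OF power_half_series, of \<epsilon>] by (intro suminf_ennreal_eq) auto

text \<open>Covers are infinite sequences of balls, so the empty set and single balls need padding;
  this makes the padding arbitrarily light.\<close>

lemma mass_small_seq: "\<epsilon> > 0 \<Longrightarrow> \<exists>n::nat \<Rightarrow> int. (\<Sum>i. mass (n i)) \<le> ennreal \<epsilon>"
proof -
  assume eps: "\<epsilon> > 0"
  have "\<forall>i. \<exists>n. mass n \<le> ennreal (\<epsilon> * (1/2) ^ Suc i)" using eps by (intro allI mass_small) simp
  then obtain n where "\<And>i. mass (n i) \<le> ennreal (\<epsilon> * (1/2) ^ Suc i)" by metis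
  then have "(\<Sum>i. mass (n i)) \<le> (\<Sum>i. ennreal (\<epsilon> * (1/2) ^ Suc i))" by (intro suminf_le summableI)
  then show ?thesis using half_sum[OF eps] by auto
qed

lemma outer_empty: "outer {} = 0"
proof -
  have "outer {} \<le> 0 + ennreal \<epsilon>" if eps: "\<epsilon> > 0" for \<epsilon>
  proof -
    obtain n :: "nat \<Rightarrow> int" where "(\<Sum>i. mass (n i)) \<le> ennreal \<epsilon>" using mass_small_seq[OF eps] by blast
    moreover have "outer {} \<le> (\<Sum>i. mass (n i))" by (rule outer_le[of "\<lambda>_. emb 0"]) (auto simp: emb_0)
    ultimately show ?thesis by simp
  qed
  then have "outer {} \<le> 0" by (rule ennreal_le_epsilon)
  then show ?thesis by simp
qed

lemma outer_rball: "outer (rball v n) \<le> mass n"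
proof (cases "rball v n = {}")
  case False
  then obtain a where a: "a \<in> Qp p" "a n = v" by (auto simp: rball_def)
  show ?thesis
  proof (rule ennreal_le_epsilon)
    fix \<epsilon> :: real assume "0 < \<epsilon>"
    then obtain m :: "nat \<Rightarrow> int" where m: "(\<Sum>i. mass (m i)) \<le> ennreal \<epsilon>" using mass_small_seq by blast
    have "outer (rball v n) \<le> (\<Sum>i. mass (case_nat n m i))"
      by (rule outer_le[of "\<lambda>_. a"]) (use a in \<open>auto intro!: exI[of _ 0]\<close>)
    also have "\<dots> = (\<Sum>i. mass (m i)) + mass n"
      by (subst suminf_offset[of _ 1]) (auto intro: summableI)
    finally show "outer (rball v n) \<le> mass n + ennreal \<epsilon>" using m by (metis add.commute add_left_mono order_trans)
  qed
qed (simp add: outer_empty)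

lemma outer_UN_le: "outer (\<Union>i::nat. A i) \<le> (\<Sum>i. outer (A i))"
proof (rule ennreal_le_epsilon)
  fix \<epsilon> :: real assume fin: "(\<Sum>i. outer (A i)) < top" and eps: "0 < \<epsilon>"
  have "\<forall>i. \<exists>c. (\<forall>j. fst c j \<in> Qp p) \<and> A i \<subseteq> (\<Union>j. rball (fst c j (snd c j)) (snd c j)) \<and>
      (\<Sum>j. mass (snd c j)) \<le> outer (A i) + ennreal (\<epsilon> * (1/2) ^ Suc i)"
  proof
    fix i
    have "outer (A i) \<noteq> \<infinity>" "\<epsilon> * (1/2) ^ Suc i > 0"
      using ennreal_suminf_lessD[OF fin, of i] eps by auto
    then obtain a n where "\<And>j. a j \<in> Qp p" "A i \<subseteq> (\<Union>j. rball (a j (n j)) (n j))"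
      "(\<Sum>j. mass (n j)) \<le> outer (A i) + ennreal (\<epsilon> * (1/2) ^ Suc i)" by (rule outer_approx) blast
    then show "\<exists>c. (\<forall>j. fst c j \<in> Qp p) \<and> A i \<subseteq> (\<Union>j. rball (fst c j (snd c j)) (snd c j)) \<and>
      (\<Sum>j. mass (snd c j)) \<le> outer (A i) + ennreal (\<epsilon> * (1/2) ^ Suc i)"
      by (intro exI[of _ "(a, n)"]) auto
  qed
  from choice[OF this] obtain c where c: "\<forall>i. (\<forall>j. fst (c i) j \<in> Qp p) \<and>
      A i \<subseteq> (\<Union>j. rball (fst (c i) j (snd (c i) j)) (snd (c i) j)) \<and>
      (\<Sum>j. mass (snd (c i) j)) \<le> outer (A i) + ennreal (\<epsilon> * (1/2) ^ Suc i)" by (elim exE)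
  define a where "a k = fst (c (fst (prod_decode k))) (snd (prod_decode k))" for k
  define n where "n k = snd (c (fst (prod_decode k))) (snd (prod_decode k))" for k
  have "outer (\<Union>i. A i) \<le> (\<Sum>k. mass (n k))"
  proof (rule outer_le[of a])
    show "a i \<in> Qp p" for i by (simp add: a_def c)
    show "(\<Union>i. A i) \<subseteq> (\<Union>k. rball (a k (n k)) (n k))"
    proof
      fix x assume "x \<in> (\<Union>i. A i)"
      then obtain i where "x \<in> A i" by blast
      then obtain j where j: "x \<in> rball (fst (c i) j (snd (c i) j)) (snd (c i) j)" using c by blast
      have "x \<in> rball (a (prod_encode (i, j)) (n (prod_encode (i, j)))) (n (prod_encode (i, j)))"
        using j by (simp add: a_def n_def)
      then show "x \<in> (\<Union>k. rball (a k (n k)) (n k))" by blast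
    qed
  qed
  also have "(\<Sum>k. mass (n k)) = (\<Sum>i. \<Sum>j. mass (snd (c i) j))"
    using suminf_ennreal_2dimen[of "\<lambda>i. \<Sum>j. mass (snd (c i) j)" "\<lambda>(i, j). mass (snd (c i) j)"]
    by (simp add: n_def case_prod_beta)
  also have "\<dots> \<le> (\<Sum>i. outer (A i) + ennreal (\<epsilon> * (1/2) ^ Suc i))"
    using c by (intro suminf_le summableI) blast
  also have "\<dots> = (\<Sum>i. outer (A i)) + ennreal \<epsilon>"
    unfolding half_sum[OF eps, symmetric] by (rule suminf_add[symmetric]) (auto intro: summableI)
  finally show "outer (\<Union>i. A i) \<le> (\<Sum>i. outer (A i)) + ennreal \<epsilon>" .
qed

lemma outer_Un_le: "outer (A \<union> B) \<le> outer A + outer B"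
proof -
  have "outer (A \<union> B) = outer (\<Union>i. binaryset A B i)" by (simp add: UN_binaryset_eq)
  also have "\<dots> \<le> (\<Sum>i. outer (binaryset A B i))" by (rule outer_UN_le)
  also have "\<dots> = outer A + outer B" by (rule suminf_binaryset_eq) (rule outer_empty)
  finally show ?thesis .
qed

lemma outer_finite_UN_le: "finite I \<Longrightarrow> outer (\<Union>i\<in>I. A i) \<le> (\<Sum>i\<in>I. outer (A i))"
proof (induction I rule: finite_induct)
  case (insert i I)
  have "outer (\<Union>i\<in>insert i I. A i) \<le> outer (A i) + outer (\<Union>i\<in>I. A i)" using outer_Un_le by simp
  also have "\<dots> \<le> outer (A i) + (\<Sum>i\<in>I. outer (A i))" using insert by (intro add_left_mono)
  finally show ?case using insert by simp
qed (simp add: outer_empty)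

lemma mass_pred: "mass (n - 1) = of_nat p * mass n"
proof -
  have "real p powr (1 - real_of_int n) = real p * real p powr (- real_of_int n)"
    using p_pos by (simp add: powr_add[symmetric] powr_mult_base)
  then show ?thesis by (simp add: mass_def ennreal_mult'' ennreal_of_nat_eq_real_of_nat)
qed

text \<open>Each step from level \<open>n\<close> to the larger ball at level \<open>n - 1\<close>
  adds \<open>p - 1\<close> siblings of mass at most \<open>mass n\<close>, and \<open>p\<close>
  balls of that mass make up \<open>mass (n - 1)\<close>.\<close>

lemma outer_rball_diff:
  assumes x: "x \<in> Qp p" and "n \<le> m"
  shows "outer (rball (x n) n - rball (x m) m) + mass m \<le> mass n"
  using assms(2)
proof (induction n rule: int_le_induct)
  case base
  then show ?case by (simp add: outer_empty)
next
  case (step n)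
  have sub: "rball (x (n - 1)) (n - 1) - rball (x m) m \<subseteq>
      (rball (x n) n - rball (x m) m) \<union> (\<Union>b\<in>lifts (x (n - 1)) (n - 1) - {x n}. rball b n)"
  proof
    fix y assume y: "y \<in> rball (x (n - 1)) (n - 1) - rball (x m) m"
    then have "y n \<in> lifts (x (n - 1)) (n - 1)" using Qp_lifts[of y "n - 1"] by (auto simp: rball_def)
    then show "y \<in> (rball (x n) n - rball (x m) m) \<union> (\<Union>b\<in>lifts (x (n - 1)) (n - 1) - {x n}. rball b n)"
      using y by (cases "y n = x n") (auto simp: rball_def)
  qed
  have xn: "x n \<in> lifts (x (n - 1)) (n - 1)" using Qp_lifts[OF x, of "n - 1"] by simp
  have "outer (\<Union>b\<in>lifts (x (n - 1)) (n - 1) - {x n}. rball b n) \<le> (\<Sum>b\<in>lifts (x (n - 1)) (n - 1) - {x n}. outer (rball b n))"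
    by (rule outer_finite_UN_le) simp
  also have "\<dots> \<le> (\<Sum>b\<in>lifts (x (n - 1)) (n - 1) - {x n}. mass n)" by (intro sum_mono outer_rball)
  also have "\<dots> = of_nat (p - 1) * mass n" using xn by (simp add: card_lifts)
  finally have "outer (rball (x (n - 1)) (n - 1) - rball (x m) m) \<le> outer (rball (x n) n - rball (x m) m) + of_nat (p - 1) * mass n"
    using order_trans[OF outer_mono[OF sub] outer_Un_le] by (meson add_left_mono order_trans)
  then have "outer (rball (x (n - 1)) (n - 1) - rball (x m) m) + mass m \<le> (outer (rball (x n) n - rball (x m) m) + mass m) + of_nat (p - 1) * mass n"
    by (metis add.assoc add.commute add_right_mono)
  also have "\<dots> \<le> mass n + of_nat (p - 1) * mass n" using step by (intro add_right_mono)
  also have "\<dots> = (1 + of_nat (p - 1)) * mass n" by (simp add: distrib_right)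
  also have "1 + of_nat (p - 1) = (of_nat p :: ennreal)" using p_pos by (metis Suc_pred' of_nat_Suc)
  also have "of_nat p * mass n = mass (n - 1)" by (simp only: mass_pred)
  finally show ?case .
qed

text \<open>Two balls are nested or disjoint, so cutting a ball by another one produces no excess
  mass.\<close>

lemma outer_rball_split: "outer (rball u n \<inter> rball v m) + outer (rball u n - rball v m) \<le> mass n"
proof (cases "rball u n \<inter> rball v m = {}")
  case True
  then have "rball u n - rball v m = rball u n" by blast
  then show ?thesis using True outer_empty outer_rball by simp
next
  case False
  then obtain x where x: "x \<in> Qp p" "u = x n" "v = x m" by (auto simp: rball_def)
  show ?thesis
  proof (cases "m \<le> n")
    case True
    then have "rball u n \<subseteq> rball v m" using rball_mono x by blast
    then have "rball u n \<inter> rball v m = rball u n" "rball u n - rball v m = {}" by blast+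
    then show ?thesis using outer_rball[of u n] by (simp only: outer_empty add_0_right)
  next
    case False
    then have "rball v m \<subseteq> rball u n" using rball_mono[of x n m] x by simp
    then have "outer (rball u n \<inter> rball v m) \<le> mass m" using outer_rball by (simp add: Int_absorb1)
    then have "outer (rball u n \<inter> rball v m) + outer (rball u n - rball v m) \<le> mass m + outer (rball u n - rball v m)"
      by (rule add_right_mono)
    also have "\<dots> \<le> mass n" using outer_rball_diff[OF x(1), of n m] False x by (simp add: add.commute)
    finally show ?thesis .
  qed
qed

text \<open>Every ball of a cover of \<open>A\<close> can be cut along \<open>rball v m\<close>
  without raising the total mass, so both pieces of \<open>A\<close> are covered at the price of
  \<open>A\<close>.\<close>

lemma outer_caratheodory: "outer (A \<inter> rball v m) + outer (A - rball v m) = outer A"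
proof (rule antisym)
  show "outer (A \<inter> rball v m) + outer (A - rball v m) \<le> outer A"
  proof (rule outer_ge)
    fix a and n :: "nat \<Rightarrow> int" assume a: "\<And>i. a i \<in> Qp p" "A \<subseteq> (\<Union>i. rball (a i (n i)) (n i))"
    let ?D = "\<lambda>i::nat. rball (a i (n i)) (n i)"
    have "outer (A \<inter> rball v m) \<le> outer (\<Union>i. ?D i \<inter> rball v m)" using a by (intro outer_mono) blast
    also have "\<dots> \<le> (\<Sum>i. outer (?D i \<inter> rball v m))" by (rule outer_UN_le)
    finally have 1: "outer (A \<inter> rball v m) \<le> (\<Sum>i. outer (?D i \<inter> rball v m))" .
    have "outer (A - rball v m) \<le> outer (\<Union>i. ?D i - rball v m)" using a by (intro outer_mono) blast
    also have "\<dots> \<le> (\<Sum>i. outer (?D i - rball v m))" by (rule outer_UN_le)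
    finally have 2: "outer (A - rball v m) \<le> (\<Sum>i. outer (?D i - rball v m))" .
    have "outer (A \<inter> rball v m) + outer (A - rball v m) \<le> (\<Sum>i. outer (?D i \<inter> rball v m) + outer (?D i - rball v m))"
      using add_mono[OF 1 2] by (subst suminf_add[symmetric]) (auto intro: summableI)
    also have "\<dots> \<le> (\<Sum>i. mass (n i))" by (intro suminf_le summableI outer_rball_split)
    finally show "outer (A \<inter> rball v m) + outer (A - rball v m) \<le> (\<Sum>i. mass (n i))" .
  qed
  have "A = (A \<inter> rball v m) \<union> (A - rball v m)" by blast
  then show "outer A \<le> outer (A \<inter> rball v m) + outer (A - rball v m)" using outer_Un_le by metis
qed

lemma openin_countable_union:
  assumes U: "openin (qp_topology p) U"
  obtains B where "countable B" "U = (\<Union>(v, n)\<in>B. rball v n)" "\<And>v n. (v, n) \<in> B \<Longrightarrow> N \<le> n"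
proof
  let ?B = "{(v, n). N \<le> n \<and> rball v n \<subseteq> U}"
  \<comment> \<open>Residues are rational and levels integral, so there are only countably many
    balls.\<close>
  show "countable ?B" by simp
  show "U = (\<Union>(v, n)\<in>?B. rball v n)"
  proof (intro equalityI subsetI)
    fix x assume x: "x \<in> U"
    then obtain n where n: "rball (x n) n \<subseteq> U" and xQ: "x \<in> Qp p" using U unfolding openin_qp by blast
    have "rball (x (max N n)) (max N n) \<subseteq> U" using rball_mono[OF xQ, of n "max N n"] n by auto
    moreover have "x \<in> rball (x (max N n)) (max N n)" using xQ by (simp add: rball_def)
    ultimately have "(x (max N n), max N n) \<in> ?B" by auto
    then show "x \<in> (\<Union>(v, n)\<in>?B. rball v n)"
      using \<open>x \<in> rball (x (max N n)) (max N n)\<close> by (intro UN_I[of "(x (max N n), max N n)"]) auto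
  qed auto
qed auto

section \<open>The Haar measure of balls, and integrals over them\<close>

lemma openin_subset_Qp: "{U. openin (qp_topology p) U} \<subseteq> Pow (Qp p)"
  unfolding openin_qp by blast

lemma space_haar [simp]: "space (haar p) = Qp p"
  unfolding haar_def by (rule space_measure_of[OF openin_subset_Qp])

lemma sets_haar: "sets (haar p) = sigma_sets (Qp p) {U. openin (qp_topology p) U}"
  unfolding haar_def by (rule sets_measure_of[OF openin_subset_Qp])

text \<open>\<open>measure_of\<close> returns the zero measure unless the given function is a
  measure on the generated sigma-algebra. Caratheodory's lambda system contains the balls, hence the
  open sets as countable unions of balls, hence all Borel sets.\<close>

lemma emeasure_haar:
  assumes "A \<in> sets (haar p)" shows "emeasure (haar p) A = outer A"
proof -
  let ?G = "{U. openin (qp_topology p) U}"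
  interpret P: sigma_algebra "Qp p" "Pow (Qp p)" by (rule sigma_algebra_Pow)
  define L where "L = lambda_system (Qp p) (Pow (Qp p)) outer"
  have "outer_measure_space (Pow (Qp p)) outer"
    unfolding outer_measure_space_def positive_def increasing_def countably_subadditive_def
    using outer_empty outer_mono outer_UN_le by auto
  then have ms: "measure_space (Qp p) L outer" unfolding L_def by (rule P.caratheodory_lemma)
  then interpret L: sigma_algebra "Qp p" L by (simp add: measure_space_def)
  have rb: "rball v n \<in> L" for v n
    unfolding L_def P.lambda_system_eq using outer_caratheodory by (auto simp: rball_def)
  have "?G \<subseteq> L"
  proof
    fix U assume "U \<in> ?G"
    then obtain B where B: "countable B" "U = (\<Union>(v, n)\<in>B. rball v n)" using openin_countable_union[of U 0] by blast
    then show "U \<in> L" using rb by (auto intro!: L.countable_UN'')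
  qed
  then have sub: "sigma_sets (Qp p) ?G \<subseteq> L" by (rule L.sigma_sets_subset)
  show ?thesis
  proof (rule emeasure_measure_of[OF _ openin_subset_Qp])
    show "haar p = measure_of (Qp p) ?G outer" by (simp add: haar_def)
    show "positive (sets (haar p)) outer" using outer_empty by (simp add: positive_def)
    show "countably_additive (sets (haar p)) outer"
      using ms sub unfolding measure_space_def countably_additive_def sets_haar by blast
  qed (rule assms)
qed

lemma first_difference:
  assumes "x \<in> Qp p" "y \<in> Qp p" "x n \<noteq> y n"
  obtains k where "k < n" "x k = y k" "x (k + 1) \<noteq> y (k + 1)"
proof -
  obtain A B where AB: "x A = 0" "y B = 0" using Qp_zero assms by blast
  define m where "m = min n (min A B)"
  have m: "x m = y m"
    using Qp_zero_mono[OF assms(1) AB(1), of m] Qp_zero_mono[OF assms(2) AB(2), of m] by (simp add: m_def)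
  have "\<exists>k<n. x k = y k \<and> x (k + 1) \<noteq> y (k + 1)"
  proof (rule ccontr)
    assume no: "\<not> ?thesis"
    have "i \<le> n \<longrightarrow> x i = y i" if "m \<le> i" for i
      using that
    proof (induction i rule: int_ge_induct)
      case (step i)
      then show ?case using no by auto
    qed (use m in auto)
    then show False using assms(3) by (simp add: m_def)
  qed
  then show ?thesis using that by blast
qed

text \<open>The first differing digit is the valuation of the difference, visible in any later
  truncation. It turns the place where two points or frequencies separate into an exact
  conductor.\<close>

lemma diff_exact_lat:
  assumes "x \<in> Qp p" "y \<in> Qp p" "x k = y k" "x (k + 1) \<noteq> y (k + 1)" "k + 1 \<le> i"
  shows "x i - y i \<in> lat k" "x i - y i \<notin> lat (k + 1)"
  using assms Qp_rd[OF assms(1), of k i] Qp_rd[OF assms(2), of k i]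
    Qp_rd[OF assms(1), of "k + 1" i] Qp_rd[OF assms(2), of "k + 1" i]
  by (simp_all flip: rd_eq_iff)

lemma sets_res: "{x \<in> Qp p. x n \<in> A} \<in> sets (haar p)"
  unfolding sets_haar using openin_res by (intro sigma_sets.Basic) simp

lemma sets_rball [simp]: "rball v n \<in> sets (haar p)"
  using sets_res[of n "{v}"] by (simp add: rball_def)

lemma outer_translate:
  assumes a: "a \<in> Qp p" and b: "b \<in> Qp p"
  shows "outer (rball (a n) n) \<le> outer (rball (b n) n)"
proof (rule outer_ge)
  fix c and m :: "nat \<Rightarrow> int"
  assume c: "\<And>i. c i \<in> Qp p" "rball (b n) n \<subseteq> (\<Union>i. rball (c i (m i)) (m i))"
  \<comment> \<open>The cover is translated by \<open>a - b\<close>, expressed with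
    \<open>psub\<close> alone.\<close>
  define c' where "c' i = psub p (c i) (psub p b a)" for i
  show "outer (rball (a n) n) \<le> (\<Sum>i. mass (m i))"
  proof (rule outer_le[of c'])
    show "c' i \<in> Qp p" for i unfolding c'_def by (intro psub_Qp c a b)
    show "rball (a n) n \<subseteq> (\<Union>i. rball (c' i (m i)) (m i))"
    proof
      fix x assume x: "x \<in> rball (a n) n"
      then have xQ: "x \<in> Qp p" and xn: "x n = a n" by (auto simp: rball_def)
      define y where "y = psub p x (psub p a b)"
      have yQ: "y \<in> Qp p" unfolding y_def by (intro psub_Qp xQ a b)
      have "y n = b n" unfolding y_def psub_apply xn
      proof (rule rd_eqI[OF _ Qp_bounds[OF b]])
        show "a n - rd (a n - b n) n - b n \<in> lat n"
          using rd_diff[of "a n - b n" n] by (simp add: algebra_simps)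
      qed
      then have "y \<in> rball (b n) n" using yQ by (simp add: rball_def)
      then obtain i where i: "y (m i) = c i (m i)" using c(2) by (auto simp: rball_def)
      have "x (m i) - rd (a (m i) - b (m i)) (m i) - c i (m i) \<in> lat (m i)"
        using rd_diff[of "x (m i) - rd (a (m i) - b (m i)) (m i)" "m i"] i by (simp add: y_def psub_apply)
      moreover have "rd (a (m i) - b (m i)) (m i) - (a (m i) - b (m i)) \<in> lat (m i)" by (rule rd_diff')
      moreover have "rd (b (m i) - a (m i)) (m i) - (b (m i) - a (m i)) \<in> lat (m i)" by (rule rd_diff')
      ultimately have "(x (m i) - rd (a (m i) - b (m i)) (m i) - c i (m i)) + (rd (a (m i) - b (m i)) (m i) - (a (m i) - b (m i)))
         + (rd (b (m i) - a (m i)) (m i) - (b (m i) - a (m i))) \<in> lat (m i)" by (intro lat_add)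
      then have "x (m i) - (c i (m i) - rd (b (m i) - a (m i)) (m i)) \<in> lat (m i)" by (simp add: algebra_simps)
      then have "c i (m i) - rd (b (m i) - a (m i)) (m i) - x (m i) \<in> lat (m i)" using lat_diff_commute by blast
      then have "c' i (m i) = x (m i)" unfolding c'_def psub_apply by (intro rd_eqI Qp_bounds xQ)
      then have "x \<in> rball (c' i (m i)) (m i)" using xQ by (simp add: rball_def)
      then show "x \<in> (\<Union>i. rball (c' i (m i)) (m i))" by blast
    qed
  qed
qed

text \<open>Translation invariance makes the measure of a ball depend on its radius only. Its exact value is
  never needed; positivity will come from the hypothesis that the compact open set has positive measure.\<close>

definition mu :: "int \<Rightarrow> real" where "mu n = measure (haar p) (rball 0 n)"

lemma emeasure_rball:
  assumes "x \<in> Qp p" shows "emeasure (haar p) (rball (x n) n) = ennreal (mu n)"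
proof -
  have e0: "emb 0 n = 0" by (simp add: emb_apply rd_id)
  have "emeasure (haar p) (rball (x n) n) = emeasure (haar p) (rball 0 n)"
    using outer_translate[OF assms emb_0, of n] outer_translate[OF emb_0 assms, of n]
    by (simp add: emeasure_haar e0)
  also have "\<dots> = ennreal (mu n)" unfolding mu_def
    using outer_rball[of 0 n] by (intro emeasure_eq_ennreal_measure) (auto simp: emeasure_haar mass_def top_unique)
  finally show ?thesis .
qed

lemma measure_rball: "x \<in> Qp p \<Longrightarrow> measure (haar p) (rball (x n) n) = mu n"
  using emeasure_rball[of x n] by (simp add: measure_def mu_def)

text \<open>With \<open>f = 1\<close> this turns integrals of functions of the residue into finite
  sums; a general \<open>f\<close> gives the finite Fourier sums in the completeness
  argument.\<close>

lemma set_integral_res: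
  fixes f :: "(int \<Rightarrow> rat) \<Rightarrow> complex"
  assumes X: "X = {x \<in> Qp p. x n \<in> res X n}" and fin: "finite (res X n)" and f: "set_integrable (haar p) X f"
  shows "(LINT x:X|haar p. f x * g (x n)) = (\<Sum>a\<in>res X n. (LINT x:rball a n|haar p. f x) * g a)"
    and "set_integrable (haar p) X (\<lambda>x. f x * g (x n))"
proof -
  have sub: "rball a n \<subseteq> X" if "a \<in> res X n" for a using X that unfolding rball_def by blast
  have fa: "integrable (haar p) (\<lambda>x. indicator (rball a n) x *\<^sub>R f x)" if "a \<in> res X n" for a
    using set_integrable_subset[OF f sets_rball sub[OF that]] by (simp add: set_integrable_def)
  have eq: "indicator X x *\<^sub>R (f x * g (x n)) = (\<Sum>a\<in>res X n. (indicator (rball a n) x *\<^sub>R f x) * g a)" if x: "x \<in> space (haar p)" for x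
  proof -
    have xQ: "x \<in> Qp p" using x by simp
    have "(\<Sum>a\<in>res X n. (indicator (rball a n) x *\<^sub>R f x) * g a) = (\<Sum>a\<in>res X n. if a = x n then f x * g (x n) else 0)"
      by (intro sum.cong refl) (use xQ in \<open>auto simp: rball_def\<close>)
    also have "\<dots> = (if x n \<in> res X n then f x * g (x n) else 0)" using fin by simp
    also have "x n \<in> res X n \<longleftrightarrow> x \<in> X" using X xQ by blast
    finally show ?thesis by simp
  qed
  have fga: "integrable (haar p) (\<lambda>x. (indicator (rball a n) x *\<^sub>R f x) * g a)" if "a \<in> res X n" for a
    by (intro integrable_mult_left fa that)
  show "set_integrable (haar p) X (\<lambda>x. f x * g (x n))"
    unfolding set_integrable_def
    by (subst Bochner_Integration.integrable_cong[OF refl eq]) (assumption, rule Bochner_Integration.integrable_sum[OF fga])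
  show "(LINT x:X|haar p. f x * g (x n)) = (\<Sum>a\<in>res X n. (LINT x:rball a n|haar p. f x) * g a)"
    unfolding set_lebesgue_integral_def
    by (subst Bochner_Integration.integral_cong[OF refl eq], assumption, subst Bochner_Integration.integral_sum[OF fga])
       (simp_all only: integral_mult_left_zero)
qed

end

section \<open>Compact open sets\<close>

locale compact_open_set = padic +
  fixes \<Omega> :: "(int \<Rightarrow> rat) set" and M N :: int
  assumes MN: "- M \<le> N" and Om: "\<Omega> = {x \<in> Qp p. x N \<in> res \<Omega> N}" and ins: "inside (- M) \<Omega>"
    and pos: "emeasure (haar p) \<Omega> > 0"
begin

lemma Om_ne: "\<Omega> \<noteq> {}" using pos by auto

lemma Om_Qp: "x \<in> \<Omega> \<Longrightarrow> x \<in> Qp p" using insideD(2)[OF ins] .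

lemma Om_period: "N \<le> n \<Longrightarrow> x \<in> Qp p \<Longrightarrow> x n \<in> res \<Omega> n \<Longrightarrow> x \<in> \<Omega>"
proof -
  assume n: "N \<le> n" and x: "x \<in> Qp p" "x n \<in> res \<Omega> n"
  then obtain y where y: "y \<in> \<Omega>" "x n = y n" by (auto simp: res_def)
  then have "x N = y N" using Qp_eq_mono[OF x(1) Om_Qp[OF y(1)] y(2) n] by simp
  then have "x N \<in> res \<Omega> N" using y(1) by (simp add: res_def)
  then show ?thesis using x(1) Om by blast
qed

lemma Om_level: "N \<le> n \<Longrightarrow> \<Omega> = {x \<in> Qp p. x n \<in> res \<Omega> n}"
  using Om_period Om_Qp by (auto simp: res_def)

lemma Om_sets [simp]: "\<Omega> \<in> sets (haar p)"
  using sets_res[of N "res \<Omega> N"] Om by simp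

lemma Om_space: "\<Omega> \<inter> space (haar p) \<in> sets (haar p)"
  using Om_sets by (rule sets.Int[OF _ sets.top])

lemma integrable_restrict_Om:
  fixes f :: "(int \<Rightarrow> rat) \<Rightarrow> 'a :: {banach, second_countable_topology}"
  shows "integrable (restrict_space (haar p) \<Omega>) f \<longleftrightarrow> set_integrable (haar p) \<Omega> f"
  by (subst integrable_restrict_space[OF Om_space]) (simp add: set_integrable_def)

lemma fin_res: "finite (res \<Omega> n)" by (rule finite_res[OF ins])

lemma res_Qp: "a \<in> res \<Omega> n \<Longrightarrow> \<exists>x\<in>\<Omega>. x \<in> Qp p \<and> a = x n" using Om_Qp by (auto simp: res_def)

lemma measure_rball_res: "a \<in> res \<Omega> n \<Longrightarrow> measure (haar p) (rball a n) = mu n"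
  using res_Qp measure_rball by blast

lemma emeasure_Om_finite: "emeasure (haar p) \<Omega> < \<infinity>"
proof -
  have "\<Omega> \<subseteq> (\<Union>a\<in>res \<Omega> N. rball a N)" using Om_Qp by (auto simp: rball_def res_def)
  then have "outer \<Omega> \<le> outer (\<Union>a\<in>res \<Omega> N. rball a N)" by (rule outer_mono)
  also have "\<dots> \<le> (\<Sum>a\<in>res \<Omega> N. outer (rball a N))" by (rule outer_finite_UN_le[OF fin_res])
  also have "\<dots> \<le> (\<Sum>a\<in>res \<Omega> N. mass N)" by (intro sum_mono outer_rball)
  also have "\<dots> < \<infinity>" by (auto simp: mass_def ennreal_mult_less_top of_nat_less_top)
  finally show ?thesis by (simp add: emeasure_haar)
qed

lemma integrable_one: "set_integrable (haar p) \<Omega> (\<lambda>x. 1 :: complex)"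
  unfolding set_integrable_def using emeasure_Om_finite by (auto intro!: integrable_real_indicator integrable_scaleR_left)

lemma integral_level:
  fixes g :: "rat \<Rightarrow> complex"
  assumes "N \<le> n"
  shows "(LINT x:\<Omega>|haar p. g (x n)) = (\<Sum>a\<in>res \<Omega> n. g a) * mu n"
    and "set_integrable (haar p) \<Omega> (\<lambda>x. g (x n))"
proof -
  have "(LINT x:rball a n|haar p. (1::complex)) = mu n" if "a \<in> res \<Omega> n" for a
  proof -
    have "emeasure (haar p) (rball a n) < \<infinity>" using res_Qp[OF that] emeasure_rball by auto
    then show ?thesis using measure_rball_res[OF that] by (simp add: set_integral_const scaleR_conv_of_real)
  qed
  then show "(LINT x:\<Omega>|haar p. g (x n)) = (\<Sum>a\<in>res \<Omega> n. g a) * mu n"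
    using set_integral_res(1)[OF Om_level[OF assms] fin_res integrable_one, of g]
    by (simp add: sum_distrib_right) (simp add: mult.commute)
  show "set_integrable (haar p) \<Omega> (\<lambda>x. g (x n))"
    using set_integral_res(2)[OF Om_level[OF assms] fin_res integrable_one, of g] by simp
qed

lemma measure_Om: "measure (haar p) \<Omega> = card (res \<Omega> N) * mu N"
proof -
  have "complex_of_real (measure (haar p) \<Omega>) = (LINT x:\<Omega>|haar p. 1)"
    using emeasure_Om_finite by (simp add: set_integral_const scaleR_conv_of_real)
  also have "\<dots> = complex_of_real (card (res \<Omega> N) * mu N)" using integral_level(1)[of N "\<lambda>_. 1"] by simp
  finally show ?thesis by (simp only: of_real_eq_iff)
qed

lemma measure_Om_pos: "measure (haar p) \<Omega> > 0"
  using pos emeasure_Om_finite by (simp add: measure_def enn2real_positive_iff)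

lemma mu_pos: "mu N > 0" and card_pos: "card (res \<Omega> N) > 0"
proof -
  show "card (res \<Omega> N) > 0" using fin_res Om_ne by (simp add: card_gt_0_iff res_def)
  then show "mu N > 0" using measure_Om measure_Om_pos by (simp add: zero_less_mult_iff)
qed

text \<open>Balls at level \<open>N\<close> have positive measure, so a property constant on such a
  ball and true almost everywhere cannot fail there. This removes null sets from both the tiling
  condition and completeness.\<close>

lemma AE_level:
  assumes ae: "AE x in haar p. Q x" and x: "x \<in> Qp p" and Q: "\<And>y. y \<in> Qp p \<Longrightarrow> y N = x N \<Longrightarrow> Q y \<longleftrightarrow> Q x"
  shows "Q x"
proof (rule ccontr)
  assume "\<not> Q x"
  obtain Z where Z: "{x \<in> space (haar p). \<not> Q x} \<subseteq> Z" "emeasure (haar p) Z = 0" "Z \<in> sets (haar p)"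
    using AE_E[OF ae] by metis
  have "rball (x N) N \<subseteq> {x \<in> space (haar p). \<not> Q x}" using Q \<open>\<not> Q x\<close> by (auto simp: rball_def)
  then have "emeasure (haar p) (rball (x N) N) \<le> emeasure (haar p) Z" using Z by (intro emeasure_mono) auto
  then show False using Z(2) mu_pos by (simp add: emeasure_rball[OF x])
qed

lemma infsum_indicator_eq_1:
  "(\<Sum>\<^sub>\<infinity>t\<in>T. (indicator \<Omega> (psub p x t) :: ennreal)) = 1 \<longleftrightarrow> (\<exists>!t. t \<in> T \<and> psub p x t \<in> \<Omega>)"
proof -
  let ?f = "\<lambda>t. (indicator \<Omega> (psub p x t) :: ennreal)"
  define S where "S = {t \<in> T. psub p x t \<in> \<Omega>}"
  have eq: "infsum ?f T = infsum (\<lambda>t. 1) S" by (rule infsum_cong_neutral) (auto simp: S_def)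
  consider "S = {}" | t where "S = {t}" | s t where "s \<in> S" "t \<in> S" "s \<noteq> t" by blast
  then show ?thesis
  proof cases
    case 1
    then have "infsum ?f T = 0" using eq by simp
    moreover have "\<not> (\<exists>!t. t \<in> T \<and> psub p x t \<in> \<Omega>)" using 1 by (auto simp: S_def)
    ultimately show ?thesis by simp
  next
    case (2 t)
    then have "infsum ?f T = 1" using eq by simp
    moreover have "s \<in> T \<and> psub p x s \<in> \<Omega> \<longleftrightarrow> s = t" for s using 2 unfolding S_def by blast
    then have "\<exists>!t. t \<in> T \<and> psub p x t \<in> \<Omega>" by simp
    ultimately show ?thesis by simp
  next
    case (3 s t)
    have "infsum (\<lambda>t. 1 :: ennreal) {s, t} \<le> infsum (\<lambda>t. 1) S"
      using 3 by (intro infsum_mono_neutral nonneg_summable_on_complete) auto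
    then have "2 \<le> infsum ?f T" using 3 eq by simp
    then have "infsum ?f T \<noteq> 1" by auto
    moreover have "\<not> (\<exists>!t. t \<in> T \<and> psub p x t \<in> \<Omega>)" using 3 by (auto simp: S_def)
    ultimately show ?thesis by simp
  qed
qed

text \<open>For fixed \<open>t\<close>, membership of \<open>psub p x t\<close> in \<Omega> depends
  on \<open>x N\<close> only, so \<open>AE_level\<close> applies to the tiling condition.\<close>

lemma tiles_iff: "tiles p \<Omega> \<longleftrightarrow> (\<exists>T\<subseteq>Qp p. \<forall>x\<in>Qp p. \<exists>!t. t \<in> T \<and> psub p x t \<in> \<Omega>)"
proof -
  have "(AE x in haar p. \<exists>!t. t \<in> T \<and> psub p x t \<in> \<Omega>) \<longleftrightarrow> (\<forall>x\<in>Qp p. \<exists>!t. t \<in> T \<and> psub p x t \<in> \<Omega>)"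
    if T: "T \<subseteq> Qp p" for T
  proof
    assume ae: "AE x in haar p. \<exists>!t. t \<in> T \<and> psub p x t \<in> \<Omega>"
    show "\<forall>x\<in>Qp p. \<exists>!t. t \<in> T \<and> psub p x t \<in> \<Omega>"
    proof
      fix x assume x: "x \<in> Qp p"
      show "\<exists>!t. t \<in> T \<and> psub p x t \<in> \<Omega>"
      proof (rule AE_level[OF ae x])
        fix y assume y: "y \<in> Qp p" "y N = x N"
        have "psub p y t \<in> \<Omega> \<longleftrightarrow> psub p x t \<in> \<Omega>" if "t \<in> T" for t
        proof -
          have tQ: "t \<in> Qp p" using that T by blast
          have iff: "psub p z t \<in> \<Omega> \<longleftrightarrow> psub p z t N \<in> res \<Omega> N" if "z \<in> Qp p" for z
            using psub_Qp[OF that tQ] Om by blast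
          show ?thesis unfolding iff[OF y(1)] iff[OF x] psub_apply y(2) ..
        qed
        then have "(t \<in> T \<and> psub p y t \<in> \<Omega>) = (t \<in> T \<and> psub p x t \<in> \<Omega>)" for t by blast
        then show "(\<exists>!t. t \<in> T \<and> psub p y t \<in> \<Omega>) \<longleftrightarrow> (\<exists>!t. t \<in> T \<and> psub p x t \<in> \<Omega>)" by (simp only:)
      qed
    qed
  next
    assume "\<forall>x\<in>Qp p. \<exists>!t. t \<in> T \<and> psub p x t \<in> \<Omega>"
    then show "AE x in haar p. \<exists>!t. t \<in> T \<and> psub p x t \<in> \<Omega>" by (intro AE_I2) (simp only: space_haar)
  qed
  then show ?thesis unfolding tiles_def infsum_indicator_eq_1 by (intro ex_cong1 conj_cong refl) blast
qed

lemma homog_iff_tiles: "(\<exists>J. homog \<Omega> J) \<longleftrightarrow> tiles p \<Omega>"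
proof
  assume "\<exists>J. homog \<Omega> J"
  then obtain J where "homog \<Omega> J" by blast
  then have "\<forall>x\<in>Qp p. \<exists>!t. t \<in> Dig (- J) \<and> psub p x t \<in> \<Omega>" by (intro ballI homog_imp_tiling[OF _ Om Om_ne ins MN])
  then show "tiles p \<Omega>" unfolding tiles_iff by (intro exI[of _ "Dig (- J)"]) (auto simp: Dig_def)
next
  assume "tiles p \<Omega>"
  then obtain T where T: "T \<subseteq> Qp p" "\<forall>x\<in>Qp p. \<exists>!t. t \<in> T \<and> psub p x t \<in> \<Omega>" unfolding tiles_iff by (elim exE conjE)
  show "\<exists>J. homog \<Omega> J" by (rule tiling_imp_homog[OF Om Om_ne ins MN T(1)]) (rule T(2)[THEN bspec])
qed

section \<open>Spectral sets and homogeneity\<close>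

lemma chi_Om: "l \<in> Qp p \<Longrightarrow> l (- A) = 0 \<Longrightarrow> x \<in> \<Omega> \<Longrightarrow> pchi_y p l x = e (l M * x A)"
  by (rule chi_eq[OF _ _ Om_Qp insideD(3)[OF ins]]) auto

text \<open>The functions on \<Omega> that are constant on balls of radius p^(-N) form a space of
  dimension \<open>card C\<close>, and the characters of \<open>\<Lambda>0\<close> form an
  orthogonal basis of it. The function \<open>g\<close> extracts the equality of dimensions from
  completeness; then the distances within \<open>\<Lambda>0\<close> bound its size.\<close>

lemma spectral_imp_homog:
  assumes "spectral_set p \<Omega>" shows "\<exists>J. homog \<Omega> J"
proof -
  define orthonormal where "orthonormal \<Lambda> \<longleftrightarrow> (\<forall>l\<in>\<Lambda>. \<forall>m\<in>\<Lambda>.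
      (LINT x:\<Omega>|haar p. pchi_y p l x * cnj (pchi_y p m x)) / measure (haar p) \<Omega> = (if l = m then 1 else 0))" for \<Lambda>
  define complete where "complete \<Lambda> \<longleftrightarrow> (\<forall>f :: (int \<Rightarrow> rat) \<Rightarrow> complex.
      f \<in> borel_measurable (restrict_space (haar p) \<Omega>) \<and>
      integrable (restrict_space (haar p) \<Omega>) (\<lambda>x. (cmod (f x))\<^sup>2) \<and>
      (\<forall>l\<in>\<Lambda>. (LINT x:\<Omega>|haar p. f x * cnj (pchi_y p l x)) = 0) \<longrightarrow>
      (AE x in restrict_space (haar p) \<Omega>. f x = 0))" for \<Lambda>
  have "\<exists>\<Lambda>\<subseteq>Qp p. orthonormal \<Lambda> \<and> complete \<Lambda>"
    using assms unfolding spectral_set_def orthonormal_def complete_def by (elim conjE)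
  then obtain \<Lambda> where \<Lambda>: "\<Lambda> \<subseteq> Qp p" and on: "orthonormal \<Lambda>" and co: "complete \<Lambda>" by blast
  have orth: "(LINT x:\<Omega>|haar p. pchi_y p l x * cnj (pchi_y p m x)) / measure (haar p) \<Omega> = (if l = m then 1 else 0)"
    if "l \<in> \<Lambda>" "m \<in> \<Lambda>" for l m
    using on that unfolding orthonormal_def by (elim ballE) auto
  have compl: "AE x in restrict_space (haar p) \<Omega>. f x = 0"
    if "f \<in> borel_measurable (restrict_space (haar p) \<Omega>)"
      "integrable (restrict_space (haar p) \<Omega>) (\<lambda>x. (cmod (f x))\<^sup>2)"
      "\<And>l. l \<in> \<Lambda> \<Longrightarrow> (LINT x:\<Omega>|haar p. f x * cnj (pchi_y p l x)) = 0" for f :: "(int \<Rightarrow> rat) \<Rightarrow> complex"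
    using co[unfolded complete_def, THEN spec, of f, THEN mp] that by simp
  define C where "C = res \<Omega> N"
  have finC: "finite C" and cardC: "card C > 0" using fin_res card_pos by (simp_all add: C_def)
  \<comment> \<open>These are frequencies in p^(-N) Z_p, whose characters are constant on balls of
    radius p^(-N).\<close>
  define \<Lambda>0 where "\<Lambda>0 = {l \<in> \<Lambda>. l (- N) = 0}"
  have ins0: "inside (- N) \<Lambda>0" using \<Lambda> by (intro insideI) (auto simp: \<Lambda>0_def)
  have sum_orth: "(\<Sum>c\<in>C. e ((l M - m M) * c)) = (if l = m then of_nat (card C) else 0)"
    if "l \<in> \<Lambda>0" "m \<in> \<Lambda>0" for l m
  proof -
    have lm: "l \<in> \<Lambda>" "m \<in> \<Lambda>" "l \<in> Qp p" "m \<in> Qp p" "l (- N) = 0" "m (- N) = 0"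
      using that \<Lambda> by (auto simp: \<Lambda>0_def)
    have "(LINT x:\<Omega>|haar p. pchi_y p l x * cnj (pchi_y p m x)) = (LINT x:\<Omega>|haar p. e ((l M - m M) * x N))"
    proof (rule set_lebesgue_integral_cong[OF Om_sets], intro allI impI)
      fix x assume "x \<in> \<Omega>"
      then show "pchi_y p l x * cnj (pchi_y p m x) = e ((l M - m M) * x N)"
        using chi_Om[OF lm(3,5)] chi_Om[OF lm(4,6)] by (simp add: left_diff_distrib e_diff)
    qed
    also have "\<dots> = (\<Sum>c\<in>C. e ((l M - m M) * c)) * mu N"
      using integral_level(1)[of N "\<lambda>a. e ((l M - m M) * a)"] by (simp add: C_def)
    finally have "(\<Sum>c\<in>C. e ((l M - m M) * c)) * mu N / (card C * mu N) = (if l = m then 1 else 0)"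
      using orth[OF lm(1,2)] by (simp add: measure_Om C_def)
    then show ?thesis using mu_pos cardC by (auto simp: field_simps split: if_splits)
  qed
  \<comment> \<open>Frequencies that agree modulo p^M have equal characters on \<Omega>, so their
    inner product cannot vanish.\<close>
  have inj: "inj_on (\<lambda>l. l M) \<Lambda>0"
  proof (rule inj_onI, rule ccontr)
    fix l m assume lm: "l \<in> \<Lambda>0" "m \<in> \<Lambda>0" "l M = m M" "l \<noteq> m"
    then have "of_nat (card C) = (0 :: complex)" using sum_orth[OF lm(1,2)] by simp
    then show False using cardC by simp
  qed
  have fin0: "finite \<Lambda>0" using finite_res[OF ins0, of M] inj by (auto simp: res_def dest: finite_imageD)
  have card0: "card (res \<Lambda>0 M) = card \<Lambda>0" unfolding res_def by (rule card_image[OF inj])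
  obtain x0 where x0: "x0 \<in> \<Omega>" using Om_ne by blast
  define c where "c = x0 N"
  have cC: "c \<in> C" using x0 by (auto simp: c_def C_def res_def)
  txt \<open>\<open>g\<close> is the indicator of the ball around \<open>c\<close> minus its orthogonal projection to the
    span of the characters in \<open>\<Lambda>0\<close>; the remaining characters of \<open>\<Lambda>\<close> integrate to zero over each ball.\<close>
  define g where "g a = (if a = c then 1 else 0) - (\<Sum>l\<in>\<Lambda>0. e (l M * (a - c))) / of_nat (card C)" for a
  have "AE x in restrict_space (haar p) \<Omega>. g (x N) = 0"
  proof (rule compl)
    have "set_integrable (haar p) \<Omega> (\<lambda>x. g (x N))" by (rule integral_level(2)) simp
    then have "integrable (restrict_space (haar p) \<Omega>) (\<lambda>x. g (x N))"
      by (simp only: integrable_restrict_Om)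
    then show "(\<lambda>x. g (x N)) \<in> borel_measurable (restrict_space (haar p) \<Omega>)" by (rule borel_measurable_integrable)
    have "set_integrable (haar p) \<Omega> (\<lambda>x. complex_of_real ((cmod (g (x N)))\<^sup>2))"
      using integral_level(2)[of N "\<lambda>a. complex_of_real ((cmod (g a))\<^sup>2)"] by simp
    then have "integrable (restrict_space (haar p) \<Omega>) (\<lambda>x. complex_of_real ((cmod (g (x N)))\<^sup>2))"
      by (simp only: integrable_restrict_Om)
    then show "integrable (restrict_space (haar p) \<Omega>) (\<lambda>x. (cmod (g (x N)))\<^sup>2)"
      by (simp only: complex_of_real_integrable_eq)
    fix m assume m: "m \<in> \<Lambda>"
    have mQ: "m \<in> Qp p" using m \<Lambda> by blast
    show "(LINT x:\<Omega>|haar p. g (x N) * cnj (pchi_y p m x)) = 0"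
    proof (cases "m (- N) = 0")
      case True
      then have m0: "m \<in> \<Lambda>0" using m by (simp add: \<Lambda>0_def)
      have "(LINT x:\<Omega>|haar p. g (x N) * cnj (pchi_y p m x)) = (LINT x:\<Omega>|haar p. g (x N) * cnj (e (m M * x N)))"
        using chi_Om[OF mQ True] by (intro set_lebesgue_integral_cong Om_sets) auto
      also have "\<dots> = (\<Sum>a\<in>C. g a * cnj (e (m M * a))) * mu N"
        using integral_level(1)[of N "\<lambda>a. g a * cnj (e (m M * a))"] by (simp add: C_def)
      also have "(\<Sum>a\<in>C. g a * cnj (e (m M * a))) =
          (\<Sum>a\<in>C. (if a = c then cnj (e (m M * a)) else 0)) -
          (\<Sum>a\<in>C. \<Sum>l\<in>\<Lambda>0. e (l M * (a - c)) * cnj (e (m M * a))) / of_nat (card C)"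
        unfolding sum_divide_distrib sum_subtractf[symmetric]
        by (intro sum.cong refl) (auto simp: g_def left_diff_distrib sum_distrib_right sum_divide_distrib)
      also have "(\<Sum>a\<in>C. \<Sum>l\<in>\<Lambda>0. e (l M * (a - c)) * cnj (e (m M * a))) =
          (\<Sum>l\<in>\<Lambda>0. \<Sum>a\<in>C. cnj (e (l M * c)) * e ((l M - m M) * a))"
        by (subst sum.swap) (intro sum.cong refl, simp add: e_diff right_diff_distrib left_diff_distrib mult_ac)
      also have "\<dots> = (\<Sum>l\<in>\<Lambda>0. if l = m then cnj (e (l M * c)) * of_nat (card C) else 0)"
        unfolding sum_distrib_left[symmetric] by (intro sum.cong refl) (simp add: sum_orth m0)
      also have "\<dots> = cnj (e (m M * c)) * of_nat (card C)" using fin0 m0 by simp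
      also have "(\<Sum>a\<in>C. (if a = c then cnj (e (m M * a)) else 0)) = cnj (e (m M * c))" using finC cC by simp
      finally show ?thesis using cardC by simp
    next
      case False
      have "m (- N) \<noteq> emb 0 (- N)" using False by (simp add: emb_apply rd_id)
      \<comment> \<open>\<open>v\<close> is the valuation of \<open>m\<close>. The character is not
        constant on balls of radius p^(-N), so the integral is resolved at the finer level
        \<open>- v\<close> and its terms are grouped by residue modulo p^N.\<close>
      then obtain v where v: "v < - N" "m v = emb 0 v" "m (v + 1) \<noteq> emb 0 (v + 1)"
        using first_difference[OF mQ emb_0] by blast
      have e0: "emb 0 n = 0" for n by (simp add: emb_apply rd_id)
      have mM: "m M \<in> lat v" "m M \<notin> lat (v + 1)"
        using diff_exact_lat[OF mQ emb_0 v(2,3), of M] v(1) MN by (simp_all add: e0)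
      have NA: "N \<le> - v" using v by simp
      have "(LINT x:\<Omega>|haar p. g (x N) * cnj (pchi_y p m x)) =
          (LINT x:\<Omega>|haar p. g (rd (x (- v)) N) * cnj (e (m M * x (- v))))"
        using chi_Om[OF mQ, of "- v"] v(2) Qp_rd[OF Om_Qp NA] by (intro set_lebesgue_integral_cong Om_sets) (auto simp: e0)
      also have "\<dots> = (\<Sum>a\<in>res \<Omega> (- v). g (rd a N) * cnj (e (m M * a))) * mu (- v)"
        using integral_level(1)[OF NA, of "\<lambda>a. g (rd a N) * cnj (e (m M * a))"] by simp
      also have "(\<Sum>a\<in>res \<Omega> (- v). g (rd a N) * cnj (e (m M * a))) =
          (\<Sum>b\<in>C. \<Sum>a\<in>{a \<in> res \<Omega> (- v). rd a N = b}. g (rd a N) * cnj (e (m M * a)))"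
        using rd_res[OF insideD(1)[OF ins] NA] fin_res
        by (intro sum.group[symmetric]) (auto simp: C_def)
      also have "\<dots> = (\<Sum>b\<in>C. g b * (\<Sum>a\<in>res (rball b N) (- v). e (- m M * a)))"
      proof (rule sum.cong[OF refl])
        fix b assume b: "b \<in> C"
        have "{a \<in> res \<Omega> (- v). rd a N = b} = res (rball b N) (- v)"
        proof (intro equalityI subsetI)
          fix a assume "a \<in> {a \<in> res \<Omega> (- v). rd a N = b}"
          then obtain x where x: "x \<in> \<Omega>" "a = x (- v)" "rd a N = b" by (auto simp: res_def)
          then have "x \<in> rball b N" using Qp_rd[OF Om_Qp[OF x(1)] NA] Om_Qp by (simp add: rball_def)
          then show "a \<in> res (rball b N) (- v)" using x(2) by (simp add: res_def)
        next
          fix a assume "a \<in> res (rball b N) (- v)"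
          then obtain x where x: "x \<in> Qp p" "x N = b" "a = x (- v)" by (auto simp: res_def rball_def)
          then have "x \<in> \<Omega>" using Om b unfolding C_def by blast
          then show "a \<in> {a \<in> res \<Omega> (- v). rd a N = b}" using x Qp_rd[OF x(1) NA] by (auto simp: res_def)
        qed
        then show "(\<Sum>a\<in>{a \<in> res \<Omega> (- v). rd a N = b}. g (rd a N) * cnj (e (m M * a))) =
            g b * (\<Sum>a\<in>res (rball b N) (- v). e (- m M * a))"
          by (auto simp: sum_distrib_left cnj_e intro!: sum.cong)
      qed
      also have "\<dots> = 0"
      proof (rule sum.neutral, rule ballI)
        fix b assume "b \<in> C"
        have "inside (- M) (rball b N)"
        proof -
          have "rball b N \<subseteq> \<Omega>" using Om \<open>b \<in> C\<close> unfolding rball_def C_def by blast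
          then show ?thesis using ins unfolding inside_def by blast
        qed
        then have "(\<Sum>a\<in>res (rball b N) (- v). e (- m M * a)) = 0"
          using mM v(1) by (intro homog_vanishing_sum[OF homog_ball, of "- M" _ _ "- v - 1"]) (auto simp: add.commute)
        then show "g b * (\<Sum>a\<in>res (rball b N) (- v). e (- m M * a)) = 0" by simp
      qed
      finally show ?thesis by simp
    qed
  qed
  then have "AE x in haar p. x \<in> \<Omega> \<longrightarrow> g (x N) = 0"
    by (simp only: AE_restrict_space_iff[OF Om_space])
  then have "x0 \<in> \<Omega> \<longrightarrow> g (x0 N) = 0"
  proof (rule AE_level[OF _ Om_Qp[OF x0]])
    fix y assume y: "y \<in> Qp p" "y N = x0 N"
    then have "y \<in> \<Omega>" using Om_period[of N y] x0 by (simp add: res_def)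
    then show "(y \<in> \<Omega> \<longrightarrow> g (y N) = 0) = (x0 \<in> \<Omega> \<longrightarrow> g (x0 N) = 0)" using x0 y(2) by simp
  qed
  then have "g c = 0" using x0 by (simp add: c_def)
  \<comment> \<open>All exponentials in \<open>g c\<close> equal 1, so \<open>g c\<close> is 1 minus
    the quotient of the two cardinalities.\<close>
  then have "of_nat (card \<Lambda>0) = (of_nat (card C) :: complex)" using cardC by (simp add: g_def)
  then have eqC: "card \<Lambda>0 = card C" by simp
  then have ne0: "\<Lambda>0 \<noteq> {}" using cardC by auto
  define S where "S = {n \<in> {- M<..N}. equid M N \<Omega> n}"
  \<comment> \<open>A first difference at digit \<open>k\<close> yields a character of conductor
    p^(-k), hence equidistribution at level \<open>- k\<close>.\<close>
  define K where "K = {k. - k \<in> S}"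
  have "card (res \<Lambda>0 M) \<le> p ^ card (K \<inter> {- N..<M})"
  proof (rule card_res_upper[OF ins0 ne0])
    show "- N \<le> M" using MN by simp
    fix l m k assume lm: "l \<in> \<Lambda>0" "m \<in> \<Lambda>0" "l k = m k" "l (k + 1) \<noteq> m (k + 1)"
    have Q: "l \<in> Qp p" "m \<in> Qp p" "l (- N) = 0" "m (- N) = 0" using lm insideD[OF ins0] by blast+
    have "l \<noteq> m" using lm by auto
    have "k + 1 \<le> M"
    proof (rule ccontr)
      assume "\<not> k + 1 \<le> M"
      then have "l M = m M" using Qp_eq_mono[OF Q(1,2) lm(3), of M] by simp
      then show False using inj lm(1,2) \<open>l \<noteq> m\<close> by (auto simp: inj_on_def)
    qed
    have "- N \<le> k"
    proof (rule ccontr)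
      assume "\<not> - N \<le> k"
      then have "l (k + 1) = m (k + 1)" using Qp_eq_mono[OF Q(1,2), of "- N" "k + 1"] Q by simp
      then show False using lm by simp
    qed
    have q: "l M - m M \<in> lat (- (- k))" "l M - m M \<notin> lat (- (- k) + 1)"
      using diff_exact_lat[OF Q(1,2) lm(3,4) \<open>k + 1 \<le> M\<close>] by simp_all
    have "(\<Sum>a\<in>res \<Omega> N. e ((l M - m M) * a)) = 0" using sum_orth[OF lm(1,2)] \<open>l \<noteq> m\<close> by (simp add: C_def)
    then have "equid M N \<Omega> (- k)" using vanishing_sum_equid[OF ins _ q] \<open>k + 1 \<le> M\<close> by simp
    then show "k \<in> K" using \<open>k + 1 \<le> M\<close> \<open>- N \<le> k\<close> by (simp add: K_def S_def)
  qed
  also have "\<dots> \<le> p ^ card S"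
  proof -
    have "finite S" by (rule finite_subset[of _ "{- M<..N}"]) (auto simp: S_def)
    then have "card (K \<inter> {- N..<M}) \<le> card S"
      by (intro card_inj_on_le[of uminus]) (auto simp: K_def)
    then show ?thesis using p_gt_1 by (intro power_increasing) auto
  qed
  finally have "card (res \<Omega> N) \<le> p ^ card S" using card0 eqC by (simp add: C_def)
  moreover have "S \<subseteq> {- M<..N}" and "\<And>n. n \<in> S \<Longrightarrow> equid M N \<Omega> n" by (auto simp: S_def)
  ultimately show ?thesis using homog_if_card_le[OF Om Om_ne ins MN] by blast
qed

text \<open>Points and frequencies exchange roles. The first difference \<open>n\<close> of two
  points of \<Omega> lies in \<open>J\<close>, so the digit set branches at the dual position -1-n.
  In terms of the matrix of character values, \<open>homog_orthogonal\<close> is orthogonality of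
  the rows and this is orthogonality of the columns, which gives completeness.\<close>

lemma dual_vanishing_sum:
  assumes h: "homog \<Omega> J" and R: "N \<le> R" and c: "c \<in> res \<Omega> R" "c' \<in> res \<Omega> R" "c \<noteq> c'"
  shows "(\<Sum>b\<in>res (Dig ({k. - 1 - k \<in> J} \<inter> {- R..})) M. e ((c - c') * b)) = 0"
proof -
  obtain x y where xy: "x \<in> \<Omega>" "y \<in> \<Omega>" "c = x R" "c' = y R" using c by (auto simp: res_def)
  have Q: "x \<in> Qp p" "y \<in> Qp p" using xy Om_Qp by auto
  obtain n where n: "n < R" "x n = y n" "x (n + 1) \<noteq> y (n + 1)"
    using first_difference[OF Q, of R] c(3) xy by blast
  have nJ: "n \<in> J" using homog_unique[OF h _ xy(1,2) n(2)] n(3) by blast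
  have nM: "- M \<le> n" using homog_low[OF h ins Om_ne, of n] nJ by linarith
  have q: "c - c' \<in> lat (- ((- 1 - n) + 1))" "c - c' \<notin> lat (- (- 1 - n))"
    using diff_exact_lat[OF Q n(2,3), of R] n(1) xy by (simp_all add: add.commute)
  show ?thesis
  proof (rule homog_vanishing_sum[OF homog_Dig _ _ _ q])
    show "inside (- R) (Dig ({k. - 1 - k \<in> J} \<inter> {- R..}))"
      unfolding Dig_restrict[symmetric] by (rule insideI) (auto simp: Dig_def)
  qed (use nJ n(1) nM in auto)
qed

text \<open>If \<open>l\<close> and \<open>m\<close> first differ at \<open>k\<close>, one of them
  has a nonzero digit there, so \<Omega> branches at -1-k, exactly where the character of the
  difference detects it.\<close>

lemma homog_orthogonal:
  assumes h: "homog \<Omega> J" and l: "l \<in> Dig {k. - 1 - k \<in> J}" and m: "m \<in> Dig {k. - 1 - k \<in> J}" and "l \<noteq> m"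
  shows "(LINT x:\<Omega>|haar p. pchi_y p l x * cnj (pchi_y p m x)) = 0"
proof -
  have Q: "l \<in> Qp p" "m \<in> Qp p" using l m by (auto simp: Dig_def)
  obtain i where "l i \<noteq> m i" using \<open>l \<noteq> m\<close> by blast
  then obtain k where k: "l k = m k" "l (k + 1) \<noteq> m (k + 1)" using first_difference[OF Q] by blast
  define n where "n = - 1 - k"
  have "l (k + 1) \<noteq> l k \<or> m (k + 1) \<noteq> m k" using k by auto
  then have nJ: "n \<in> J" using l m by (auto simp: Dig_def n_def)
  have nM: "- M \<le> n" using homog_low[OF h ins Om_ne, of n] nJ by linarith
  obtain B1 B2 where B: "l B1 = 0" "m B2 = 0" using Qp_zero Q by blast
  \<comment> \<open>Large enough for both characters to be read off from \<open>x A\<close>, for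
    \<Omega> to be a union of balls of that level, and for the branching at \<open>n\<close> to be
    visible.\<close>
  define A where "A = max (max N (n + 1)) (max (- B1) (- B2))"
  have A: "l (- A) = 0" "m (- A) = 0" "N \<le> A" "n + 1 \<le> A"
    using Qp_zero_mono[OF Q(1) B(1), of "- A"] Qp_zero_mono[OF Q(2) B(2), of "- A"] by (auto simp: A_def)
  have q: "l M - m M \<in> lat (- (n + 1))" "l M - m M \<notin> lat (- n)"
    using diff_exact_lat[OF Q k, of M] nM by (simp_all add: n_def add.commute)
  have "(LINT x:\<Omega>|haar p. pchi_y p l x * cnj (pchi_y p m x)) = (LINT x:\<Omega>|haar p. e ((l M - m M) * x A))"
  proof (rule set_lebesgue_integral_cong[OF Om_sets], intro allI impI)
    fix x assume "x \<in> \<Omega>"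
    then show "pchi_y p l x * cnj (pchi_y p m x) = e ((l M - m M) * x A)"
      using chi_Om[OF Q(1) A(1)] chi_Om[OF Q(2) A(2)] by (simp add: left_diff_distrib e_diff)
  qed
  also have "\<dots> = (\<Sum>b\<in>res \<Omega> A. e ((l M - m M) * b)) * mu A"
    by (rule integral_level(1)[OF A(3)])
  also have "(\<Sum>b\<in>res \<Omega> A. e ((l M - m M) * b)) = 0"
    by (rule homog_vanishing_sum[OF h ins nJ A(4) q])
  finally show ?thesis by simp
qed

lemma integral_chi_self: "(LINT x:\<Omega>|haar p. pchi_y p l x * cnj (pchi_y p l x)) = measure (haar p) \<Omega>"
proof -
  have "pchi_y p l x * cnj (pchi_y p l x) = 1" for x
    by (simp add: pchi_y_def pchi_def complex_norm_square[symmetric])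
  then have "(LINT x:\<Omega>|haar p. pchi_y p l x * cnj (pchi_y p l x)) = (LINT x:\<Omega>|haar p. 1)" by simp
  also have "\<dots> = measure (haar p) \<Omega>"
    using emeasure_Om_finite by (simp add: set_integral_const scaleR_conv_of_real)
  finally show ?thesis .
qed

text \<open>Fourier inversion at level \<open>R\<close>: the vanishing coefficients are multiplied
  by \<open>e (b * c)\<close> and summed over the frequencies, and \<open>dual_vanishing_sum\<close>
  leaves only the ball at \<open>c\<close>.\<close>

lemma homog_ball_integral_zero:
  assumes h: "homog \<Omega> J" and f: "set_integrable (haar p) \<Omega> f"
    and f0: "\<And>l. l \<in> Dig {k. - 1 - k \<in> J} \<Longrightarrow> (LINT x:\<Omega>|haar p. f x * cnj (pchi_y p l x)) = 0"
    and R: "N \<le> R" and c: "c \<in> res \<Omega> R"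
  shows "(LINT x:rball c R|haar p. f x) = 0"
proof -
  define X where "X = Dig ({k. - 1 - k \<in> J} \<inter> {- R..})"
  have X: "X = {l \<in> Dig {k. - 1 - k \<in> J}. l (- R) = 0}" unfolding X_def by (rule Dig_restrict[symmetric])
  have insX: "inside (- R) X" unfolding X by (rule insideI) (auto simp: Dig_def)
  define I where "I a = (LINT x:rball a R|haar p. f x)" for a
  have 0: "(\<Sum>a\<in>res \<Omega> R. I a * e (- (b * a))) = 0" if b: "b \<in> res X M" for b
  proof -
    obtain l where l: "l \<in> X" "b = l M" using b by (auto simp: res_def)
    have lD: "l \<in> Dig {k. - 1 - k \<in> J}" "l \<in> Qp p" "l (- R) = 0" using l X by (auto simp: Dig_def)
    have "(LINT x:\<Omega>|haar p. f x * cnj (pchi_y p l x)) = (LINT x:\<Omega>|haar p. f x * e (- (b * x R)))"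
      using chi_Om[OF lD(2,3)] l(2) by (intro set_lebesgue_integral_cong Om_sets) (auto simp: cnj_e)
    also have "\<dots> = (\<Sum>a\<in>res \<Omega> R. I a * e (- (b * a)))"
      unfolding I_def by (rule set_integral_res(1)[OF Om_level[OF R] fin_res f])
    finally show ?thesis using f0[OF lD(1)] by simp
  qed
  have "0 = (\<Sum>b\<in>res X M. e (b * c) * (\<Sum>a\<in>res \<Omega> R. I a * e (- (b * a))))" using 0 by simp
  also have "\<dots> = (\<Sum>b\<in>res X M. \<Sum>a\<in>res \<Omega> R. I a * e ((c - a) * b))"
    unfolding sum_distrib_left
  proof (intro sum.cong refl)
    fix b a
    have "e ((c - a) * b) = e (b * c) * e (- (b * a))" by (simp add: e_add[symmetric] algebra_simps)
    then show "e (b * c) * (I a * e (- (b * a))) = I a * e ((c - a) * b)" by simp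
  qed
  also have "\<dots> = (\<Sum>a\<in>res \<Omega> R. I a * (\<Sum>b\<in>res X M. e ((c - a) * b)))"
    by (subst sum.swap) (simp add: sum_distrib_left)
  also have "\<dots> = (\<Sum>a\<in>res \<Omega> R. if a = c then I c * of_nat (card (res X M)) else 0)"
    by (intro sum.cong refl) (use dual_vanishing_sum[OF h R c] in \<open>auto simp: X_def\<close>)
  also have "\<dots> = I c * of_nat (card (res X M))" using c fin_res by simp
  finally have "I c * of_nat (card (res X M)) = 0" by simp
  moreover have "card (res X M) \<noteq> 0"
  proof -
    have "emb 0 n = 0" for n by (simp add: emb_apply rd_id)
    then have "emb 0 \<in> X" unfolding X Dig_def using emb_0 by simp
    then show ?thesis using finite_res[OF insX] by (auto simp: res_def)
  qed
  ultimately show ?thesis by (simp add: I_def)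
qed

text \<open>The balls of level at least \<open>N\<close>, with the empty set, are closed under
  intersection and generate the Borel sets. By Dynkin's argument the integral of \<open>f\<close>
  vanishes over every Borel part of \<Omega>.\<close>

lemma AE_zero_if_ball_integrals_zero:
  fixes f :: "(int \<Rightarrow> rat) \<Rightarrow> complex"
  assumes f: "set_integrable (haar p) \<Omega> f"
    and f0: "\<And>R c. N \<le> R \<Longrightarrow> c \<in> res \<Omega> R \<Longrightarrow> (LINT x:rball c R|haar p. f x) = 0"
  shows "AE x in restrict_space (haar p) \<Omega>. f x = 0"
proof -
  define G where "G = insert {} {rball v n |v n. N \<le> n}"
  have GQ: "G \<subseteq> Pow (Qp p)" by (auto simp: G_def rball_def)
  have sets_G: "sets (haar p) = sigma_sets (Qp p) G"
    unfolding sets_haar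
  proof (rule sigma_sets_eqI)
    fix U assume "U \<in> {U. openin (qp_topology p) U}"
    then obtain B where B: "countable B" "U = (\<Union>(v, n)\<in>B. rball v n)" "\<And>v n. (v, n) \<in> B \<Longrightarrow> N \<le> n"
      using openin_countable_union[of U N] by blast
    interpret sigma_algebra "Qp p" "sigma_sets (Qp p) G" by (rule sigma_algebra_sigma_sets[OF GQ])
    have "(case s of (v, n) \<Rightarrow> rball v n) \<in> sigma_sets (Qp p) G" if "s \<in> B" for s
      using B(3) that by (cases s) (auto simp: G_def intro!: sigma_sets.Basic)
    then show "U \<in> sigma_sets (Qp p) G" unfolding B(2) by (intro countable_UN'' B(1))
  next
    fix A assume "A \<in> G"
    then show "A \<in> sigma_sets (Qp p) {U. openin (qp_topology p) U}"
      unfolding G_def using openin_rball by (auto intro: sigma_sets.Empty sigma_sets.Basic)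
  qed
  have stable: "Int_stable G"
  proof (rule Int_stableI)
    fix A B assume A: "A \<in> G" and B: "B \<in> G"
    show "A \<inter> B \<in> G"
    proof (cases "A \<inter> B = {}")
      case False
      then obtain x where x: "x \<in> A" "x \<in> B" by blast
      then obtain v n w m where "A = rball v n" "B = rball w m" "N \<le> n" "N \<le> m"
        using A B by (auto simp: G_def)
      with x have *: "A = rball (x n) n" "B = rball (x m) m" "N \<le> n" "N \<le> m" "x \<in> Qp p"
        by (simp_all add: rball_def)
      have "A \<subseteq> B \<or> B \<subseteq> A" using rball_mono[OF *(5), of n m] rball_mono[OF *(5), of m n] * by (cases "n \<le> m") auto
      then have "A \<inter> B = A \<or> A \<inter> B = B" by blast
      then show ?thesis using A B by auto
    qed (simp add: G_def)
  qed
  have fsub: "set_integrable (haar p) (\<Omega> \<inter> A) f" if "A \<in> sets (haar p)" for A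
    by (rule set_integrable_subset[OF f]) (use that in auto)
  \<comment> \<open>The integral over all of \<Omega>, for complements in the induction below; the
    factor 1 matches the form of \<open>set_integral_res\<close>.\<close>
  have "(LINT x:\<Omega>|haar p. f x * 1) = (\<Sum>a\<in>res \<Omega> N. (LINT x:rball a N|haar p. f x) * 1)"
    by (rule set_integral_res(1)[OF Om fin_res f])
  then have fOm: "(LINT x:\<Omega>|haar p. f x) = 0" using f0[of N] by simp
  have zero: "(LINT x:\<Omega> \<inter> A|haar p. f x) = 0" if "A \<in> sets (haar p)" for A
    using stable GQ that[unfolded sets_G]
  proof (induction A rule: sigma_sets_induct_disjoint)
    case (basic A)
    then consider "A = {}" | v n where "A = rball v n" "N \<le> n" by (auto simp: G_def)
    then show ?case
    proof cases
      case (2 v n)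
      show ?thesis
      proof (cases "v \<in> res \<Omega> n")
        case True
        then have "rball v n \<subseteq> \<Omega>" using Om_level[OF 2(2)] unfolding rball_def by blast
        then have "\<Omega> \<inter> A = rball v n" using 2 by blast
        then show ?thesis using f0[OF 2(2) True] by simp
      next
        case False
        then have "\<Omega> \<inter> A = {}" using 2 by (auto simp: rball_def res_def)
        then show ?thesis by (simp add: set_lebesgue_integral_def)
      qed
    qed (simp add: set_lebesgue_integral_def)
  next
    case empty
    then show ?case by (simp add: set_lebesgue_integral_def)
  next
    case (compl A)
    have A: "A \<in> sets (haar p)" using compl sets_G by simp
    have "\<Omega> = (\<Omega> \<inter> A) \<union> (\<Omega> \<inter> (Qp p - A))" using Om_Qp by blast
    then have "(LINT x:\<Omega>|haar p. f x) = (LINT x:(\<Omega> \<inter> A) \<union> (\<Omega> \<inter> (Qp p - A))|haar p. f x)" by simp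
    also have "\<dots> = (LINT x:\<Omega> \<inter> A|haar p. f x) + (LINT x:\<Omega> \<inter> (Qp p - A)|haar p. f x)"
      using sets.compl_sets[OF A] by (intro set_integral_Un fsub A) auto
    finally show ?case using compl fOm by simp
  next
    case (union A)
    have A: "A i \<in> sets (haar p)" for i using union sets_G by auto
    have "\<Omega> \<inter> (\<Union>i. A i) = (\<Union>i. \<Omega> \<inter> A i)" by blast
    moreover have "(LINT x:(\<Union>i. \<Omega> \<inter> A i)|haar p. f x) = (\<Sum>i. (LINT x:\<Omega> \<inter> A i|haar p. f x))"
    proof (rule lebesgue_integral_countable_add)
      show "\<Omega> \<inter> A i \<in> sets (haar p)" for i by (rule sets.Int[OF Om_sets A])
      show "(\<Omega> \<inter> A i) \<inter> (\<Omega> \<inter> A j) = {}" if "i \<noteq> j" for i j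
        using union(1) that by (auto simp: disjoint_family_on_def)
      show "set_integrable (haar p) (\<Union>i. \<Omega> \<inter> A i) f"
        by (rule set_integrable_subset[OF f]) (use A in auto)
    qed
    ultimately show ?case using union by simp
  qed
  let ?R = "restrict_space (haar p) \<Omega>"
  have fin: "finite_measure ?R"
  proof (rule finite_measureI)
    have "\<Omega> \<inter> Qp p = \<Omega>" using Om by blast
    then show "emeasure ?R (space ?R) \<noteq> \<infinity>"
      using emeasure_Om_finite by (simp add: emeasure_restrict_space[OF Om_space] space_restrict_space)
  qed
  interpret R: finite_measure ?R by (rule fin)
  show ?thesis
  proof (rule R.density_zero)
    show "integrable ?R f" using f by (simp only: integrable_restrict_Om)
    fix A assume "A \<in> sets ?R"
    then obtain A' where A': "A' \<in> sets (haar p)" "A = \<Omega> \<inter> A'" by (auto simp: sets_restrict_space)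
    have "(LINT x:A|?R. f x) = (LINT x|haar p. indicator \<Omega> x *\<^sub>R (indicator A x *\<^sub>R f x))"
      unfolding set_lebesgue_integral_def by (rule integral_restrict_space[OF Om_space])
    also have "\<dots> = (LINT x:\<Omega> \<inter> A'|haar p. f x)"
      unfolding set_lebesgue_integral_def A'(2)
      by (intro Bochner_Integration.integral_cong refl) (auto simp: indicator_def)
    finally show "(LINT x:A|?R. f x) = 0" using zero[OF A'(1)] by simp
  qed
qed

lemma homog_imp_spectral:
  assumes h: "homog \<Omega> J" shows "spectral_set p \<Omega>"
  unfolding spectral_set_def
proof (intro conjI exI[of _ "Dig {k. - 1 - k \<in> J}"] ballI allI impI)
  show "Dig {k. - 1 - k \<in> J} \<subseteq> Qp p" by (auto simp: Dig_def)
  fix l m assume l: "l \<in> Dig {k. - 1 - k \<in> J}" and m: "m \<in> Dig {k. - 1 - k \<in> J}"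
  show "(LINT x:\<Omega>|haar p. pchi_y p l x * cnj (pchi_y p m x)) / measure (haar p) \<Omega> = (if l = m then 1 else 0)"
    using homog_orthogonal[OF h l m] integral_chi_self[of l] measure_Om_pos by (cases "l = m") simp_all
next
  fix f :: "(int \<Rightarrow> rat) \<Rightarrow> complex"
  let ?R = "restrict_space (haar p) \<Omega>"
  assume f: "f \<in> borel_measurable ?R \<and> integrable ?R (\<lambda>x. (cmod (f x))\<^sup>2) \<and>
    (\<forall>l\<in>Dig {k. - 1 - k \<in> J}. (LINT x:\<Omega>|haar p. f x * cnj (pchi_y p l x)) = 0)"
  have "integrable ?R (\<lambda>x. 1 :: complex)" using integrable_one by (simp only: integrable_restrict_Om)
  \<comment> \<open>On a finite measure space square integrable functions are integrable, by the
    bound |z| <= 1 + |z|^2.\<close>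
  then have "integrable ?R (\<lambda>x. 1 + (cmod (f x))\<^sup>2)"
    using f by (intro Bochner_Integration.integrable_add) (auto simp: complex_of_real_integrable_eq[of _ "\<lambda>_. 1", symmetric])
  then have "integrable ?R f"
  proof (rule Bochner_Integration.integrable_bound)
    have "cmod z \<le> norm (1 + (cmod z)\<^sup>2)" for z
    proof -
      have "2 * cmod z \<le> 1 + (cmod z)\<^sup>2" using sum_squares_bound[of "cmod z" 1] by (simp add: power2_eq_square)
      then have "cmod z \<le> 1 + (cmod z)\<^sup>2" using norm_ge_zero[of z] by linarith
      then show ?thesis by simp
    qed
    then show "AE x in ?R. norm (f x) \<le> norm (1 + (cmod (f x))\<^sup>2)" by (intro AE_I2)
  qed (use f in simp)
  then have "set_integrable (haar p) \<Omega> f" by (simp only: integrable_restrict_Om)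
  then show "AE x in ?R. f x = 0"
    using f by (intro AE_zero_if_ball_integrals_zero homog_ball_integral_zero[OF h]) auto
qed (use pos emeasure_Om_finite in auto)

lemma spectral_iff_homog: "spectral_set p \<Omega> \<longleftrightarrow> (\<exists>J. homog \<Omega> J)"
  using spectral_imp_homog homog_imp_spectral by blast

end

theorem theorem1p1:
  fixes p :: nat and \<Omega> :: "(int \<Rightarrow> rat) set"
  assumes "prime p"
    and "openin (qp_topology p) \<Omega>"
    and "compactin (qp_topology p) \<Omega>"
    and "emeasure (haar p) \<Omega> > 0"
  shows "(spectral_set p \<Omega> \<longleftrightarrow> p_homogeneous p \<Omega>) \<and> (p_homogeneous p \<Omega> \<longleftrightarrow> tiles p \<Omega>)"
proof -
  interpret padic p by unfold_locales (rule assms(1))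
  obtain M N where MN: "- M \<le> N" "\<Omega> = {x \<in> Qp p. x N \<in> res \<Omega> N}" "inside (- M) \<Omega>"
    using compact_open_structure[OF assms(2,3)] .
  interpret compact_open_set p \<Omega> M N by unfold_locales (use MN assms(4) in auto)
  show ?thesis
    using spectral_iff_homog homog_iff_tiles p_homogeneous_iff_homog[OF insideD(1)[OF ins]] by blast
qed

end
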